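(* Under the assumption FPT$\neq$W[1], M-EPVCB is not fixed-parameter tractable when parameterized by $|V|-2\nu_{ind}(G)$.
   Context: Graphs are finite, simple, undirected. A matching $M$ of $G$ is induced if $G$ contains no path with three edges whose first and third edges both belong to $M$; $\nu_{ind}(G)$ is the maximum size of an induced matching of $G$. For $V_0\subseteq V(G)$, $E(V_0)$ denotes the set of edges with at least one endpoint in $V_0$. M-EPVCB: given a bipartite graph $G=(V,E)$, an edge-weight function $w:E\to\mathbb{N}$ (positive integers), and positive integers $k_1,k_2,k_3$, decide whether there exists $V_0\subseteq V$ with $|V_0|\le k_1$ such that $\sum_{e\in E(V_0)}w(e)\ge k_2$ and $E(V_0)$ contains a matching $M$ with $\sum_{e\in M}w(e)\ge k_3$. *)

theory Defs
  imports Complex_Main "HOL-Library.Discrete_Functions"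
begin

section \<open>Machine model\<close>

text \<open>
  The machine is a unit-cost RAM on natural numbers with addition, truncated subtraction and
  indirect addressing, but without multiplication. Its memory is split into finitely many
  arrays (those named in the program), and its control flow is structured. For a fixed program,
  one step adds at most a constant number of bits to the longest number in memory. Hence running
  times agree with those of Turing machines up to a polynomial, when inputs are measured in bits.
\<close>

datatype exp =
    Const nat
  | Get nat exp  \<comment> \<open>array name and index\<close>
  | Add exp exp
  | Sub exp exp

datatype com =
    Skip
  | Put nat exp exp  \<comment> \<open>array name, index, new value\<close>
  | Seq com com
  | Cond exp com com
  | While exp com

type_synonym state = "nat \<Rightarrow> nat \<Rightarrow> nat"

fun eval :: "exp \<Rightarrow> state \<Rightarrow> nat" where
  "eval (Const n) s = n"
| "eval (Get a e) s = s a (eval e s)"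
| "eval (Add e1 e2) s = eval e1 s + eval e2 s"
| "eval (Sub e1 e2) s = eval e1 s - eval e2 s"

text \<open>
  \<open>exec P s t s'\<close>: started in \<open>s\<close>, the program \<open>P\<close> halts in \<open>s'\<close> after \<open>t\<close> steps. A test succeeds if
  its value is nonzero. Evaluating an expression is charged to the enclosing step, since
  its size is a constant of the program.
\<close>

inductive exec :: "com \<Rightarrow> state \<Rightarrow> nat \<Rightarrow> state \<Rightarrow> bool" where
  Skip: "exec Skip s 1 s"
| Put: "exec (Put a i e) s 1 (s(a := (s a)(eval i s := eval e s)))"
| Seq: "exec P s t s' \<Longrightarrow> exec Q s' u s'' \<Longrightarrow> exec (Seq P Q) s (t + u) s''"
| CondTrue: "eval e s \<noteq> 0 \<Longrightarrow> exec P s t s' \<Longrightarrow> exec (Cond e P Q) s (Suc t) s'"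
| CondFalse: "eval e s = 0 \<Longrightarrow> exec Q s t s' \<Longrightarrow> exec (Cond e P Q) s (Suc t) s'"
| WhileFalse: "eval e s = 0 \<Longrightarrow> exec (While e P) s 1 s"
| WhileTrue: "eval e s \<noteq> 0 \<Longrightarrow> exec P s t s' \<Longrightarrow> exec (While e P) s' u s''
    \<Longrightarrow> exec (While e P) s (Suc (t + u)) s''"

inductive_cases SkipE: "exec Skip s t s'"
  and PutE: "exec (Put a i e) s t s'"
  and SeqE: "exec (Seq P Q) s t s'"
  and CondE: "exec (Cond e P Q) s t s'"
  and WhileE: "exec (While e P) s t s'"

lemma exec_deterministic:
  "exec P s t s' \<Longrightarrow> exec P s u s'' \<Longrightarrow> t = u \<and> s' = s''"
proof (induction arbitrary: u s'' rule: exec.induct)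
  case (Skip s)
  then show ?case by (auto elim: SkipE)
next
  case (Put a i e s)
  then show ?case by (auto elim: PutE)
next
  case (Seq P s t s' Q v r)
  from Seq.prems obtain t1 t2 s1 where "exec P s t1 s1" "exec Q s1 t2 s''" "u = t1 + t2"
    by (rule SeqE)
  then show ?case using Seq.IH by blast
next
  case (CondTrue e s P t s' Q)
  from CondTrue.prems CondTrue.hyps(1) obtain v where "exec P s v s''" "u = Suc v"
    by (auto elim: CondE)
  then show ?case using CondTrue.IH by blast
next
  case (CondFalse e s Q t s' P)
  from CondFalse.prems CondFalse.hyps(1) obtain v where "exec Q s v s''" "u = Suc v"
    by (auto elim: CondE)
  then show ?case using CondFalse.IH by blast
next
  case (WhileFalse e s P)
  then show ?case by (auto elim: WhileE)
next
  case (WhileTrue e s P t s' v r)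
  from WhileTrue.prems WhileTrue.hyps(1) obtain t1 t2 s1
    where "exec P s t1 s1" "exec (While e P) s1 t2 s''" "u = Suc (t1 + t2)"
    by (auto elim: WhileE)
  then show ?case using WhileTrue.IH by blast
qed

text \<open>Input in array 0 and output in array 1: length at index 0, entries from index 1 on.\<close>

definition init :: "nat list \<Rightarrow> state" where
  "init xs = (\<lambda>a i. if a \<noteq> 0 then 0 else if i = 0 then length xs
     else if i \<le> length xs then xs ! (i - 1) else 0)"

definition result :: "state \<Rightarrow> nat list" where
  "result s = map (\<lambda>i. s 1 (Suc i)) [0..<s 1 0]"

text \<open>
  Writing an output entry costs one step. Without this charge, a program could announce an output
  of length \<open>2 ^ n\<close> in \<open>n\<close> steps, by doubling the length entry.
\<close>

definition computes :: "com \<Rightarrow> nat list \<Rightarrow> nat list \<Rightarrow> nat \<Rightarrow> bool" where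
  "computes P xs ys t \<longleftrightarrow> (\<exists>s u. exec P (init xs) u s \<and> result s = ys \<and> t = u + length ys)"

definition computable :: "(nat \<Rightarrow> nat) \<Rightarrow> bool" where
  "computable f \<longleftrightarrow> (\<exists>P. \<forall>n. \<exists>t. computes P [n] [f n] t)"

text \<open>Total number of bits; \<open>floor_log n + 1\<close> is the binary length of \<open>n\<close> (and 1 for \<open>n = 0\<close>).\<close>

definition input_size :: "nat list \<Rightarrow> nat" where
  "input_size xs = (\<Sum>x\<leftarrow>xs. floor_log x + 1)"


section \<open>Parameterized complexity\<close>

text \<open>
  A parameterized problem is a language of strings over the naturals together with a parameter
  function. The parameter function is not required to be computable in polynomial time, because
  the induced matching number is not known to be; no algorithm is told the parameter.
\<close>

type_synonym pproblem = "nat list set \<times> (nat list \<Rightarrow> nat)"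

definition fpt_bounded :: "(nat list \<Rightarrow> nat) \<Rightarrow> com \<Rightarrow> (nat list \<Rightarrow> nat list) \<Rightarrow> bool" where
  "fpt_bounded \<kappa> P F \<longleftrightarrow> (\<exists>f c. computable f \<and>
     (\<forall>x. \<exists>t. computes P x (F x) t \<and> t \<le> f (\<kappa> x) * (input_size x + 1) ^ c))"

definition FPT :: "pproblem set" where
  "FPT = {(Q, \<kappa>). \<exists>P. fpt_bounded \<kappa> P (\<lambda>x. [if x \<in> Q then 1 else 0])}"

definition fpt_reducible :: "pproblem \<Rightarrow> pproblem \<Rightarrow> bool" (infix \<open>\<le>\<^sub>f\<^sub>p\<^sub>t\<close> 50) where
  "L \<le>\<^sub>f\<^sub>p\<^sub>t L' \<longleftrightarrow> (\<exists>P R g. fpt_bounded (snd L) P R \<and> computable g \<and>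
     (\<forall>x. (x \<in> fst L \<longleftrightarrow> R x \<in> fst L') \<and> snd L' (R x) \<le> g (snd L x)))"

text \<open>
  Boolean circuits are lists of gates in topological order: a gate refers to its predecessors by
  their positions, and the last gate is the output.
\<close>

datatype gate = Input | Neg nat | And "nat list" | Or "nat list"

type_synonym circuit = "gate list"

fun preds :: "gate \<Rightarrow> nat list" where
  "preds Input = []"
| "preds (Neg j) = [j]"
| "preds (And js) = js"
| "preds (Or js) = js"

fun fan_in_ok :: "gate \<Rightarrow> bool" where
  "fan_in_ok (And js) \<longleftrightarrow> 2 \<le> length js"
| "fan_in_ok (Or js) \<longleftrightarrow> 2 \<le> length js"
| "fan_in_ok _ \<longleftrightarrow> True"

definition wf_circuit :: "circuit \<Rightarrow> bool" where
  "wf_circuit C \<longleftrightarrow> C \<noteq> [] \<and> (\<forall>i<length C. fan_in_ok (C ! i) \<and>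
     distinct (preds (C ! i)) \<and> (\<forall>j\<in>set (preds (C ! i)). j < i))"

definition input_gates :: "circuit \<Rightarrow> nat set" where
  "input_gates C = {i. i < length C \<and> C ! i = Input}"

text \<open>The lists \<open>vs\<close>, \<open>ds\<close>, \<open>ws\<close> below hold the results for the gates that come earlier.\<close>

fun gate_value :: "nat set \<Rightarrow> bool list \<Rightarrow> gate \<Rightarrow> bool" where
  "gate_value A vs Input \<longleftrightarrow> length vs \<in> A"
| "gate_value A vs (Neg j) \<longleftrightarrow> \<not> vs ! j"
| "gate_value A vs (And js) \<longleftrightarrow> (\<forall>j\<in>set js. vs ! j)"
| "gate_value A vs (Or js) \<longleftrightarrow> (\<exists>j\<in>set js. vs ! j)"

definition satisfies :: "nat set \<Rightarrow> circuit \<Rightarrow> bool" where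
  "satisfies A C \<longleftrightarrow> last (foldl (\<lambda>vs g. vs @ [gate_value A vs g]) [] C)"

definition gate_depth :: "nat list \<Rightarrow> gate \<Rightarrow> nat" where
  "gate_depth ds g = (if g = Input then 0 else Suc (Max ((\<lambda>j. ds ! j) ` set (preds g))))"

definition depth :: "circuit \<Rightarrow> nat" where
  "depth C = last (foldl (\<lambda>ds g. ds @ [gate_depth ds g]) [] C)"

text \<open>Weft is the maximum number of large gates (fan-in above 2) on a path to the output.\<close>

definition gate_weft :: "nat list \<Rightarrow> gate \<Rightarrow> nat" where
  "gate_weft ws g = (if g = Input then 0 else
     (if length (preds g) > 2 then 1 else 0) + Max ((\<lambda>j. ws ! j) ` set (preds g)))"

definition weft :: "circuit \<Rightarrow> nat" where
  "weft C = last (foldl (\<lambda>ws g. ws @ [gate_weft ws g]) [] C)"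

fun encode_gate :: "gate \<Rightarrow> nat list" where
  "encode_gate Input = [0]"
| "encode_gate (Neg j) = [1, j]"
| "encode_gate (And js) = 2 # length js # js"
| "encode_gate (Or js) = 3 # length js # js"

definition encode_circuit :: "nat \<Rightarrow> circuit \<Rightarrow> nat list" where
  "encode_circuit k C = k # length C # concat (map encode_gate C)"

text \<open>
  Weighted circuit satisfiability for circuits of weft at most \<open>t\<close> and depth at most \<open>d\<close>: is there
  a satisfying assignment with exactly \<open>k\<close> true inputs? The parameter is \<open>k\<close>.
\<close>

definition WCS :: "nat \<Rightarrow> nat \<Rightarrow> pproblem" where
  "WCS t d =
     ({encode_circuit k C | k C. wf_circuit C \<and> weft C \<le> t \<and> depth C \<le> d \<and>
         (\<exists>A \<subseteq> input_gates C. card A = k \<and> satisfies A C)},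
      \<lambda>x. case x of [] \<Rightarrow> 0 | k # _ \<Rightarrow> k)"

definition W :: "nat \<Rightarrow> pproblem set" where
  "W t = {L. \<exists>d\<ge>1. L \<le>\<^sub>f\<^sub>p\<^sub>t WCS t d}"


section \<open>Graphs\<close>

definition graph :: "'a set \<Rightarrow> 'a set set \<Rightarrow> bool" where
  "graph V E \<longleftrightarrow> finite V \<and> (\<forall>e\<in>E. \<exists>u\<in>V. \<exists>v\<in>V. u \<noteq> v \<and> e = {u, v})"

definition bipartite :: "'a set \<Rightarrow> 'a set set \<Rightarrow> bool" where
  "bipartite V E \<longleftrightarrow> (\<exists>X Y. X \<union> Y = V \<and> X \<inter> Y = {} \<and> (\<forall>e\<in>E. \<exists>x\<in>X. \<exists>y\<in>Y. e = {x, y}))"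

definition matching :: "'a set set \<Rightarrow> 'a set set \<Rightarrow> bool" where
  "matching E M \<longleftrightarrow> M \<subseteq> E \<and> (\<forall>e\<in>M. \<forall>f\<in>M. e \<noteq> f \<longrightarrow> e \<inter> f = {})"

definition induced_matching :: "'a set set \<Rightarrow> 'a set set \<Rightarrow> bool" where
  "induced_matching E M \<longleftrightarrow> matching E M \<and>
     \<not> (\<exists>a b c d. distinct [a, b, c, d] \<and> {a, b} \<in> E \<and> {b, c} \<in> E \<and> {c, d} \<in> E \<and>
          {a, b} \<in> M \<and> {c, d} \<in> M)"

definition induced_matching_number :: "'a set set \<Rightarrow> nat" where
  "induced_matching_number E = Max {card M | M. induced_matching E M}"

definition incident_edges :: "'a set set \<Rightarrow> 'a set \<Rightarrow> 'a set set" where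
  "incident_edges E U = {e \<in> E. e \<inter> U \<noteq> {}}"


section \<open>The problem M-EPVCB\<close>

definition mepvcb_instance ::
  "'a set \<Rightarrow> 'a set set \<Rightarrow> ('a set \<Rightarrow> nat) \<Rightarrow> nat \<Rightarrow> nat \<Rightarrow> nat \<Rightarrow> bool" where
  "mepvcb_instance V E w k1 k2 k3 \<longleftrightarrow>
     graph V E \<and> bipartite V E \<and> (\<forall>e\<in>E. w e > 0) \<and> k1 > 0 \<and> k2 > 0 \<and> k3 > 0"

definition mepvcb_yes ::
  "'a set \<Rightarrow> 'a set set \<Rightarrow> ('a set \<Rightarrow> nat) \<Rightarrow> nat \<Rightarrow> nat \<Rightarrow> nat \<Rightarrow> bool" where
  "mepvcb_yes V E w k1 k2 k3 \<longleftrightarrow>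
     (\<exists>U\<subseteq>V. card U \<le> k1 \<and> (\<Sum>e\<in>incident_edges E U. w e) \<ge> k2 \<and>
        (\<exists>M. matching (incident_edges E U) M \<and> (\<Sum>e\<in>M. w e) \<ge> k3))"

text \<open>
  For the encoding, the vertices are \<open>0, \<dots>, n - 1\<close> and the edges with their weights are given by a
  list of triples \<open>(u, v, c)\<close>, in which every edge occurs once. Since sizes are counted in bits,
  weights and bounds are in binary.
\<close>

type_synonym weighted_edge = "nat \<times> nat \<times> nat"
type_synonym raw_instance = "nat \<times> weighted_edge list \<times> nat \<times> nat \<times> nat"

definition edge_of :: "weighted_edge \<Rightarrow> nat set" where
  "edge_of = (\<lambda>(u, v, c). {u, v})"

definition edges :: "weighted_edge list \<Rightarrow> nat set set" where
  "edges es = edge_of ` set es"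

definition weight :: "weighted_edge list \<Rightarrow> nat set \<Rightarrow> nat" where
  "weight es e = (THE c. \<exists>u v. (u, v, c) \<in> set es \<and> e = {u, v})"

fun valid :: "raw_instance \<Rightarrow> bool" where
  "valid (n, es, k1, k2, k3) \<longleftrightarrow>
     distinct (map edge_of es) \<and> mepvcb_instance {..<n} (edges es) (weight es) k1 k2 k3"

fun yes_instance :: "raw_instance \<Rightarrow> bool" where
  "yes_instance (n, es, k1, k2, k3) \<longleftrightarrow> mepvcb_yes {..<n} (edges es) (weight es) k1 k2 k3"

fun param :: "raw_instance \<Rightarrow> nat" where
  "param (n, es, k1, k2, k3) = card {..<n} - 2 * induced_matching_number (edges es)"

fun encode :: "raw_instance \<Rightarrow> nat list" where
  "encode (n, es, k1, k2, k3) =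
     [n, k1, k2, k3, length es] @ concat (map (\<lambda>(u, v, c). [u, v, c]) es)"

lemma inj_encode: "inj encode"
proof -
  have "es = es'" if "concat (map (\<lambda>(u, v, c). [u, v, c]) es) =
      concat (map (\<lambda>(u, v, c). [u, v, c]) es')"
    for es es' :: "weighted_edge list"
    using that
  proof (induction es arbitrary: es')
    case Nil
    then show ?case by (cases es') auto
  next
    case (Cons e es)
    then show ?case by (cases e; cases es') auto
  qed
  then show ?thesis by (auto intro!: injI)
qed

lemma weight_eq:
  assumes "distinct (map edge_of es)" and "(u, v, c) \<in> set es"
  shows "weight es {u, v} = c"
proof -
  have "c' = c" if "(u', v', c') \<in> set es" and "{u, v} = {u', v'}" for u' v' c'
  proof -
    have "edge_of (u', v', c') = edge_of (u, v, c)"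
      using that by (simp add: edge_of_def)
    moreover have "inj_on edge_of (set es)"
      using assms(1) by (simp add: distinct_map)
    ultimately have "(u', v', c') = (u, v, c)"
      using assms(2) that(1) by (blast dest: inj_onD)
    then show ?thesis by simp
  qed
  then show ?thesis
    unfolding weight_def using assms(2) by (intro the_equality) blast+
qed

definition M_EPVCB :: "nat list set" where
  "M_EPVCB = encode ` {I. valid I \<and> yes_instance I}"

text \<open>
  The parameter \<open>|V| - 2 \<nu>\<^sub>i\<^sub>n\<^sub>d(G)\<close>; lists that encode no instance (a condition
  decidable in polynomial time) get the dummy value 0. The subtraction is not truncated, as the edges
  of a matching cover twice as many vertices as there are edges.
\<close>

definition M_EPVCB_param :: "nat list \<Rightarrow> nat" where
  "M_EPVCB_param x = (if x \<in> encode ` {I. valid I} then param (inv encode x) else 0)"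

end

theory Submission
  imports Defs
begin

text \<open>
  M-EPVCB is hard already for parameter values at most 1, because weights are given in binary: a perfect
  induced matching together with one further vertex encodes subset sum. Satisfiability of circuits
  by an assignment of given weight reduces to subset sum in polynomial time (for any weft and depth, so
  no normal form for weft 1 is needed). Hence, if M-EPVCB were fixed-parameter
  tractable, composing these reductions with an algorithm for it would decide every problem in
  \<open>W 1\<close>. The converse inclusion holds since the answer of an algorithm can be turned into
  a circuit with a single input.
\<close>


section \<open>Composing programs\<close>

text \<open>M-EPVCB has only lower bounds, whereas subset sum asks for an equality. So one choice
  has to act on two bounds in opposite directions: selecting index \<open>i\<close> gains
  \<open>x i\<close> in the matching and loses \<open>x i\<close> in the coverage. A single equality
  of numbers must in turn stand for a system of small equations, one per gate; they are stacked as
  digits, so the weights become exponentially large although they are short in binary. All this has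
  to be done by programs of a machine without multiplication. Two devices keep it manageable: loops
  with a common number of rounds, so that totality and polynomial time need no separate argument,
  and a base for the digits that equals this number of rounds, so that a loop multiplies by the
  base. Composing algorithms also needs a bound on the bits of intermediate outputs and a time bound
  whose parameter part is again \<open>computable\<close>; for this reason bounds are rounded up to
  powers of two.\<close>

fun shift_exp :: "nat \<Rightarrow> exp \<Rightarrow> exp" where
  "shift_exp m (Const n) = Const n"
| "shift_exp m (Get a e) = Get (m + a) (shift_exp m e)"
| "shift_exp m (Add e1 e2) = Add (shift_exp m e1) (shift_exp m e2)"
| "shift_exp m (Sub e1 e2) = Sub (shift_exp m e1) (shift_exp m e2)"

fun shift :: "nat \<Rightarrow> com \<Rightarrow> com" where
  "shift m Skip = Skip"
| "shift m (Put a i e) = Put (m + a) (shift_exp m i) (shift_exp m e)"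
| "shift m (Seq P Q) = Seq (shift m P) (shift m Q)"
| "shift m (Cond e P Q) = Cond (shift_exp m e) (shift m P) (shift m Q)"
| "shift m (While e P) = While (shift_exp m e) (shift m P)"

lemma eval_shift: "eval (shift_exp m e) s = eval e (\<lambda>a. s (m + a))"
  by (induction e) auto

text \<open>Array names are constants of the program, so adding \<open>m\<close> to all of them
  makes it see the memory from array \<open>m\<close> on as if it were the whole memory.\<close>

lemma exec_shift:
  assumes "exec P s t s'" and "(\<lambda>a. r (m + a)) = s"
  shows "\<exists>r'. exec (shift m P) r t r' \<and> (\<lambda>a. r' (m + a)) = s' \<and> (\<forall>a<m. r' a = r a)"
  using assms
proof (induction arbitrary: r rule: exec.induct)
  case (Skip s)
  then show ?case using exec.Skip[of r] by (intro exI[of _ r]) simp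
next
  case (Put a i e s)
  let ?r = "r(m + a := (r (m + a))(eval i s := eval e s))"
  have "exec (shift m (Put a i e)) r 1 ?r"
    using exec.Put[of "m + a" "shift_exp m i" "shift_exp m e" r] Put by (simp add: eval_shift)
  moreover have "(\<lambda>b. ?r (m + b)) = s(a := (s a)(eval i s := eval e s))"
    using Put by auto
  moreover have "\<forall>b<m. ?r b = r b" by simp
  ultimately show ?case by blast
next
  case (Seq P s t s' Q u s'')
  from Seq.IH(1)[OF Seq.prems] obtain r1 where r1: "exec (shift m P) r t r1"
    "(\<lambda>a. r1 (m + a)) = s'" "\<forall>a<m. r1 a = r a" by blast
  from Seq.IH(2)[OF r1(2)] r1 show ?case by (auto intro: exec.Seq)
next
  case (CondTrue e s P t s' Q)
  from CondTrue.IH[OF CondTrue.prems] obtain r' where r': "exec (shift m P) r t r'"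
    "(\<lambda>a. r' (m + a)) = s'" "\<forall>a<m. r' a = r a" by blast
  have "eval (shift_exp m e) r \<noteq> 0" using CondTrue by (simp add: eval_shift)
  from exec.CondTrue[OF this r'(1)] r' show ?case by auto
next
  case (CondFalse e s Q t s' P)
  from CondFalse.IH[OF CondFalse.prems] obtain r' where r': "exec (shift m Q) r t r'"
    "(\<lambda>a. r' (m + a)) = s'" "\<forall>a<m. r' a = r a" by blast
  have "eval (shift_exp m e) r = 0" using CondFalse by (simp add: eval_shift)
  from exec.CondFalse[OF this r'(1)] r' show ?case by auto
next
  case (WhileFalse e s P)
  then have "exec (shift m (While e P)) r 1 r"
    by (auto intro!: exec.WhileFalse[unfolded One_nat_def] simp: eval_shift)
  with WhileFalse show ?case by blast
next
  case (WhileTrue e s P t s' u s'')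
  from WhileTrue.IH(1)[OF WhileTrue.prems] obtain r1 where r1: "exec (shift m P) r t r1"
    "(\<lambda>a. r1 (m + a)) = s'" "\<forall>a<m. r1 a = r a" by blast
  from WhileTrue.IH(2)[OF r1(2)] obtain r2 where r2: "exec (While (shift_exp m e) (shift m P)) r1 u r2"
    "(\<lambda>a. r2 (m + a)) = s''" "\<forall>a<m. r2 a = r1 a" by auto
  have "exec (While (shift_exp m e) (shift m P)) r (Suc (t + u)) r2"
    using WhileTrue.hyps(1) WhileTrue.prems r1(1) r2(1)
    by (intro exec.WhileTrue) (auto simp: eval_shift)
  with r1 r2 show ?case by auto
qed

text \<open>Only written arrays count: an array that is merely read keeps its initial
  content.\<close>

fun array_bound :: "com \<Rightarrow> nat" where
  "array_bound Skip = 0"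
| "array_bound (Put a i e) = Suc a"
| "array_bound (Seq P Q) = max (array_bound P) (array_bound Q)"
| "array_bound (Cond e P Q) = max (array_bound P) (array_bound Q)"
| "array_bound (While e P) = array_bound P"

lemma exec_frame: "exec P s t s' \<Longrightarrow> array_bound P \<le> a \<Longrightarrow> s' a = s a"
  by (induction rule: exec.induct) auto

section \<open>Bit growth in memory and the size of outputs\<close>

fun exp_growth :: "exp \<Rightarrow> nat" where
  "exp_growth (Const n) = n"
| "exp_growth (Get a e) = 1"
| "exp_growth (Add e1 e2) = exp_growth e1 + exp_growth e2"
| "exp_growth (Sub e1 e2) = exp_growth e1"

text \<open>The successor makes the factor at least 1, so that it also covers the entries that an
  assignment leaves alone.\<close>

fun growth :: "com \<Rightarrow> nat" where
  "growth Skip = 1"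
| "growth (Put a i e) = Suc (exp_growth e)"
| "growth (Seq P Q) = max (growth P) (growth Q)"
| "growth (Cond e P Q) = max (growth P) (growth Q)"
| "growth (While e P) = growth P"

lemma growth_pos: "1 \<le> growth P"
  by (induction P) auto

lemma eval_growth:
  assumes "\<And>a i. s a i \<le> V" and "1 \<le> V"
  shows "eval e s \<le> exp_growth e * V"
proof (induction e)
  case (Const n)
  then show ?case using assms by simp
next
  case (Add e1 e2)
  then show ?case by (simp add: add_mult_distrib)
next
  case (Sub e1 e2)
  then show ?case by (simp add: le_diff_conv trans_le_add1)
qed (use assms in auto)

text \<open>Without multiplication, a step increases the largest number in memory by a constant
  factor at most, that is, by a bounded number of bits. \<open>V\<close> varies in the induction
  because the second of two programs starts from the bound left by the first.\<close>

lemma exec_growth: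
  "exec P s t s' \<Longrightarrow> growth P \<le> K \<Longrightarrow> (\<And>a i. s a i \<le> V) \<Longrightarrow> 1 \<le> V \<Longrightarrow> s' a i \<le> K ^ t * V"
proof (induction arbitrary: V a i rule: exec.induct)
  case (Skip s)
  then show ?case using mult_le_mono[of 1 K "s a i" V] by simp
next
  case (Put b j e s)
  have "eval e s \<le> exp_growth e * V" using eval_growth Put.prems by blast
  also have "\<dots> \<le> K * V" using Put.prems by simp
  finally have "eval e s \<le> K * V" .
  moreover have "s c l \<le> K * V" for c l
    using Put.prems(1) Put.prems(2)[of c l] mult_le_mono[of 1 K "s c l" V] by simp
  ultimately show ?case by simp
next
  case (Seq P s t s' Q u s'')
  have *: "1 \<le> K ^ t * V" using Seq.prems growth_pos[of P] by simp
  have "s'' a i \<le> K ^ u * (K ^ t * V)"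
  proof (rule Seq.IH(2))
    show "s' b j \<le> K ^ t * V" for b j using Seq.IH(1) Seq.prems by simp
  qed (use Seq.prems * in auto)
  then show ?case by (simp add: power_add mult_ac)
next
  case (CondTrue e s P t s' Q)
  have "s' a i \<le> K ^ t * V" using CondTrue by simp
  also have "\<dots> \<le> K ^ Suc t * V" using CondTrue.prems growth_pos[of P] by simp
  finally show ?case .
next
  case (CondFalse e s Q t s' P)
  have "s' a i \<le> K ^ t * V" using CondFalse by simp
  also have "\<dots> \<le> K ^ Suc t * V" using CondFalse.prems growth_pos[of Q] by simp
  finally show ?case .
next
  case (WhileFalse e s P)
  then show ?case using growth_pos[of P] mult_le_mono[of 1 K "s a i" V] by simp
next
  case (WhileTrue e s P t s' u s'')
  have *: "1 \<le> K ^ t * V" using WhileTrue.prems growth_pos[of P] by simp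
  have "s'' a i \<le> K ^ u * (K ^ t * V)"
  proof (rule WhileTrue.IH(2))
    show "s' b j \<le> K ^ t * V" for b j using WhileTrue.IH(1) WhileTrue.prems by simp
  qed (use WhileTrue.prems * in auto)
  also have "\<dots> = K ^ (t + u) * V" by (simp add: power_add mult_ac)
  also have "\<dots> \<le> K ^ Suc (t + u) * V" using WhileTrue.prems growth_pos[of P] by simp
  finally show ?case .
qed

lemma length_le_input_size: "length xs \<le> input_size xs"
  by (induction xs) (auto simp: input_size_def)

lemma init_le: "init xs a i \<le> 2 ^ input_size xs"
proof -
  have len: "length xs \<le> 2 ^ input_size xs"
    using length_le_input_size[of xs] less_exp[of "input_size xs"] by linarith
  have entry: "x \<le> 2 ^ input_size xs" if "x \<in> set xs" for x
  proof -
    have "x \<le> 2 ^ (floor_log x + 1)" using floor_log_exp2_gt[of x] by simp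
    also have "\<dots> \<le> 2 ^ input_size xs"
      unfolding input_size_def
      using that by (intro power_increasing member_le_sum_list) auto
    finally show ?thesis .
  qed
  show ?thesis using len entry by (auto simp: init_def)
qed

lemma length_result_le: "computes P xs ys t \<Longrightarrow> length ys \<le> t"
  by (auto simp: computes_def)

text \<open>There are at most \<open>t\<close> entries because writing them is charged, and the bits
  of each are linear in time and input size.\<close>

lemma input_size_result_le:
  assumes "computes P xs ys t"
  shows "input_size ys \<le> t * (growth P * t + input_size xs + 1)"
proof -
  from assms obtain s u where s: "exec P (init xs) u s" "result s = ys" "t = u + length ys"
    by (auto simp: computes_def)
  have "floor_log y + 1 \<le> growth P * t + input_size xs + 1" if "y \<in> set ys" for y
  proof -
    from that s obtain i where "y = s 1 (Suc i)" by (auto simp: result_def)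
    then have "y \<le> growth P ^ u * 2 ^ input_size xs"
      using exec_growth[OF s(1), of "growth P" "2 ^ input_size xs"] init_le by simp
    \<comment> \<open>Replacing the factor by a power of two makes the bound a single power, whose
      logarithm can be read off.\<close>
    also have "\<dots> \<le> (2 ^ growth P) ^ u * 2 ^ input_size xs"
      using less_exp[of "growth P"] by (intro mult_right_mono power_mono) auto
    also have "\<dots> = 2 ^ (growth P * u + input_size xs)"
      by (simp add: power_mult power_add)
    finally have "floor_log y \<le> growth P * u + input_size xs"
      using floor_log_le_iff floor_log_power by metis
    moreover have "growth P * u \<le> growth P * t" using s by simp
    ultimately show ?thesis by linarith
  qed
  then have "(\<Sum>y\<leftarrow>ys. floor_log y + 1) \<le> (\<Sum>y\<leftarrow>ys. growth P * t + input_size xs + 1)"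
    by (intro sum_list_mono) auto
  then have "input_size ys \<le> length ys * (growth P * t + input_size xs + 1)"
    by (simp add: input_size_def[of ys] sum_list_triv)
  also have "\<dots> \<le> t * (growth P * t + input_size xs + 1)"
    using length_result_le[OF assms] by (intro mult_right_mono) auto
  finally show ?thesis .
qed

section \<open>Copying arrays and sequential composition\<close>

abbreviation Var :: "nat \<Rightarrow> exp" where
  "Var a \<equiv> Get a (Const 0)"

definition copy_loop :: "nat \<Rightarrow> nat \<Rightarrow> nat \<Rightarrow> com" where
  "copy_loop q a b = While (Var q)
     (Seq (Put b (Var q) (Get a (Var q))) (Put q (Const 0) (Sub (Var q) (Const 1))))"

definition copy :: "nat \<Rightarrow> nat \<Rightarrow> nat \<Rightarrow> com" where
  "copy q a b = Seq (Put q (Const 0) (Var a)) (Seq (Put b (Const 0) (Var a)) (copy_loop q a b))"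

text \<open>The counter doubles as the index and runs down to 1, so index 0, the length entry, is
  left to \<open>copy\<close>. A round costs a test and two assignments; the failing test at the end
  is one more step.\<close>

lemma exec_copy_loop:
  assumes "distinct [q, a, b]" and "s q 0 = n"
  shows "\<exists>s'. exec (copy_loop q a b) s (3 * n + 1) s' \<and> (\<forall>c. c \<noteq> q \<longrightarrow> c \<noteq> b \<longrightarrow> s' c = s c) \<and>
    (\<forall>i. s' b i = (if 1 \<le> i \<and> i \<le> n then s a i else s b i))"
  using assms(2)
proof (induction n arbitrary: s)
  case 0
  then have "exec (copy_loop q a b) s 1 s"
    unfolding copy_loop_def by (intro exec.WhileFalse) simp
  then show ?case by (intro exI[of _ s]) auto
next
  case (Suc n)
  let ?s1 = "s(b := (s b)(Suc n := s a (Suc n)))"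
  let ?s2 = "?s1(q := (?s1 q)(0 := n))"
  have 1: "exec (Put b (Var q) (Get a (Var q))) s 1 ?s1"
    using exec.Put[of b "Var q" "Get a (Var q)" s] Suc.prems by simp
  have 2: "exec (Put q (Const 0) (Sub (Var q) (Const 1))) ?s1 1 ?s2"
    using exec.Put[of q "Const 0" "Sub (Var q) (Const 1)" ?s1] Suc.prems assms(1) by simp
  have "?s2 q 0 = n" by simp
  from Suc.IH[of ?s2, OF this] obtain s' where s': "exec (copy_loop q a b) ?s2 (3 * n + 1) s'"
    "\<forall>c. c \<noteq> q \<longrightarrow> c \<noteq> b \<longrightarrow> s' c = ?s2 c"
    "\<forall>i. s' b i = (if 1 \<le> i \<and> i \<le> n then ?s2 a i else ?s2 b i)" by (elim exE conjE)
  have "exec (copy_loop q a b) s (Suc ((1 + 1) + (3 * n + 1))) s'"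
    unfolding copy_loop_def
    by (rule exec.WhileTrue[OF _ exec.Seq[OF 1 2] s'(1)[unfolded copy_loop_def]])
      (simp add: Suc.prems)
  moreover have "Suc ((1 + 1) + (3 * n + 1)) = 3 * Suc n + 1" by simp
  moreover have "\<forall>c. c \<noteq> q \<longrightarrow> c \<noteq> b \<longrightarrow> s' c = s c" using s'(2) by simp
  moreover have "s' b i = (if 1 \<le> i \<and> i \<le> Suc n then s a i else s b i)" for i
    using s'(3)[rule_format, of i] assms(1) by (cases "i = Suc n") auto
  ultimately show ?case by metis
qed

lemma exec_copy:
  assumes "distinct [q, a, b]"
  shows "\<exists>s'. exec (copy q a b) s (3 * s a 0 + 3) s' \<and> (\<forall>c. c \<noteq> q \<longrightarrow> c \<noteq> b \<longrightarrow> s' c = s c) \<and>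
    (\<forall>i. s' b i = (if i \<le> s a 0 then s a i else s b i))"
proof -
  let ?s1 = "s(q := (s q)(0 := s a 0))"
  let ?s2 = "?s1(b := (?s1 b)(0 := s a 0))"
  have 1: "exec (Put q (Const 0) (Var a)) s 1 ?s1"
    using exec.Put[of q "Const 0" "Var a" s] by simp
  have 2: "exec (Put b (Const 0) (Var a)) ?s1 1 ?s2"
    using exec.Put[of b "Const 0" "Var a" ?s1] assms by simp
  have "?s2 q 0 = s a 0" using assms by simp
  from exec_copy_loop[of q a b ?s2, OF assms this] obtain s' where
    s': "exec (copy_loop q a b) ?s2 (3 * s a 0 + 1) s'"
    "\<forall>c. c \<noteq> q \<longrightarrow> c \<noteq> b \<longrightarrow> s' c = ?s2 c"
    "\<forall>i. s' b i = (if 1 \<le> i \<and> i \<le> s a 0 then ?s2 a i else ?s2 b i)" by (elim exE conjE)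
  have "exec (copy q a b) s (1 + (1 + (3 * s a 0 + 1))) s'"
    unfolding copy_def by (rule exec.Seq[OF 1 exec.Seq[OF 2 s'(1)]])
  moreover have "1 + (1 + (3 * s a 0 + 1)) = 3 * s a 0 + 3" by simp
  moreover have "\<forall>c. c \<noteq> q \<longrightarrow> c \<noteq> b \<longrightarrow> s' c = s c" using s'(2) by simp
  moreover have "s' b i = (if i \<le> s a 0 then s a i else s b i)" for i
    using s'(3)[rule_format, of i] assms by (cases i) auto
  ultimately show ?thesis by metis
qed

text \<open>\<open>Q\<close> runs on the arrays from \<open>Suc m\<close> on, which \<open>P\<close>
  never writes and which are therefore still zero; array \<open>m\<close> is the counter of both
  copies. As \<open>t\<close> and \<open>u\<close> already pay for the entries of \<open>y\<close>
  and \<open>z\<close>, copying costs only a constant factor.\<close>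

lemma computes_comp:
  obtains R where "\<And>x y z t u. computes P x y t \<Longrightarrow> computes Q y z u \<Longrightarrow>
    \<exists>v. computes R x z v \<and> v \<le> 6 * (t + u + 1)"
proof -
  \<comment> \<open>The maximum with 2 keeps the input array 0 and the output array 1 apart from the
    arrays used for copying and for \<open>Q\<close>.\<close>
  define m where "m = max (array_bound P) 2"
  define R where
    "R = Seq P (Seq (copy m 1 (Suc m)) (Seq (shift (Suc m) Q) (copy m (Suc (Suc m)) 1)))"
  have "\<exists>v. computes R x z v \<and> v \<le> 6 * (t + u + 1)"
    if xy: "computes P x y t" and yz: "computes Q y z u" for x y z t u
  proof -
    from xy obtain s1 t1 where s1: "exec P (init x) t1 s1" "result s1 = y" "t = t1 + length y"
      by (auto simp: computes_def)
    have len_y: "s1 1 0 = length y" using s1(2) by (auto simp: result_def)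
    have y_nth: "s1 1 (Suc i) = y ! i" if "i < length y" for i
      using s1(2) that by (auto simp: result_def)
    have fresh: "s1 a = (\<lambda>_. 0)" if "m \<le> a" for a
      using exec_frame[OF s1(1), of a] that by (auto simp: m_def init_def)
    have "distinct [m, 1, Suc m]" "distinct [m, Suc (Suc m), 1]" by (auto simp: m_def)
    note dist = this
    from exec_copy[OF dist(1), of s1] obtain s2 where
      s2: "exec (copy m 1 (Suc m)) s1 (3 * length y + 3) s2"
        "\<forall>c. c \<noteq> m \<longrightarrow> c \<noteq> Suc m \<longrightarrow> s2 c = s1 c"
        "\<forall>i. s2 (Suc m) i = (if i \<le> length y then s1 1 i else s1 (Suc m) i)"
      unfolding len_y by (elim exE conjE)
    have "s2 (Suc m + a) i = init y a i" for a i
    proof (cases "a = 0")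
      case True
      then show ?thesis
        using s2(3) fresh[of "Suc m"] len_y y_nth by (cases i) (auto simp: init_def)
    next
      case False
      then show ?thesis using s2(2) fresh[of "Suc m + a"] by (auto simp: init_def)
    qed
    then have "(\<lambda>a. s2 (Suc m + a)) = init y" by (intro ext)
    moreover from yz obtain s t2 where s: "exec Q (init y) t2 s" "result s = z" "u = t2 + length z"
      by (auto simp: computes_def)
    ultimately obtain s3 where s3: "exec (shift (Suc m) Q) s2 t2 s3" "(\<lambda>a. s3 (Suc m + a)) = s"
      using exec_shift[OF s(1), of s2 "Suc m"] by auto
    have s3_1: "s3 (Suc (Suc m)) = s 1" using s3(2) by auto
    have len_z: "s 1 0 = length z" using s(2) by (auto simp: result_def)
    from exec_copy[OF dist(2), of s3] obtain s4 where
      s4: "exec (copy m (Suc (Suc m)) 1) s3 (3 * length z + 3) s4"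
        "\<forall>i. s4 1 i = (if i \<le> length z then s 1 i else s3 1 i)"
      unfolding s3_1 len_z by (elim exE conjE)
    \<comment> \<open>Older entries of array 1 may survive behind the copied ones, but
      \<open>result\<close> reads only up to the length entry.\<close>
    have "result s4 = result s"
      unfolding result_def using s4(2) len_z by auto
    moreover have "exec R (init x) (t1 + ((3 * length y + 3) + (t2 + (3 * length z + 3)))) s4"
      unfolding R_def by (rule exec.Seq[OF s1(1) exec.Seq[OF s2(1) exec.Seq[OF s3(1) s4(1)]]])
    ultimately have "computes R x z (t1 + ((3 * length y + 3) + (t2 + (3 * length z + 3))) + length z)"
      unfolding computes_def using s(2) by blast
    then show ?thesis using s1(3) s(3) by (intro exI conjI) auto
  qed
  then show thesis by (rule that)
qed

section \<open>Computable bounds and composition of parameterized algorithms\<close>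

fun times_exp :: "nat \<Rightarrow> exp \<Rightarrow> exp" where
  "times_exp 0 e = Const 0"
| "times_exp (Suc n) e = Add e (times_exp n e)"

lemma eval_times_exp [simp]: "eval (times_exp n e) s = n * eval e s"
  by (induction n) auto

lemma exec_double_loop:
  assumes "m \<noteq> 1" and "s m 0 = n"
  shows "\<exists>s' t. exec (While (Var m) (Seq (Put 1 (Const 1) (Add (Get 1 (Const 1)) (Get 1 (Const 1))))
      (Put m (Const 0) (Sub (Var m) (Const 1))))) s t s' \<and> s' 1 = (s 1)(1 := 2 ^ n * s 1 1)"
  using assms(2)
proof (induction n arbitrary: s)
  case 0
  then show ?case by (auto intro!: exI exec.WhileFalse)
next
  case (Suc n)
  let ?b1 = "Put 1 (Const 1) (Add (Get 1 (Const 1)) (Get 1 (Const 1)))"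
  let ?b2 = "Put m (Const 0) (Sub (Var m) (Const 1))"
  let ?s1 = "s(1 := (s 1)(1 := s 1 1 + s 1 1))"
  let ?s2 = "?s1(m := (?s1 m)(0 := n))"
  have 1: "exec ?b1 s 1 ?s1"
    using exec.Put[of 1 "Const 1" "Add (Get 1 (Const 1)) (Get 1 (Const 1))" s]
    by (simp del: One_nat_def)
  have 2: "exec ?b2 ?s1 1 ?s2"
    using exec.Put[of m "Const 0" "Sub (Var m) (Const 1)" ?s1] Suc.prems assms(1) by simp
  have "?s2 m 0 = n" by simp
  from Suc.IH[of ?s2, OF this] obtain s' t where s': "exec (While (Var m) (Seq ?b1 ?b2)) ?s2 t s'"
    "s' 1 = (?s2 1)(1 := 2 ^ n * ?s2 1 1)" by (elim exE conjE)
  have "exec (While (Var m) (Seq ?b1 ?b2)) s (Suc ((1 + 1) + t)) s'"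
    by (rule exec.WhileTrue[OF _ exec.Seq[OF 1 2] s'(1)]) (simp add: Suc.prems)
  moreover have "s' 1 = (s 1)(1 := 2 ^ Suc n * s 1 1)" using s'(2) assms(1) by auto
  ultimately show ?case by blast
qed

text \<open>Repeated doubling yields powers of two, the only growth beyond \<open>f\<close> that the
  bound of a composed algorithm requires; \<open>computable\<close> puts no limit on the time for
  it.\<close>

lemma computable_exp:
  assumes "computable f"
  shows "computable (\<lambda>n. 2 ^ (a * f n + b))"
proof -
  from assms obtain P where P: "\<And>n. \<exists>t. computes P [n] [f n] t" by (auto simp: computable_def)
  let ?L = "While (Var 2) (Seq (Put 1 (Const 1) (Add (Get 1 (Const 1)) (Get 1 (Const 1))))
      (Put 2 (Const 0) (Sub (Var 2) (Const 1))))"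
  let ?e = "Add (times_exp a (Get 1 (Const 1))) (Const b)"
  let ?Q = "Seq P (Seq (Put 2 (Const 0) ?e) (Seq (Put 1 (Const 1) (Const 1)) ?L))"
  have "\<exists>t. computes ?Q [n] [2 ^ (a * f n + b)] t" for n
  proof -
    from P[of n] obtain s t where s: "exec P (init [n]) t s" "result s = [f n]"
      by (auto simp: computes_def)
    have s1: "s 1 0 = 1"
      using s(2) by (metis diff_zero length_Cons length_map length_upt list.size(3) One_nat_def result_def)
    then have "s 1 1 = f n" using s(2) by (simp add: result_def)
    let ?s1 = "s(2 := (s 2)(0 := a * f n + b))"
    let ?s2 = "?s1(1 := (?s1 1)(1 := 1))"
    have 1: "exec (Put 2 (Const 0) ?e) s 1 ?s1"
      using exec.Put[of 2 "Const 0" ?e s] \<open>s 1 1 = f n\<close> by simp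
    have 2: "exec (Put 1 (Const 1) (Const 1)) ?s1 1 ?s2"
      using exec.Put[of 1 "Const 1" "Const 1" ?s1] by (simp del: One_nat_def)
    have "?s2 2 0 = a * f n + b" "?s2 1 1 = 1" by simp_all
    from exec_double_loop[of 2 ?s2, OF _ this(1)] this(2) obtain s' u where
      s': "exec ?L ?s2 u s'" "s' 1 = (?s2 1)(1 := 2 ^ (a * f n + b))" by auto
    have "exec ?Q (init [n]) (t + (1 + (1 + u))) s'" 
      by (rule exec.Seq[OF s(1) exec.Seq[OF 1 exec.Seq[OF 2 s'(1)]]])
    moreover have "result s' = [2 ^ (a * f n + b)]" using s'(2) s1 by (simp add: result_def)
    ultimately show ?thesis by (auto simp: computes_def)
  qed
  then show ?thesis by (auto simp: computable_def)
qed

lemma computable_const: "computable (\<lambda>_. c)"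
proof -
  let ?P = "Seq (Put 1 (Const 0) (Const 1)) (Put 1 (Const 1) (Const c))"
  have "\<exists>t. computes ?P [n] [c] t" for n
    unfolding computes_def by (intro exI conjI, rule exec.Seq[OF exec.Put exec.Put], auto simp: result_def)
  then show ?thesis by (auto simp: computable_def)
qed

text \<open>On intermediate inputs the parameter stays below a constant, so the second algorithm is
  polynomial there. All dependence on \<open>\<kappa>\<close> comes from the first one, through its
  running time and the size of its output.\<close>

lemma fpt_bounded_comp:
  assumes P: "fpt_bounded \<kappa> P F" and Q: "fpt_bounded \<kappa>' Q H" and b: "\<And>x. \<kappa>' (F x) \<le> b"
  obtains R where "fpt_bounded \<kappa> R (\<lambda>x. H (F x))"
proof -
  from P obtain f c where f: "computable f"
    and P': "\<And>x. \<exists>t. computes P x (F x) t \<and> t \<le> f (\<kappa> x) * (input_size x + 1) ^ c"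
    by (auto simp: fpt_bounded_def)
  from Q obtain f' c' where
    Q': "\<And>x. \<exists>t. computes Q x (H x) t \<and> t \<le> f' (\<kappa>' x) * (input_size x + 1) ^ c'"
    by (auto simp: fpt_bounded_def)
  obtain R where R: "\<And>x y z t u. computes P x y t \<Longrightarrow> computes Q y z u \<Longrightarrow>
    \<exists>v. computes R x z v \<and> v \<le> 6 * (t + u + 1)" by (rule computes_comp[of P Q]) blast
  \<comment> \<open>\<open>f'\<close> is not assumed to be monotone; the sum bounds all its values
    at arguments up to \<open>b\<close>.\<close>
  define M where "M = (\<Sum>i\<le>b. f' i)"
  define G where "G = growth P"
  \<comment> \<open>\<open>2 * c'\<close> because the intermediate input is quadratic in
    \<open>h\<close>; the additional 1 ensures that \<open>h ^ E\<close> bounds \<open>h\<close>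
    even for \<open>c' = 0\<close>.\<close>
  define E where "E = 2 * c' + 1"
  define a where "a = M * (G + 2) ^ c'"
  define K where "K = 6 * (2 + a)"
  have "\<exists>v. computes R x (H (F x)) v \<and>
      v \<le> 2 ^ (E * f (\<kappa> x) + K) * (input_size x + 1) ^ ((c + 1) * E)" for x
  proof -
    define s where "s = input_size x + 1"
    from P'[of x] obtain t where t: "computes P x (F x) t" "t \<le> f (\<kappa> x) * s ^ c"
      by (auto simp: s_def)
    from Q'[of "F x"] obtain u where u: "computes Q (F x) (H (F x)) u"
      "u \<le> f' (\<kappa>' (F x)) * (input_size (F x) + 1) ^ c'" by auto
    from R[OF t(1) u(1)] obtain v where v: "computes R x (H (F x)) v" "v \<le> 6 * (t + u + 1)"
      by auto
    \<comment> \<open>\<open>h\<close> dominates both the input size and the time of the first run,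
      so all further bounds can be powers of \<open>h\<close>.\<close>
    define h where "h = t + s"
    have h1: "1 \<le> h" by (simp add: h_def s_def)
    have "input_size (F x) \<le> t * (G * t + s)"
      using input_size_result_le[OF t(1)] by (simp add: G_def s_def add.assoc)
    also have "\<dots> \<le> h * (G * h + h)" by (intro mult_mono add_mono) (auto simp: h_def)
    finally have "input_size (F x) + 1 \<le> h * (G * h + h) + h * h"
      using h1 by (metis add_mono mult_le_mono nat_mult_1)
    also have "\<dots> = (G + 2) * h ^ 2" by (simp add: algebra_simps power2_eq_square)
    finally have size: "input_size (F x) + 1 \<le> (G + 2) * h ^ 2" .
    have "f' (\<kappa>' (F x)) \<le> M" unfolding M_def using b by (intro member_le_sum) auto
    then have "u \<le> M * ((G + 2) * h ^ 2) ^ c'"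
      using u(2) mult_le_mono[OF _ power_mono[OF size]] by (meson le_trans zero_le)
    then have u': "u \<le> a * h ^ (2 * c')"
      by (simp only: a_def power_mult_distrib power_mult mult.assoc)
    have "h ^ (2 * c') \<le> h ^ E" "h \<le> h ^ E" "1 \<le> h ^ E"
      using h1 power_increasing[of "2 * c'" E h] power_increasing[of 1 E h]
      by (auto simp: E_def)
    then have "t + u + 1 \<le> h ^ E + a * h ^ E + h ^ E"
    proof (intro add_mono)
      show "t \<le> h ^ E" using \<open>h \<le> h ^ E\<close> by (simp add: h_def)
      show "u \<le> a * h ^ E"
        using u' \<open>h ^ (2 * c') \<le> h ^ E\<close> by (meson le_trans mult_le_mono2)
    qed
    also have "\<dots> = (2 + a) * h ^ E" by (simp only: add_mult_distrib mult_2)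
    finally have "6 * (t + u + 1) \<le> K * h ^ E" by (simp only: K_def mult.assoc mult_le_mono2)
    with v(2) have vK: "v \<le> K * h ^ E" by linarith
    have "h \<le> (f (\<kappa> x) + 1) * s ^ (c + 1)"
    proof -
      have "t \<le> f (\<kappa> x) * s ^ (c + 1)"
      proof -
        have "s ^ c \<le> s ^ (c + 1)" by (rule power_increasing) (auto simp: s_def)
        from mult_le_mono2[OF this, of "f (\<kappa> x)"] t(2) show ?thesis by linarith
      qed
      moreover have "s \<le> s ^ (c + 1)" by (rule self_le_power) (auto simp: s_def)
      ultimately show ?thesis unfolding h_def add_mult_distrib by linarith
    qed
    then have "h ^ E \<le> ((f (\<kappa> x) + 1) * s ^ (c + 1)) ^ E" by (intro power_mono) auto
    then have "K * h ^ E \<le> K * ((f (\<kappa> x) + 1) * s ^ (c + 1)) ^ E"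
      by (rule mult_le_mono2)
    with vK have "v \<le> K * ((f (\<kappa> x) + 1) * s ^ (c + 1)) ^ E" by linarith
    also have "\<dots> = K * (f (\<kappa> x) + 1) ^ E * s ^ ((c + 1) * E)"
      by (simp only: power_mult_distrib power_mult mult.assoc)
    \<comment> \<open>Rounding up to powers of two gives a factor of the form covered by
      \<open>computable_exp\<close>.\<close>
    also have "\<dots> \<le> 2 ^ K * (2 ^ f (\<kappa> x)) ^ E * s ^ ((c + 1) * E)"
      using less_exp[of K] less_exp[of "f (\<kappa> x)"]
      by (intro mult_right_mono mult_mono power_mono) linarith+
    also have "2 ^ K * (2 ^ f (\<kappa> x)) ^ E = (2::nat) ^ (E * f (\<kappa> x) + K)"
      by (simp only: power_add power_mult[symmetric] mult.commute)
    finally show ?thesis using v(1) by (auto simp: s_def)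
  qed
  then have "fpt_bounded \<kappa> R (\<lambda>x. H (F x))"
    unfolding fpt_bounded_def
    using computable_exp[OF f, of E K] by blast
  then show thesis by (rule that)
qed

section \<open>Bounded loops\<close>

text \<open>
  All loops of a program run for the same number of rounds, which is stored in array 2 and never
  modified. So the meaning of a program is a total function on states, and its running
  time is bounded by a polynomial in the number of rounds that depends on its syntax only.
\<close>

datatype prog =
    Nop
  | Asg nat exp exp
  | Then prog prog  (infixr \<open>;;\<close> 60)
  | If exp prog prog
  | Loop nat prog  \<comment> \<open>the counter is at index 0 of the given array\<close>

fun run :: "prog \<Rightarrow> state \<Rightarrow> state" where
  "run Nop s = s"
| "run (Asg a i e) s = s(a := (s a)(eval i s := eval e s))"
| "run (p ;; q) s = run q (run p s)"
| "run (If e p q) s = (if eval e s \<noteq> 0 then run p s else run q s)"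
| "run (Loop k p) s =
     ((\<lambda>r. (run p r)(k := (run p r k)(0 := Suc (run p r k 0)))) ^^ s 2 0) (s(k := (s k)(0 := 0)))"

fun code :: "prog \<Rightarrow> com" where
  "code Nop = Skip"
| "code (Asg a i e) = Put a i e"
| "code (p ;; q) = Seq (code p) (code q)"
| "code (If e p q) = Cond e (code p) (code q)"
| "code (Loop k p) = Seq (Put k (Const 0) (Const 0))
     (While (Sub (Var 2) (Var k)) (Seq (code p) (Put k (Const 0) (Add (Var k) (Const 1)))))"

fun writes :: "prog \<Rightarrow> nat set" where
  "writes Nop = {}"
| "writes (Asg a i e) = {a}"
| "writes (p ;; q) = writes p \<union> writes q"
| "writes (If e p q) = writes p \<union> writes q"
| "writes (Loop k p) = insert k (writes p)"

text \<open>The while loop in \<open>code\<close> tests array 2 and the counter in every round;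
  protecting both makes it agree with the iteration count that \<open>run\<close> fixes on
  entry.\<close>

fun wf_prog :: "prog \<Rightarrow> bool" where
  "wf_prog Nop \<longleftrightarrow> True"
| "wf_prog (Asg a i e) \<longleftrightarrow> a \<noteq> 2"
| "wf_prog (p ;; q) \<longleftrightarrow> wf_prog p \<and> wf_prog q"
| "wf_prog (If e p q) \<longleftrightarrow> wf_prog p \<and> wf_prog q"
| "wf_prog (Loop k p) \<longleftrightarrow> wf_prog p \<and> k \<noteq> 2 \<and> k \<notin> writes p"

text \<open>Adding both branches of a conditional is crude but avoids maxima. A loop pays two steps
  for the initialisation and the last test, and two more per round for test and increment.\<close>

fun time_bound :: "prog \<Rightarrow> nat \<Rightarrow> nat" where
  "time_bound Nop n = 1"
| "time_bound (Asg a i e) n = 1"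
| "time_bound (p ;; q) n = time_bound p n + time_bound q n"
| "time_bound (If e p q) n = Suc (time_bound p n + time_bound q n)"
| "time_bound (Loop k p) n = 2 + n * (time_bound p n + 2)"

lemma run_frame: "a \<notin> writes p \<Longrightarrow> run p s a = s a"
proof (induction p arbitrary: s)
  case (Loop k p)
  have "((\<lambda>r. (run p r)(k := (run p r k)(0 := Suc (run p r k 0)))) ^^ n) r a = r a" for n r
    using Loop by (induction n) auto
  then show ?case using Loop.prems by simp
qed auto

lemma wf_prog_frame: "wf_prog p \<Longrightarrow> run p s 2 = s 2"
proof -
  assume "wf_prog p"
  then have "2 \<notin> writes p" by (induction p) auto
  then show ?thesis by (rule run_frame)
qed

lemma exec_code:
  "wf_prog p \<Longrightarrow> \<exists>t. exec (code p) s t (run p s) \<and> t \<le> time_bound p (s 2 0)"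
proof (induction p arbitrary: s)
  case Nop
  then show ?case using exec.Skip[of s] by (intro exI[of _ 1]) simp
next
  case (Asg a i e)
  have "exec (code (Asg a i e)) s 1 (run (Asg a i e) s)"
    using exec.Put[of a i e s] by (simp only: code.simps run.simps)
  moreover have "1 \<le> time_bound (Asg a i e) (s 2 0)" by simp
  ultimately show ?case by blast
next
  case (Then p q)
  from Then.IH(1)[of s] Then.prems obtain t where
    t: "exec (code p) s t (run p s)" "t \<le> time_bound p (s 2 0)" by auto
  from Then.IH(2)[of "run p s"] Then.prems obtain u where
    u: "exec (code q) (run p s) u (run q (run p s))" "u \<le> time_bound q (s 2 0)"
    by (auto simp: wf_prog_frame)
  from exec.Seq[OF t(1) u(1)] t(2) u(2) show ?case by (intro exI[of _ "t + u"]) simp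
next
  case (If e p q)
  show ?case
  proof (cases "eval e s = 0")
    case True
    from If.IH(2)[of s] If.prems obtain t where
      t: "exec (code q) s t (run q s)" "t \<le> time_bound q (s 2 0)" by auto
    from exec.CondFalse[OF True t(1)] t(2) True show ?thesis by (intro exI[of _ "Suc t"]) simp
  next
    case False
    from If.IH(1)[of s] If.prems obtain t where
      t: "exec (code p) s t (run p s)" "t \<le> time_bound p (s 2 0)" by auto
    from exec.CondTrue[OF False t(1)] t(2) False show ?thesis by (intro exI[of _ "Suc t"]) simp
  qed
next
  case (Loop k p)
  let ?g = "\<lambda>r. (run p r)(k := (run p r k)(0 := Suc (run p r k 0)))"
  let ?b = "Seq (code p) (Put k (Const 0) (Add (Var k) (Const 1)))"
  let ?w = "While (Sub (Var 2) (Var k)) ?b"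
  let ?c = "time_bound p (s 2 0) + 2"
  from Loop.prems have k: "k \<noteq> 2" "k \<notin> writes p" "wf_prog p" by auto
  have loop: "\<exists>t. exec ?w r t ((?g ^^ m) r) \<and> t \<le> m * ?c + 1"
    if "r 2 0 = s 2 0" "r k 0 + m = s 2 0" for m r
    using that
  proof (induction m arbitrary: r)
    case 0
    then have "exec ?w r 1 r" by (intro exec.WhileFalse) simp
    then show ?case by (intro exI[of _ 1]) simp
  next
    case (Suc m)
    from Loop.IH[OF k(3), of r] Suc.prems obtain t where
      t: "exec (code p) r t (run p r)" "t \<le> time_bound p (s 2 0)" by auto
    have put: "exec (Put k (Const 0) (Add (Var k) (Const 1))) (run p r) 1 (?g r)"
      using exec.Put[of k "Const 0" "Add (Var k) (Const 1)" "run p r"] by simp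
    have "?g r 2 0 = s 2 0" "?g r k 0 + m = s 2 0"
      using Suc.prems k by (auto simp: wf_prog_frame run_frame)
    from Suc.IH[of "?g r", OF this] obtain u where u: "exec ?w (?g r) u ((?g ^^ m) (?g r))" "u \<le> m * ?c + 1"
      by (elim exE conjE)
    have "eval (Sub (Var 2) (Var k)) r \<noteq> 0" using Suc.prems by simp
    from exec.WhileTrue[OF this exec.Seq[OF t(1) put] u(1)] t(2) u(2)
    have "exec ?w r (Suc (t + 1 + u)) ((?g ^^ Suc m) r)" by (simp only: funpow_Suc_right o_apply)
    moreover have "Suc (t + 1 + u) \<le> Suc m * ?c + 1" using t(2) u(2) by simp
    ultimately show ?case by blast
  qed
  let ?s = "s(k := (s k)(0 := 0))"
  have put: "exec (Put k (Const 0) (Const 0)) s 1 ?s"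
    using exec.Put[of k "Const 0" "Const 0" s] by simp
  have "?s 2 0 = s 2 0" "?s k 0 + s 2 0 = s 2 0" using k by auto
  from loop[of ?s, OF this] obtain t where t: "exec ?w ?s t ((?g ^^ s 2 0) ?s)" "t \<le> s 2 0 * ?c + 1"
    by (elim exE conjE)
  from exec.Seq[OF put t(1)] t(2) show ?case by (intro exI[of _ "1 + t"]) simp
qed

text \<open>The exponents of subprograms are simply added, and a loop raises the exponent by one; so
  the degree depends on the program text alone.\<close>

lemma time_bound_poly: "\<exists>K e. \<forall>n. time_bound p n \<le> K * (n + 1) ^ e"
proof (induction p)
  case Nop
  show ?case by (rule exI[of _ 1], rule exI[of _ 0]) simp
next
  case (Asg a i e)
  show ?case by (rule exI[of _ 1], rule exI[of _ 0]) simp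
next
  case (Then p q)
  then obtain K e L d where *: "\<And>n. time_bound p n \<le> K * (n + 1) ^ e"
    "\<And>n. time_bound q n \<le> L * (n + 1) ^ d"
    by blast
  have "time_bound (p ;; q) n \<le> (K + L) * (n + 1) ^ (e + d)" for n
  proof -
    have "K * (n + 1) ^ e \<le> K * (n + 1) ^ (e + d)" "L * (n + 1) ^ d \<le> L * (n + 1) ^ (e + d)"
      by (intro mult_le_mono2 power_increasing; simp)+
    with *(1)[of n] *(2)[of n] show ?thesis
      unfolding time_bound.simps add_mult_distrib by linarith
  qed
  then show ?case by blast
next
  case (If c p q)
  then obtain K e L d where *: "\<And>n. time_bound p n \<le> K * (n + 1) ^ e"
    "\<And>n. time_bound q n \<le> L * (n + 1) ^ d"
    by blast
  have "time_bound (If c p q) n \<le> (K + L + 1) * (n + 1) ^ (e + d)" for n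
  proof -
    have "K * (n + 1) ^ e \<le> K * (n + 1) ^ (e + d)" "L * (n + 1) ^ d \<le> L * (n + 1) ^ (e + d)"
      by (intro mult_le_mono2 power_increasing; simp)+
    moreover have "1 \<le> (n + 1) ^ (e + d)" by simp
    ultimately show ?thesis using *(1)[of n] *(2)[of n]
      unfolding time_bound.simps add_mult_distrib nat_mult_1 by linarith
  qed
  then show ?case by blast
next
  case (Loop k p)
  then obtain K e where *: "\<And>n. time_bound p n \<le> K * (n + 1) ^ e" by blast
  have "time_bound (Loop k p) n \<le> (K + 2) * (n + 1) ^ (e + 1)" for n
  proof -
    let ?P = "(n + 1) ^ e"
    have "1 \<le> ?P" by simp
    have "n * (time_bound p n + 2) \<le> n * (K * ?P + 2 * ?P)"
      using *[of n] \<open>1 \<le> ?P\<close> by (intro mult_le_mono2 add_mono) linarith+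
    then have "time_bound (Loop k p) n \<le> 2 * ?P + n * (K * ?P + 2 * ?P)"
      using \<open>1 \<le> ?P\<close> unfolding time_bound.simps by linarith
    also have "\<dots> \<le> (K + 2) * (n + 1) ^ (e + 1)"
      by (simp add: algebra_simps)
    finally show ?thesis .
  qed
  then show ?case by blast
qed

section \<open>Loop invariants and polynomial running time\<close>

lemma run_Loop_invariant:
  assumes init: "I 0 (s(k := (s k)(0 := 0)))"
    and step: "\<And>i r. i < s 2 0 \<Longrightarrow> I i r \<Longrightarrow> r k 0 = i \<Longrightarrow>
      I (Suc i) ((run p r)(k := (run p r k)(0 := Suc i)))"
    and k: "k \<notin> writes p"
  shows "I (s 2 0) (run (Loop k p) s)"
proof -
  define g where "g = (\<lambda>r. (run p r)(k := (run p r k)(0 := Suc (run p r k 0))))"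
  define s0 where "s0 = s(k := (s k)(0 := 0))"
  have "I i ((g ^^ i) s0) \<and> (g ^^ i) s0 k 0 = i"
    if "i \<le> s 2 0" for i
    using that
  proof (induction i)
    case 0
    have "I 0 s0" "s0 k 0 = 0" unfolding s0_def using init by (blast, simp)
    then show ?case by simp
  next
    case (Suc i)
    let ?r = "(g ^^ i) s0"
    have "I i ?r" "?r k 0 = i" "i < s 2 0" using Suc by auto
    then have "I (Suc i) ((run p ?r)(k := (run p ?r k)(0 := Suc i)))" by (intro step)
    moreover have "run p ?r k 0 = i" using run_frame[OF k, of ?r] \<open>?r k 0 = i\<close> by simp
    ultimately have "I (Suc i) (g ?r) \<and> g ?r k 0 = Suc i" by (simp add: g_def)
    then show ?case by simp
  qed
  then have "I (s 2 0) ((g ^^ s 2 0) s0)" by blast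
  then show ?thesis by (simp only: run.simps g_def s0_def)
qed

text \<open>A loop whose rounds from \<open>eval b s\<close> on are idle.\<close>

abbreviation For :: "nat \<Rightarrow> exp \<Rightarrow> prog \<Rightarrow> prog" where
  "For k b p \<equiv> Loop k (If (Sub b (Var k)) p Nop)"

text \<open>Among the first \<open>i\<close> rounds, \<open>min n i\<close> are effective, so the
  invariant stands still once the bound is reached. The counter nevertheless goes on, hence
  \<open>idle\<close>; and \<open>n \<le> s 2 0\<close> says that the available rounds
  suffice.\<close>

lemma run_For_invariant:
  assumes init: "I 0 (s(k := (s k)(0 := 0)))"
    and step: "\<And>i r. i < n \<Longrightarrow> I i r \<Longrightarrow> r k 0 = i \<Longrightarrow>
      I (Suc i) ((run p r)(k := (run p r k)(0 := Suc i)))"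
    and bound: "\<And>i r. I i r \<Longrightarrow> eval b r = n"
    and idle: "\<And>r c. I n r \<Longrightarrow> I n (r(k := (r k)(0 := c)))"
    and n: "n \<le> s 2 0" and k: "k \<notin> writes p"
  shows "I n (run (For k b p) s)"
proof -
  let ?p = "If (Sub b (Var k)) p Nop"
  have "I (min n (s 2 0)) (run (For k b p) s)"
  proof (rule run_Loop_invariant[where I = "\<lambda>i. I (min n i)"])
    show "I (min n 0) (s(k := (s k)(0 := 0)))" using init by simp
    show "k \<notin> writes ?p" using k by simp
    show "I (min n (Suc i)) ((run ?p r)(k := (run ?p r k)(0 := Suc i)))"
      if "I (min n i) r" "r k 0 = i" for i r
    proof (cases "i < n")
      case True
      then show ?thesis using step[of i r] that bound[of i r] by (simp add: min_absorb2)
    next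
      case False
      then show ?thesis using idle[of r "Suc i"] that bound[of n r] by (simp add: min_absorb1)
    qed
  qed
  then show ?thesis using n by (simp add: min_absorb1)
qed

text \<open>With linearly many rounds the time is polynomial, so a concrete program only needs
  correctness of the total function \<open>run\<close>. The constant parameter function expresses
  ordinary polynomial time; \<open>len\<close> pays for the charge on output entries.\<close>

lemma fpt_bounded_code:
  assumes wf: "wf_prog p"
    and res: "\<And>x. result (run p ((init x)(2 := (init x 2)(0 := c * (length x + 1))))) = F x"
    and len: "\<And>x. length (F x) \<le> K * (length x + 1) ^ e"
  shows "fpt_bounded (\<lambda>_. 0) (Seq (Put 2 (Const 0) (times_exp c (Add (Var 0) (Const 1)))) (code p)) F"
proof -
  obtain L d where L: "\<And>n. time_bound p n \<le> L * (n + 1) ^ d" using time_bound_poly by blast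
  let ?E = "1 + L * (c + 1) ^ d + K"
  have "\<exists>t. computes (Seq (Put 2 (Const 0) (times_exp c (Add (Var 0) (Const 1)))) (code p)) x (F x) t \<and>
      t \<le> ?E * (input_size x + 1) ^ (d + e)" for x
  proof -
    let ?n = "c * (length x + 1)" and ?b = "input_size x + 1"
    let ?s = "(init x)(2 := (init x 2)(0 := ?n))"
    have put: "exec (Put 2 (Const 0) (times_exp c (Add (Var 0) (Const 1)))) (init x) 1 ?s"
      using exec.Put[of 2 "Const 0" "times_exp c (Add (Var 0) (Const 1))" "init x"]
      by (simp add: init_def)
    from exec_code[OF wf, of ?s] obtain t where t: "exec (code p) ?s t (run p ?s)"
      "t \<le> time_bound p ?n" by auto
    have "computes (Seq (Put 2 (Const 0) (times_exp c (Add (Var 0) (Const 1)))) (code p)) x (F x)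
        (1 + t + length (F x))"
      unfolding computes_def using exec.Seq[OF put t(1)] res[of x] by blast
    moreover have "t \<le> L * (c + 1) ^ d * ?b ^ (d + e)"
    proof -
      have "t \<le> L * (?n + 1) ^ d" using t(2) L[of ?n] by linarith
      also have "?n \<le> c * ?b"
        using length_le_input_size[of x] by (intro mult_le_mono2) simp
      then have "?n + 1 \<le> (c + 1) * ?b" unfolding add_mult_distrib nat_mult_1 by linarith
      then have "(?n + 1) ^ d \<le> ((c + 1) * ?b) ^ d" by (intro power_mono) auto
      then have "L * (?n + 1) ^ d \<le> L * ((c + 1) * ?b) ^ d" by (rule mult_le_mono2)
      also have "\<dots> = L * (c + 1) ^ d * ?b ^ d"
        by (simp only: power_mult_distrib mult.assoc)
      also have "\<dots> \<le> L * (c + 1) ^ d * ?b ^ (d + e)"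
        by (intro mult_le_mono2 power_increasing) auto
      finally show ?thesis .
    qed
    moreover have "length (F x) \<le> K * ?b ^ (d + e)"
    proof -
      have "length (F x) \<le> K * (length x + 1) ^ e" by (rule len)
      also have "\<dots> \<le> K * ?b ^ e"
        using length_le_input_size[of x] by (intro mult_le_mono2 power_mono) auto
      also have "\<dots> \<le> K * ?b ^ (d + e)"
        by (intro mult_le_mono2 power_increasing) auto
      finally show ?thesis .
    qed
    moreover have "1 \<le> ?b ^ (d + e)" by simp
    moreover from calculation have "1 + t + length (F x) \<le> ?E * ?b ^ (d + e)"
      unfolding add_mult_distrib nat_mult_1 by linarith
    ultimately show ?thesis by blast
  qed
  then show ?thesis
    unfolding fpt_bounded_def using computable_const[of ?E] by blast
qed

section \<open>From subset sum to M-EPVCB\<close>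

text \<open>
  The graph consists of disjoint edges \<open>{2 * i + 1, 2 * i + 2}\<close>, and of a further vertex 0
  that is adjacent to all \<open>2 * i + 1\<close>. A matching of weight \<open>m * N + T\<close> forces the selection of \<open>m\<close>
  indices with sum at least \<open>T\<close>, and then the total weight bounds the sum by \<open>T\<close> from above,
  because index \<open>i\<close> covers \<open>N + N' - x i\<close>. The indices from \<open>m\<close> on only pad
  the selection.
\<close>

locale gadget =
  fixes x :: "nat \<Rightarrow> nat" and m T X N N' :: nat
  assumes X: "X = (\<Sum>i<m. x i)" and N': "N' = 2 * X + 1" and N: "N = (m + 2) * (X + 1)"
    and pad: "\<And>i. m \<le> i \<Longrightarrow> x i = 0"
begin

definition rung :: "nat \<Rightarrow> nat set" where
  "rung i = {2 * i + 1, 2 * i + 2}"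

definition spoke :: "nat \<Rightarrow> nat set" where
  "spoke i = {0, 2 * i + 1}"

text \<open>The factor 2 in the spoke turns the gain \<open>x i\<close> of the rung into a net loss
  \<open>x i\<close> of the pair, and \<open>N' = 2 * X + 1\<close> keeps spokes positive.
  \<open>N\<close> exceeds \<open>m * X + N'\<close>, so that all items and one spoke together
  cannot make up for a missing rung.\<close>

definition es :: "weighted_edge list" where
  "es = concat (map (\<lambda>i. [(2 * i + 1, 2 * i + 2, N + x i), (0, 2 * i + 1, N' - 2 * x i)]) [0..<2 * m])"

definition inst :: raw_instance where
  "inst = (4 * m + 1, es, m, m * (N + N') - T, m * N + T)"

lemma x_le: "x i \<le> X"
proof (cases "i < m")
  case True
  then show ?thesis unfolding X by (intro member_le_sum) auto
qed (simp add: pad)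

lemma rung_eq [simp]: "rung i = rung j \<longleftrightarrow> i = j"
  by (auto simp: rung_def doubleton_eq_iff)

lemma spoke_eq [simp]: "spoke i = spoke j \<longleftrightarrow> i = j"
  by (auto simp: spoke_def doubleton_eq_iff)

lemma rung_neq_spoke [simp]: "rung i \<noteq> spoke j" "spoke j \<noteq> rung i"
  by (auto simp: spoke_def rung_def doubleton_eq_iff)

lemma odd_in_rung [simp]: "Suc (2 * i) \<in> rung j \<longleftrightarrow> i = j"
  by (auto simp: rung_def)

lemma rung_disjoint: "v \<in> rung i \<Longrightarrow> v \<in> rung j \<Longrightarrow> i = j"
  by (auto simp: rung_def)

lemma odd_in_spoke [simp]: "Suc (2 * i) \<in> spoke j \<longleftrightarrow> i = j"
  by (auto simp: spoke_def)

lemma zero_in_rung [simp]: "0 \<notin> rung i"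
  by (simp add: rung_def)

lemma zero_in_spoke [simp]: "0 \<in> spoke i"
  by (simp add: spoke_def)

lemma set_es: "set es = (\<lambda>i. (2 * i + 1, 2 * i + 2, N + x i)) ` {..<2 * m} \<union>
    (\<lambda>i. (0, 2 * i + 1, N' - 2 * x i)) ` {..<2 * m}"
  by (auto simp: es_def)

lemma edges_es: "edges es = rung ` {..<2 * m} \<union> spoke ` {..<2 * m}"
  unfolding edges_def set_es by (simp add: image_Un image_image edge_of_def rung_def spoke_def)

lemma distinct_es: "distinct (map edge_of es)"
proof -
  have "distinct (concat (map (\<lambda>i. [rung i, spoke i]) [0..<k]))" for k
    by (induction k) auto
  moreover have "map edge_of es = concat (map (\<lambda>i. [rung i, spoke i]) [0..<2 * m])"
    by (simp add: es_def map_concat edge_of_def rung_def spoke_def o_def)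
  ultimately show ?thesis by simp
qed

lemma weight_rung: "i < 2 * m \<Longrightarrow> weight es (rung i) = N + x i"
  unfolding rung_def by (rule weight_eq[OF distinct_es]) (auto simp: set_es)

lemma weight_spoke: "i < 2 * m \<Longrightarrow> weight es (spoke i) = N' - 2 * x i"
  unfolding spoke_def by (rule weight_eq[OF distinct_es]) (auto simp: set_es)

lemma weight_both: "i < 2 * m \<Longrightarrow> weight es (rung i) + weight es (spoke i) + x i = N + N'"
  using x_le[of i] weight_rung[of i] weight_spoke[of i] N' by linarith

lemma graph_es: "graph {..<4 * m + 1} (edges es)"
proof -
  have "\<exists>u<4 * m + 1. \<exists>v<4 * m + 1. u \<noteq> v \<and> rung i = {u, v}" if "i < 2 * m" for i
    using that by (intro exI[of _ "2 * i + 1"] conjI exI[of _ "2 * i + 2"]) (auto simp: rung_def)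
  moreover have "\<exists>u<4 * m + 1. \<exists>v<4 * m + 1. u \<noteq> v \<and> spoke i = {u, v}" if "i < 2 * m" for i
    using that by (intro exI[of _ 0] conjI exI[of _ "2 * i + 1"]) (auto simp: spoke_def)
  ultimately show ?thesis
    unfolding graph_def edges_es by (auto simp: Bex_def)
qed

lemma bipartite_es: "bipartite {..<4 * m + 1} (edges es)"
  unfolding bipartite_def
proof (intro exI conjI)
  let ?X = "{v. v < 4 * m + 1 \<and> odd v}" and ?Y = "{v. v < 4 * m + 1 \<and> even v}"
  show "?X \<union> ?Y = {..<4 * m + 1}" "?X \<inter> ?Y = {}" by auto
  show "\<forall>e\<in>edges es. \<exists>u\<in>?X. \<exists>v\<in>?Y. e = {u, v}"
  proof
    fix e assume "e \<in> edges es"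
    then obtain i where i: "i < 2 * m" "e = rung i \<or> e = spoke i" by (auto simp: edges_es)
    then show "\<exists>u\<in>?X. \<exists>v\<in>?Y. e = {u, v}"
    proof (elim disjE)
      assume "e = rung i"
      then show ?thesis
        using i(1) by (intro bexI[of _ "2 * i + 1"] bexI[of _ "2 * i + 2"]) (auto simp: rung_def)
    next
      assume "e = spoke i"
      then show ?thesis
        using i(1) by (intro bexI[of _ "2 * i + 1"] bexI[of _ 0]) (auto simp: spoke_def)
    qed
  qed
qed

text \<open>The second condition is positivity of the coverage bound. For larger \<open>T\<close>
  the subtraction is truncated to 0 and the instance is invalid, in accordance with \<open>T\<close>
  being out of reach of the items.\<close>

lemma valid_inst: "valid inst \<longleftrightarrow> 0 < m \<and> T < m * (N + N')"
proof -
  have "weight es e > 0" if "e \<in> edges es" for e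
  proof -
    from that obtain i where i: "i < 2 * m" "e = rung i \<or> e = spoke i" by (auto simp: edges_es)
    moreover have "0 < N" "2 * x i < N'" using x_le[of i] by (auto simp: N N')
    ultimately show ?thesis by (auto simp: weight_rung weight_spoke)
  qed
  moreover have "0 < m * N + T" if "0 < m" using that by (simp add: N)
  ultimately show ?thesis
    unfolding inst_def valid.simps mepvcb_instance_def
    using distinct_es graph_es bipartite_es by auto
qed

text \<open>The odd end of a rung covers exactly this rung and the spoke of the same index, so the
  selected odd ends meet the coverage bound and their rungs are the matching.\<close>

lemma yes_inst_if:
  assumes I: "I \<subseteq> {..<m}" "(\<Sum>i\<in>I. x i) = T"
  shows "yes_instance inst"
proof -
  have card_I: "card I \<le> m" using I(1) by (metis card_lessThan card_mono finite_lessThan)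
  have fin_I: "finite I" using I(1) finite_subset by blast
  \<comment> \<open>Indices from \<open>m\<close> on have item 0, so they raise the number of
    selected indices to \<open>m\<close> without changing the sum.\<close>
  define J where "J = I \<union> {m..<m + (m - card I)}"
  have J: "J \<subseteq> {..<2 * m}" "finite J" using I(1) fin_I by (auto simp: J_def)
  have "card J = card I + card {m..<m + (m - card I)}"
    unfolding J_def using I(1) fin_I by (intro card_Un_disjoint) auto
  then have card_J: "card J = m" using card_I by simp
  have "(\<Sum>i\<in>J. x i) = (\<Sum>i\<in>I. x i) + (\<Sum>i\<in>{m..<m + (m - card I)}. x i)"
    unfolding J_def using I(1) fin_I by (intro sum.union_disjoint) auto
  then have sum_J: "(\<Sum>i\<in>J. x i) = T" using I(2) by (simp add: pad)
  define U where "U = (\<lambda>i. 2 * i + 1) ` J"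
  have U: "U \<subseteq> {..<4 * m + 1}" using J(1) by (auto simp: U_def)
  have card_U: "card U \<le> m" unfolding U_def using card_image_le[OF J(2)] card_J by metis
  have inc: "incident_edges (edges es) U = rung ` J \<union> spoke ` J"
    using J(1) by (auto simp: incident_edges_def edges_es U_def) (auto simp: rung_def spoke_def)
  have "(\<Sum>e\<in>incident_edges (edges es) U. weight es e) =
      (\<Sum>e\<in>rung ` J. weight es e) + (\<Sum>e\<in>spoke ` J. weight es e)"
    unfolding inc using J(2) by (intro sum.union_disjoint) auto
  also have "\<dots> = (\<Sum>i\<in>J. weight es (rung i)) + (\<Sum>i\<in>J. weight es (spoke i))"
    by (simp add: sum.reindex inj_on_def)
  finally have "(\<Sum>e\<in>incident_edges (edges es) U. weight es e) + (\<Sum>i\<in>J. x i) =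
      (\<Sum>i\<in>J. weight es (rung i) + weight es (spoke i) + x i)"
    by (simp add: sum.distrib)
  also have "\<dots> = (\<Sum>i\<in>J. N + N')" using J(1) by (intro sum.cong refl weight_both) auto
  also have "\<dots> = m * (N + N')" by (simp add: card_J)
  finally have cover: "m * (N + N') - T \<le> (\<Sum>e\<in>incident_edges (edges es) U. weight es e)"
    by (simp add: sum_J)
  have match: "matching (incident_edges (edges es) U) (rung ` J)"
    unfolding matching_def inc using rung_disjoint by blast
  have "(\<Sum>e\<in>rung ` J. weight es e) = (\<Sum>i\<in>J. N + x i)"
    using J(1) by (subst sum.reindex) (auto simp: inj_on_def weight_rung intro!: sum.cong)
  also have "\<dots> = m * N + T" by (simp add: sum.distrib card_J sum_J)
  finally have heavy: "m * N + T \<le> (\<Sum>e\<in>rung ` J. weight es e)" by simp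
  show ?thesis
    unfolding inst_def yes_instance.simps mepvcb_yes_def
    using U card_U cover match heavy by (intro exI[of _ U] conjI exI[of _ "rung ` J"])
qed

text \<open>The matching bound forces \<open>U\<close> to spend its \<open>m\<close> vertices on
  \<open>m\<close> different rungs, none on vertex 0. Then all edges that count for either bound
  have their index in \<open>J\<close>, and the two bounds enclose the sum of the items.\<close>

lemma yes_inst_only_if:
  assumes "yes_instance inst" and "0 < m"
  obtains I where "I \<subseteq> {..<m}" "(\<Sum>i\<in>I. x i) = T"
proof -
  from assms(1) have "mepvcb_yes {..<4 * m + 1} (edges es) (weight es) m (m * (N + N') - T) (m * N + T)"
    by (simp only: inst_def yes_instance.simps)
  then obtain U where U: "U \<subseteq> {..<4 * m + 1}" "card U \<le> m"
    and cover: "m * (N + N') - T \<le> (\<Sum>e\<in>incident_edges (edges es) U. weight es e)"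
    and "\<exists>M. matching (incident_edges (edges es) U) M \<and> m * N + T \<le> (\<Sum>e\<in>M. weight es e)"
    unfolding mepvcb_yes_def by metis
  then obtain M where
    M: "matching (incident_edges (edges es) U) M" "m * N + T \<le> (\<Sum>e\<in>M. weight es e)"
    by metis
  have fin_U: "finite U" using U(1) finite_subset by blast
  have fin_M: "finite M"
  proof (rule finite_subset)
    show "M \<subseteq> edges es" using M(1) by (auto simp: matching_def incident_edges_def)
    show "finite (edges es)" by (simp add: edges_es)
  qed
  define J where "J = {i. i < 2 * m \<and> rung i \<inter> U \<noteq> {}}"
  have J: "finite J" "J \<subseteq> {..<2 * m}" by (auto simp: J_def)
  have "\<forall>i\<in>J. \<exists>v. v \<in> rung i \<and> v \<in> U" by (auto simp: J_def)
  then obtain f where f: "\<And>i. i \<in> J \<Longrightarrow> f i \<in> rung i" "\<And>i. i \<in> J \<Longrightarrow> f i \<in> U"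
    by (metis bchoice)
  have card_J: "card J \<le> card (U - {0})"
  proof (rule card_inj_on_le)
    show "inj_on f J"
    proof (rule inj_onI)
      fix i j assume "i \<in> J" "j \<in> J" "f i = f j"
      then show "i = j" using f(1)[of i] f(1)[of j] rung_disjoint[of "f i" i j] by simp
    qed
    have "f i \<in> U - {0}" if "i \<in> J" for i
      using f[OF that] zero_in_rung[of i] by (metis DiffI singletonD)
    then show "f ` J \<subseteq> U - {0}" by (rule image_subsetI)
  qed (use fin_U in simp)
  have edge_M: "\<exists>i<2 * m. e = rung i \<or> e = spoke i" if "e \<in> M" for e
    using that M(1) by (auto simp: matching_def incident_edges_def edges_es)
  \<comment> \<open>Every edge has exactly one odd end, and \<open>h\<close> reads off its index.
    Disjoint edges have different odd ends, so \<open>h\<close> is injective on a matching.\<close>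
  define h where "h = (\<lambda>e :: nat set. THE i. Suc (2 * i) \<in> e)"
  have h [simp]: "h (rung i) = i" "h (spoke i) = i" for i by (auto simp: h_def)
  have inj_h: "inj_on h M"
  proof (rule inj_onI)
    fix e f assume "e \<in> M" "f \<in> M" "h e = h f"
    moreover have "Suc (2 * h e) \<in> e" "Suc (2 * h f) \<in> f" using edge_M \<open>e \<in> M\<close> \<open>f \<in> M\<close> by force+
    ultimately show "e = f" using M(1) by (auto simp: matching_def)
  qed
  have weight_le: "weight es e \<le> N + x (h e)" if "e \<in> M" for e
  proof -
    have "N' \<le> N" by (simp add: N N')
    then show ?thesis using edge_M[OF that] by (auto simp: weight_rung weight_spoke)
  qed
  have part: "(\<Sum>e\<in>L. weight es e) \<le> (\<Sum>i\<in>J. N + x i)" if "L \<subseteq> M" "h ` L \<subseteq> J" for L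
  proof -
    have "(\<Sum>e\<in>L. weight es e) \<le> (\<Sum>e\<in>L. N + x (h e))"
      using weight_le that(1) by (intro sum_mono) auto
    also have "\<dots> = (\<Sum>i\<in>h ` L. N + x i)"
      using inj_on_subset[OF inj_h that(1)] by (simp add: sum.reindex)
    also have "\<dots> \<le> (\<Sum>i\<in>J. N + x i)" using that(2) J(1) by (intro sum_mono2) auto
    finally show ?thesis .
  qed
  have rung_J: "i \<in> J" if "rung i \<in> M" for i
    using that M(1) by (fastforce simp: J_def matching_def incident_edges_def edges_es)
  \<comment> \<open>With fewer touched rungs, the matching has at most \<open>m - 1\<close> rungs
    and, since spokes share vertex 0, at most one spoke. By the choice of \<open>N\<close> this
    weighs less than \<open>m * N\<close>.\<close>
  have "m \<le> card J"
  proof (rule ccontr)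
    assume "\<not> m \<le> card J"
    then have "card J \<le> m - 1" by simp
    let ?L = "{e \<in> M. 0 \<in> e}"
    have "finite ?L" using fin_M by simp
    moreover have "e = f" if "e \<in> ?L" "f \<in> ?L" for e f
      using that M(1) unfolding matching_def by blast
    ultimately have "card ?L \<le> 1" using card_le_Suc0_iff_eq[of ?L] by simp
    moreover have "weight es e \<le> N'" if "e \<in> ?L" for e
      using edge_M[of e] that by (auto simp: weight_spoke)
    ultimately have "(\<Sum>e\<in>?L. weight es e) \<le> N'"
    proof -
      assume *: "card ?L \<le> 1" "\<And>e. e \<in> ?L \<Longrightarrow> weight es e \<le> N'"
      have "(\<Sum>e\<in>?L. weight es e) \<le> card ?L * N'"
        using sum_bounded_above[of ?L "weight es" N'] *(2) by simp
      also have "\<dots> \<le> 1 * N'" using *(1) by (rule mult_le_mono1)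
      finally show ?thesis by simp
    qed
    moreover have "(\<Sum>e\<in>M - ?L. weight es e) \<le> (\<Sum>i\<in>J. N + x i)"
    proof (rule part)
      show "h ` (M - ?L) \<subseteq> J" using edge_M rung_J by fastforce
    qed auto
    moreover have "(\<Sum>i\<in>J. N + x i) \<le> (\<Sum>i\<in>J. N + X)"
      using x_le by (intro sum_mono) simp
    moreover have "(\<Sum>i\<in>J. N + X) \<le> (m - 1) * (N + X)"
      using \<open>card J \<le> m - 1\<close> by simp
    moreover have "(\<Sum>e\<in>M. weight es e) = (\<Sum>e\<in>M - ?L. weight es e) + (\<Sum>e\<in>?L. weight es e)"
      using fin_M by (intro sum.subset_diff) auto
    ultimately have "m * N + T \<le> (m - 1) * (N + X) + N'" using M(2) by linarith
    moreover have "m * N = (m - 1) * N + N" using assms(2) by (cases m) auto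
    moreover have "(m - 1) * X \<le> m * X" by (intro mult_le_mono1) simp
    ultimately have "N + T \<le> m * X + N'" by (simp add: algebra_simps)
    then show False by (simp add: N N')
  qed
  have "0 \<notin> U"
  proof
    assume "0 \<in> U"
    then have "card (U - {0}) < card U" using fin_U by (intro card_Diff1_less)
    with \<open>m \<le> card J\<close> card_J U(2) show False by linarith
  qed
  with \<open>m \<le> card J\<close> card_J U(2) have "card J = m" by simp
  \<comment> \<open>As 0 is not in \<open>U\<close>, a spoke can be covered only at its odd end,
    which lies on the rung of the same index.\<close>
  have spoke_J: "i \<in> J" if "spoke i \<in> incident_edges (edges es) U" for i
    using that \<open>0 \<notin> U\<close> by (auto simp: J_def incident_edges_def edges_es spoke_def rung_def)
  have rung_J': "i \<in> J" if "rung i \<in> incident_edges (edges es) U" for i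
    using that by (auto simp: J_def incident_edges_def edges_es)
  have "h ` M \<subseteq> J"
  proof
    fix i assume "i \<in> h ` M"
    then obtain e where e: "e \<in> M" "i = h e" by auto
    with edge_M[of e] M(1) spoke_J rung_J show "i \<in> J" by (auto simp: matching_def)
  qed
  from part[OF subset_refl this] M(2) have "m * N + T \<le> m * N + (\<Sum>i\<in>J. x i)"
    by (simp add: sum.distrib \<open>card J = m\<close>)
  then have ge: "T \<le> (\<Sum>i\<in>J. x i)" by simp
  have inc: "incident_edges (edges es) U \<subseteq> rung ` J \<union> spoke ` J"
  proof
    fix e assume e: "e \<in> incident_edges (edges es) U"
    then obtain i where "e = rung i \<or> e = spoke i" by (auto simp: incident_edges_def edges_es)
    then show "e \<in> rung ` J \<union> spoke ` J" using e spoke_J rung_J' by auto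
  qed
  have "(\<Sum>e\<in>incident_edges (edges es) U. weight es e) \<le> (\<Sum>e\<in>rung ` J \<union> spoke ` J. weight es e)"
    using inc J(1) by (intro sum_mono2) auto
  also have "\<dots> = (\<Sum>e\<in>rung ` J. weight es e) + (\<Sum>e\<in>spoke ` J. weight es e)"
    using J(1) by (intro sum.union_disjoint) auto
  also have "\<dots> = (\<Sum>i\<in>J. weight es (rung i)) + (\<Sum>i\<in>J. weight es (spoke i))"
    by (simp add: sum.reindex inj_on_def)
  finally have "(\<Sum>e\<in>incident_edges (edges es) U. weight es e) + (\<Sum>i\<in>J. x i) \<le>
      (\<Sum>i\<in>J. weight es (rung i) + weight es (spoke i) + x i)"
    by (simp add: sum.distrib)
  also have "\<dots> = (\<Sum>i\<in>J. N + N')" using J(2) by (intro sum.cong refl weight_both) auto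
  also have "\<dots> = m * (N + N')" by (simp add: \<open>card J = m\<close>)
  \<comment> \<open>Either the subtraction is exact and the sum is at most \<open>T\<close>, or it
    is truncated and the sum is at most \<open>m * (N + N')\<close>, which is below
    \<open>T\<close>.\<close>
  finally have "m * (N + N') - T + (\<Sum>i\<in>J. x i) \<le> m * (N + N')" using cover by simp
  with ge have "(\<Sum>i\<in>J. x i) = T" by linarith
  moreover have "(\<Sum>i\<in>J. x i) = (\<Sum>i\<in>J \<inter> {..<m}. x i)"
    using J(1) pad by (intro sum.mono_neutral_right) (auto simp: not_less[symmetric])
  ultimately show thesis using that[of "J \<inter> {..<m}"] by simp
qed

lemma inst_correct:
  assumes "0 < m"
  shows "valid inst \<and> yes_instance inst \<longleftrightarrow> (\<exists>I\<subseteq>{..<m}. (\<Sum>i\<in>I. x i) = T)"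
proof
  assume "valid inst \<and> yes_instance inst"
  then show "\<exists>I\<subseteq>{..<m}. (\<Sum>i\<in>I. x i) = T" using yes_inst_only_if assms by metis
next
  assume "\<exists>I\<subseteq>{..<m}. (\<Sum>i\<in>I. x i) = T"
  then obtain I where I: "I \<subseteq> {..<m}" "(\<Sum>i\<in>I. x i) = T" by blast
  have "T \<le> X" unfolding X I(2)[symmetric] using I(1) by (intro sum_mono2) auto
  also have "X < 1 * (N + N')" by (simp add: N')
  also have "\<dots> \<le> m * (N + N')" using assms by (intro mult_le_mono1) simp
  finally show "valid inst \<and> yes_instance inst"
    using valid_inst assms yes_inst_if[OF I] by simp
qed

text \<open>The \<open>2 * m\<close> rungs miss only vertex 0. An edge between their ends cannot be
  a spoke, as spokes contain 0, so it is a rung itself and no forbidden path exists.\<close>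

lemma param_inst: "param inst \<le> 1"
proof -
  let ?M = "rung ` {..<2 * m}"
  have "\<not> ({b, c} \<in> edges es \<and> {a, b} \<in> ?M \<and> {c, d} \<in> ?M)" if "distinct [a, b, c, d]" for a b c d
  proof
    assume *: "{b, c} \<in> edges es \<and> {a, b} \<in> ?M \<and> {c, d} \<in> ?M"
    then obtain i j where ij: "{a, b} = rung i" "{c, d} = rung j" by auto
    then have "0 \<noteq> b" "0 \<noteq> c" by (metis insertI1 insertI2 zero_in_rung)+
    then have "{b, c} \<noteq> spoke l" for l by (metis insert_iff singletonD zero_in_spoke)
    then obtain l where l: "{b, c} = rung l" using * by (auto simp: edges_es)
    have "l = i" using rung_disjoint[of b l i] ij(1) l by blast
    then show False using ij(1) l that by (auto simp: doubleton_eq_iff)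
  qed
  moreover have "matching (edges es) ?M"
    unfolding matching_def edges_es using rung_disjoint by blast
  ultimately have "induced_matching (edges es) ?M"
    unfolding induced_matching_def by blast
  moreover have "finite {card M | M. induced_matching (edges es) M}"
  proof (rule finite_subset)
    show "{card M | M. induced_matching (edges es) M} \<subseteq> card ` Pow (edges es)"
      by (auto simp: induced_matching_def matching_def)
    show "finite (card ` Pow (edges es))" by (simp add: edges_es)
  qed
  ultimately have "card ?M \<le> induced_matching_number (edges es)"
    unfolding induced_matching_number_def by (intro Max_ge) auto
  moreover have "card ?M = 2 * m" by (subst card_image) (auto simp: inj_on_def)
  ultimately show ?thesis by (simp add: inst_def)
qed

end


section \<open>The reduction as a map on lists, and its program\<close>

definition subset_sum :: "nat list \<Rightarrow> bool" where
  "subset_sum zs \<longleftrightarrow> (\<exists>I\<subseteq>{..<length zs - 1}. (\<Sum>i\<in>I. zs ! Suc i) = zs ! 0)"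

text \<open>Taking the item from the initial memory instead of the list makes it 0 beyond the end,
  as \<open>pad\<close> demands, and identical to what the program reads.\<close>

definition item :: "nat list \<Rightarrow> nat \<Rightarrow> nat" where
  "item zs i = init zs 0 (i + 2)"

definition items_sum :: "nat list \<Rightarrow> nat" where
  "items_sum zs = (\<Sum>i<length zs - 1. item zs i)"

definition reduction :: "nat list \<Rightarrow> raw_instance" where
  "reduction zs = gadget.inst (item zs) (length zs - 1) (init zs 0 1)
     ((length zs - 1 + 2) * (items_sum zs + 1)) (2 * items_sum zs + 1)"

lemma gadget_reduction: "gadget (item zs) (length zs - 1) (items_sum zs)
  ((length zs - 1 + 2) * (items_sum zs + 1)) (2 * items_sum zs + 1)"
  by unfold_locales (auto simp: items_sum_def item_def init_def)

lemma encode_reduction_correct: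
  assumes "2 \<le> length zs"
  shows "encode (reduction zs) \<in> M_EPVCB \<longleftrightarrow> subset_sum zs"
proof -
  have "item zs i = zs ! Suc i" if "i < length zs - 1" for i
    using that by (auto simp: item_def init_def)
  then have "(\<Sum>i\<in>I. item zs i) = (\<Sum>i\<in>I. zs ! Suc i)" if "I \<subseteq> {..<length zs - 1}" for I
    using that by (intro sum.cong) auto
  moreover have "init zs 0 1 = zs ! 0" using assms by (auto simp: init_def)
  moreover have "encode I \<in> M_EPVCB \<longleftrightarrow> valid I \<and> yes_instance I" for I
    using inj_encode by (auto simp: M_EPVCB_def inj_image_mem_iff)
  ultimately show ?thesis
    using gadget.inst_correct[OF gadget_reduction[of zs]] assms
    unfolding reduction_def subset_sum_def by (metis (no_types, lifting) Suc_1 Suc_le_lessD zero_less_diff)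
qed

lemma encode_reduction_param: "M_EPVCB_param (encode (reduction zs)) \<le> 1"
  using gadget.param_inst[OF gadget_reduction[of zs]] inj_encode
  by (auto simp: M_EPVCB_param_def reduction_def)

definition pair_code :: "nat list \<Rightarrow> nat \<Rightarrow> nat list" where
  "pair_code zs i = [2 * i + 1, 2 * i + 2, (length zs - 1 + 2) * (items_sum zs + 1) + item zs i,
     0, 2 * i + 1, 2 * items_sum zs + 1 - 2 * item zs i]"

lemma length_concat_pair_code [simp]: "length (concat (map (pair_code zs) [0..<n])) = 6 * n"
  by (induction n) (auto simp: pair_code_def)

text \<open>Lists the entries as the program produces them: a header of five, and six for each rung
  with its spoke.\<close>

lemma encode_reduction:
  defines "N zs \<equiv> (length zs - 1 + 2) * (items_sum zs + 1)"
  shows "encode (reduction zs) =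
    [4 * (length zs - 1) + 1, length zs - 1,
     (length zs - 1) * (N zs + (2 * items_sum zs + 1)) - init zs 0 1,
     (length zs - 1) * N zs + init zs 0 1, 4 * (length zs - 1)] @
    concat (map (pair_code zs) [0..<2 * (length zs - 1)])"
proof -
  let ?es = "gadget.es (item zs) (length zs - 1) (N zs) (2 * items_sum zs + 1)"
  have es: "?es = concat (map (\<lambda>i. [(2 * i + 1, 2 * i + 2, N zs + item zs i),
      (0, 2 * i + 1, 2 * items_sum zs + 1 - 2 * item zs i)]) [0..<2 * (length zs - 1)])"
    using gadget.es_def[OF gadget_reduction] by (simp only: N_def)
  have "concat (map (\<lambda>(u, v, c). [u, v, c]) (concat (map (\<lambda>i. [(2 * i + 1, 2 * i + 2, N zs + item zs i),
      (0, 2 * i + 1, 2 * items_sum zs + 1 - 2 * item zs i)]) [0..<n]))) =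
      concat (map (pair_code zs) [0..<n])" for n
    by (induction n) (auto simp: pair_code_def N_def)
  then have "concat (map (\<lambda>(u, v, c). [u, v, c]) ?es) =
      concat (map (pair_code zs) [0..<2 * (length zs - 1)])"
    unfolding es .
  moreover have "length (concat (map (\<lambda>i. [(2 * i + 1, 2 * i + 2, N zs + item zs i),
      (0, 2 * i + 1, 2 * items_sum zs + 1 - 2 * item zs i)]) [0..<n])) = 2 * n" for n
    by (induction n) auto
  then have "length ?es = 4 * (length zs - 1)" unfolding es by simp
  ultimately show ?thesis
    unfolding reduction_def gadget.inst_def[OF gadget_reduction]
    by (simp add: N_def)
qed

text \<open>
  Arrays: 3 the loop counter \<open>i\<close>, 4 the sum of the items, 5 the number \<open>N\<close>, 6 and 7 the multiples
  \<open>m * N\<close> and \<open>m * (N + N')\<close>, 8 the number of entries written after the first five.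
\<close>

abbreviation numbers :: exp where
  "numbers \<equiv> Sub (Var 0) (Const 1)"

abbreviation odd_index :: exp where
  "odd_index \<equiv> Add (Add (Var 3) (Var 3)) (Const 1)"

abbreviation current_item :: exp where
  "current_item \<equiv> Get 0 (Add (Var 3) (Const 2))"

abbreviation spoke_base :: exp where
  "spoke_base \<equiv> Add (Add (Var 4) (Var 4)) (Const 1)"

definition sum_prog :: prog where
  "sum_prog = For 3 numbers (Asg 4 (Const 0) (Add (Var 4) current_item))"

text \<open>The loop contributes \<open>m\<close> summands \<open>X + 1\<close> of the product
  \<open>N\<close>, the last assignment the two remaining ones.\<close>

definition base_prog :: prog where
  "base_prog = For 3 numbers (Asg 5 (Const 0) (Add (Var 5) (Add (Var 4) (Const 1)))) ;;
     Asg 5 (Const 0) (Add (Var 5) (times_exp 2 (Add (Var 4) (Const 1))))"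

definition multiples_prog :: prog where
  "multiples_prog = For 3 numbers (Asg 6 (Const 0) (Add (Var 6) (Var 5)) ;;
     Asg 7 (Const 0) (Add (Var 7) (Add (Var 5) spoke_base)))"

definition edges_prog :: prog where
  "edges_prog = For 3 (Add numbers numbers) (
     Asg 1 (Add (Var 8) (Const 6)) odd_index ;;
     Asg 1 (Add (Var 8) (Const 7)) (Add odd_index (Const 1)) ;;
     Asg 1 (Add (Var 8) (Const 8)) (Add (Var 5) current_item) ;;
     Asg 1 (Add (Var 8) (Const 9)) (Const 0) ;;
     Asg 1 (Add (Var 8) (Const 10)) odd_index ;;
     Asg 1 (Add (Var 8) (Const 11)) (Sub spoke_base (times_exp 2 current_item)) ;;
     Asg 8 (Const 0) (Add (Var 8) (Const 6)))"

definition header_prog :: prog where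
  "header_prog =
     Asg 1 (Const 1) (Add (times_exp 4 numbers) (Const 1)) ;;
     Asg 1 (Const 2) numbers ;;
     Asg 1 (Const 3) (Sub (Var 7) (Get 0 (Const 1))) ;;
     Asg 1 (Const 4) (Add (Var 6) (Get 0 (Const 1))) ;;
     Asg 1 (Const 5) (times_exp 4 numbers) ;;
     Asg 1 (Const 0) (Add (times_exp 12 numbers) (Const 5))"

definition reduction_prog :: prog where
  "reduction_prog = sum_prog ;; base_prog ;; multiples_prog ;; edges_prog ;; header_prog"

lemma wf_reduction_prog: "wf_prog reduction_prog"
  by (simp add: reduction_prog_def sum_prog_def base_prog_def multiples_prog_def edges_prog_def header_prog_def)

context
  fixes zs :: "nat list" and s0 :: state and m X N :: nat
  defines "s0 \<equiv> (init zs)(2 := (init zs 2)(0 := 2 * (length zs + 1)))"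
    and "m \<equiv> length zs - 1"
    and "X \<equiv> items_sum zs"
    and "N \<equiv> (m + 2) * (X + 1)"
begin

text \<open>Here and below, the zero entries are carried along because later phases use these arrays
  as accumulators.\<close>

definition sum_inv :: "nat \<Rightarrow> state \<Rightarrow> bool" where
  "sum_inv i r \<longleftrightarrow> r 0 = init zs 0 \<and> r 2 = s0 2 \<and> r 4 0 = (\<Sum>j<i. item zs j) \<and>
     r 5 0 = 0 \<and> r 6 0 = 0 \<and> r 7 0 = 0 \<and> r 8 0 = 0"

lemma run_sum_prog: "sum_inv m (run sum_prog s0)"
  unfolding sum_prog_def
proof (rule run_For_invariant)
  show "sum_inv 0 (s0(3 := (s0 3)(0 := 0)))" by (simp add: sum_inv_def s0_def init_def)
  show "m \<le> s0 2 0" by (simp add: m_def s0_def)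
qed (auto simp: sum_inv_def init_def m_def item_def)

definition base_inv :: "nat \<Rightarrow> state \<Rightarrow> bool" where
  "base_inv i r \<longleftrightarrow> r 0 = init zs 0 \<and> r 2 = s0 2 \<and> r 4 0 = X \<and>
     r 5 0 = i * (X + 1) \<and> r 6 0 = 0 \<and> r 7 0 = 0 \<and> r 8 0 = 0"

lemma run_base_prog:
  assumes "sum_inv m s"
  shows "base_inv (m + 2) (run base_prog s)"
proof -
  have "base_inv m (run (For 3 numbers (Asg 5 (Const 0) (Add (Var 5) (Add (Var 4) (Const 1))))) s)"
  proof (rule run_For_invariant)
    show "base_inv 0 (s(3 := (s 3)(0 := 0)))"
      using assms by (simp add: base_inv_def sum_inv_def X_def items_sum_def m_def)
    show "m \<le> s 2 0" using assms by (simp add: sum_inv_def m_def s0_def)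
  qed (auto simp: base_inv_def init_def m_def)
  then show ?thesis by (simp add: base_prog_def base_inv_def)
qed

definition multiples_inv :: "nat \<Rightarrow> state \<Rightarrow> bool" where
  "multiples_inv i r \<longleftrightarrow> r 0 = init zs 0 \<and> r 2 = s0 2 \<and> r 4 0 = X \<and>
     r 5 0 = N \<and> r 6 0 = i * N \<and> r 7 0 = i * (N + (2 * X + 1)) \<and> r 8 0 = 0"

lemma run_multiples_prog:
  assumes "base_inv (m + 2) s"
  shows "multiples_inv m (run multiples_prog s)"
  unfolding multiples_prog_def
proof (rule run_For_invariant)
  show "multiples_inv 0 (s(3 := (s 3)(0 := 0)))"
    using assms by (simp add: base_inv_def multiples_inv_def N_def)
  show "m \<le> s 2 0" using assms by (simp add: base_inv_def m_def s0_def)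
qed (auto simp: multiples_inv_def init_def m_def)

definition edges_inv :: "nat \<Rightarrow> state \<Rightarrow> bool" where
  "edges_inv i r \<longleftrightarrow> r 0 = init zs 0 \<and> r 2 = s0 2 \<and> r 4 0 = X \<and>
     r 5 0 = N \<and> r 6 0 = m * N \<and> r 7 0 = m * (N + (2 * X + 1)) \<and> r 8 0 = 6 * i \<and>
     map (\<lambda>j. r 1 (j + 6)) [0..<6 * i] = concat (map (pair_code zs) [0..<i])"

lemma run_edges_prog:
  assumes "multiples_inv m s"
  shows "edges_inv (2 * m) (run edges_prog s)"
  unfolding edges_prog_def
proof (rule run_For_invariant)
  show "edges_inv 0 (s(3 := (s 3)(0 := 0)))"
    using assms by (simp add: edges_inv_def multiples_inv_def)
  show "2 * m \<le> s 2 0" using assms by (simp add: multiples_inv_def m_def s0_def)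
next
  fix i r
  assume i: "i < 2 * m" and inv: "edges_inv i r" and r: "r 3 0 = i"
  let ?p = "Asg 1 (Add (Var 8) (Const 6)) odd_index ;;
     Asg 1 (Add (Var 8) (Const 7)) (Add odd_index (Const 1)) ;;
     Asg 1 (Add (Var 8) (Const 8)) (Add (Var 5) current_item) ;;
     Asg 1 (Add (Var 8) (Const 9)) (Const 0) ;;
     Asg 1 (Add (Var 8) (Const 10)) odd_index ;;
     Asg 1 (Add (Var 8) (Const 11)) (Sub spoke_base (times_exp 2 current_item)) ;;
     Asg 8 (Const 0) (Add (Var 8) (Const 6))"
  define q where "q = (run ?p r)(3 := (run ?p r 3)(0 := Suc i))"
  have r': "r 0 = init zs 0" "r 4 0 = X" "r 5 0 = N" "r 8 0 = 6 * i"
    using inv by (auto simp: edges_inv_def)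
  have "q 1 (j + 6) = r 1 (j + 6)" if "j < 6 * i" for j
    using r' that by (simp add: q_def)
  then have "map (\<lambda>j. q 1 (j + 6)) [0..<6 * i] = map (\<lambda>j. r 1 (j + 6)) [0..<6 * i]" by simp
  moreover have "map (\<lambda>j. q 1 (j + 6)) [6 * i..<6 * i + 6] = pair_code zs i"
    using r' r by (simp add: upt_rec q_def pair_code_def N_def m_def X_def item_def)
  moreover have "[0..<6 * Suc i] = [0..<6 * i] @ [6 * i..<6 * i + 6]"
    using upt_add_eq_append[of 0 "6 * i" 6] by (simp add: add.commute)
  moreover have "map (\<lambda>j. r 1 (j + 6)) [0..<6 * i] = concat (map (pair_code zs) [0..<i])"
    using inv by (simp add: edges_inv_def)
  ultimately have "map (\<lambda>j. q 1 (j + 6)) [0..<6 * Suc i] =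
      concat (map (pair_code zs) [0..<i]) @ pair_code zs i"
    by (simp only: map_append)
  then have "map (\<lambda>j. q 1 (j + 6)) [0..<6 * Suc i] = concat (map (pair_code zs) [0..<Suc i])"
    by simp
  moreover have "q 0 = init zs 0 \<and> q 2 = s0 2 \<and> q 4 0 = X \<and> q 5 0 = N \<and> q 6 0 = m * N \<and>
      q 7 0 = m * (N + (2 * X + 1)) \<and> q 8 0 = 6 * Suc i"
    using inv by (simp add: q_def edges_inv_def)
  ultimately show "edges_inv (Suc i) ((run ?p r)(3 := (run ?p r 3)(0 := Suc i)))"
    unfolding q_def[symmetric] edges_inv_def by blast
qed (auto simp: edges_inv_def init_def m_def)

lemma result_reduction_prog: "result (run reduction_prog s0) = encode (reduction zs)"
proof -
  define s where "s = run edges_prog (run multiples_prog (run base_prog (run sum_prog s0)))"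
  have inv: "edges_inv (2 * m) s"
    unfolding s_def by (intro run_edges_prog run_multiples_prog run_base_prog run_sum_prog)
  define q where "q = run header_prog s"
  have len: "q 1 0 = 5 + 12 * m"
    using inv by (simp add: q_def header_prog_def edges_inv_def init_def m_def)
  have "[0..<5 + 12 * m] = [0..<5] @ [5..<5 + 12 * m]"
    using upt_add_eq_append[of 0 5 "12 * m"] by simp
  then have "result q = map (\<lambda>j. q 1 (Suc j)) [0..<5] @ map (\<lambda>j. q 1 (Suc j)) [5..<5 + 12 * m]"
    unfolding result_def len by simp
  moreover have "map (\<lambda>j. q 1 (Suc j)) [5..<5 + 12 * m] = map (\<lambda>j. s 1 (j + 6)) [0..<6 * (2 * m)]"
    by (rule nth_equalityI) (auto simp: q_def header_prog_def add.commute)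
  moreover have "map (\<lambda>j. q 1 (Suc j)) [0..<5] =
      [4 * m + 1, m, m * (N + (2 * X + 1)) - init zs 0 1, m * N + init zs 0 1, 4 * m]"
  proof -
    have "s 0 = init zs 0" "s 6 0 = m * N" "s 7 0 = m * (N + (2 * X + 1))"
      using inv by (auto simp: edges_inv_def)
    then show ?thesis by (simp add: upt_rec q_def header_prog_def init_def m_def)
  qed
  ultimately have "result q = encode (reduction zs)"
    using inv unfolding encode_reduction edges_inv_def by (simp add: m_def N_def X_def)
  then show ?thesis by (simp add: reduction_prog_def q_def s_def)
qed

end

text \<open>The factor 2 in the number of rounds is due to \<open>edges_prog\<close>, which handles
  twice as many pairs as there are items.\<close>

lemma fpt_bounded_reduction:
  obtains P where "fpt_bounded (\<lambda>_. 0) P (\<lambda>zs. encode (reduction zs))"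
proof
  have "length (encode (reduction zs)) \<le> 12 * (length zs + 1) ^ 1" for zs
    unfolding encode_reduction by simp
  from fpt_bounded_code[of reduction_prog 2 "\<lambda>zs. encode (reduction zs)", OF wf_reduction_prog
      result_reduction_prog this]
  show "fpt_bounded (\<lambda>_. 0) (Seq (Put 2 (Const 0) (times_exp 2 (Add (Var 0) (Const 1))))
      (code reduction_prog)) (\<lambda>zs. encode (reduction zs))" .
qed

section \<open>From circuits to subset sum\<close>

lemma length_foldl_snoc: "length (foldl (\<lambda>vs g. vs @ [f vs g]) [] C) = length C"
  by (induction C rule: rev_induct) auto

lemma nth_foldl_snoc:
  "i < length C \<Longrightarrow> foldl (\<lambda>vs g. vs @ [f vs g]) [] C ! i =
     f (foldl (\<lambda>vs g. vs @ [f vs g]) [] (take i C)) (C ! i)"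
  by (induction C rule: rev_induct) (auto simp: nth_append length_foldl_snoc less_Suc_eq)

text \<open>Values, depths and wefts are folds of one shape. Later gates only append to the list, so
  looking up a predecessor already gives its final result.\<close>

lemma foldl_snoc_take:
  "j < i \<Longrightarrow> i \<le> length C \<Longrightarrow> foldl (\<lambda>vs g. vs @ [f vs g]) [] (take i C) ! j =
     foldl (\<lambda>vs g. vs @ [f vs g]) [] C ! j"
  using nth_foldl_snoc[of j C f] nth_foldl_snoc[of j "take i C" f] by (simp add: min_absorb1)

fun tag :: "gate \<Rightarrow> nat" where
  "tag Input = 0"
| "tag (Neg j) = 1"
| "tag (And js) = 2"
| "tag (Or js) = 3"

text \<open>
  For every gate \<open>i\<close> there are items \<open>2 + 2 * i\<close> (gate true) and \<open>3 + 2 * i\<close> (gate false).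
  Up to complementation, every gate that is not an input states that its output literal holds iff
  none of its \<open>r\<close> input literals does. This is expressed by giving the output literal the
  coefficient \<open>r + 1\<close>, every input literal and each of \<open>r\<close> slack items the coefficient 1, and
  requiring the sum \<open>r + 1\<close>. These are the digits of the items at \<open>2 * i + 2\<close>, for a base \<open>B\<close> so
  large that there are no carries; digit \<open>2 * i + 1\<close> makes the gate either true or false, and digit 0
  counts the true inputs and, with weight \<open>n + 1\<close>, forces the last gate to be true. An event \<open>(a, d)\<close>
  adds \<open>B ^ d\<close> to the item \<open>a\<close>, where item 1 stands for the target of the subset sum.
\<close>

definition in_lit :: "nat \<Rightarrow> nat \<Rightarrow> nat" where
  "in_lit t j = 2 + 2 * j + (if t = 2 then 1 else 0)"

definition out_lit :: "nat \<Rightarrow> nat \<Rightarrow> nat" where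
  "out_lit t i = 2 + 2 * i + (if t = 3 then 1 else 0)"

definition slack :: "nat \<Rightarrow> nat \<Rightarrow> nat \<Rightarrow> nat" where
  "slack n i j = 2 + 2 * n + n * i + j"

type_synonym event = "nat \<times> nat"

definition start_events :: "nat \<Rightarrow> nat \<Rightarrow> event list" where
  "start_events t i = [(2 + 2 * i, 2 * i + 1), (3 + 2 * i, 2 * i + 1), (1, 2 * i + 1)] @
     (if t = 0 then [(2 + 2 * i, 0)] else [(out_lit t i, 2 * i + 2), (1, 2 * i + 2)])"

text \<open>Each predecessor raises the coefficient of the output literal and the target digit by
  one, starting from the 1 in \<open>start_events\<close>. Thus \<open>r + 1\<close> is reached
  without knowing \<open>r\<close> beforehand, and events can be emitted while parsing.\<close>

definition pred_events :: "nat \<Rightarrow> nat \<Rightarrow> nat \<Rightarrow> nat \<Rightarrow> event list" where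
  "pred_events n t i j =
     [(in_lit t j, 2 * i + 2), (out_lit t i, 2 * i + 2), (slack n i j, 2 * i + 2), (1, 2 * i + 2)]"

definition gate_events :: "nat \<Rightarrow> nat \<Rightarrow> nat \<Rightarrow> nat list \<Rightarrow> event list" where
  "gate_events n t i js = start_events t i @ concat (map (pred_events n t i) js)"

definition circuit_events :: "nat \<Rightarrow> circuit \<Rightarrow> event list" where
  "circuit_events n C =
     concat (map (\<lambda>i. gate_events n (tag (C ! i)) i (preds (C ! i))) [0..<length C])"

text \<open>Item \<open>2 * n\<close> is \<open>2 + 2 * (n - 1)\<close>, the last gate being true.
  Its weight \<open>n + 1\<close> exceeds what all inputs together can contribute to digit
  0.\<close>

definition final_events :: "nat \<Rightarrow> nat \<Rightarrow> event list" where
  "final_events k n = replicate (n + 1) (2 * n, 0) @ replicate (k + n + 1) (1, 0)"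

fun tally :: "nat \<Rightarrow> event list \<Rightarrow> nat \<Rightarrow> nat" where
  "tally B [] a = 0"
| "tally B ((b, d) # ev) a = (if b = a then B ^ d else 0) + tally B ev a"

lemma tally_append [simp]: "tally B (ev @ ev') a = tally B ev a + tally B ev' a"
  by (induction B ev a rule: tally.induct) auto

lemma tally_replicate [simp]: "tally B (replicate m (b, d)) a = (if b = a then m * B ^ d else 0)"
  by (induction m) auto

text \<open>This is digit \<open>d\<close> of the sum of the items in \<open>S\<close>, as long as
  no carries occur.\<close>

definition occurrences :: "event list \<Rightarrow> nat set \<Rightarrow> nat \<Rightarrow> nat" where
  "occurrences ev S d = length (filter (\<lambda>(a, e). a \<in> S \<and> e = d) ev)"

lemma occurrences_simps [simp]:
  "occurrences [] S d = 0"
  "occurrences ((a, e) # ev) S d = of_bool (a \<in> S \<and> e = d) + occurrences ev S d"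
  "occurrences (ev @ ev') S d = occurrences ev S d + occurrences ev' S d"
  by (auto simp: occurrences_def)

lemma occurrences_replicate [simp]:
  "occurrences (replicate m (a, e)) S d = (if a \<in> S \<and> e = d then m else 0)"
  by (induction m) auto

lemma occurrences_le: "occurrences ev S d \<le> length ev"
  by (simp add: occurrences_def)

lemma sum_tally:
  assumes "finite S" and "\<And>a d. (a, d) \<in> set ev \<Longrightarrow> d < D"
  shows "(\<Sum>a\<in>S. tally B ev a) = (\<Sum>d<D. occurrences ev S d * B ^ d)"
  using assms(2)
proof (induction ev)
  case (Cons e ev)
  obtain b d where e: "e = (b, d)" by fastforce
  have "d < D" using Cons.prems e by auto
  have "(\<Sum>a\<in>S. tally B (e # ev) a) = (\<Sum>a\<in>S. if b = a then B ^ d else 0) + (\<Sum>a\<in>S. tally B ev a)"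
    by (simp add: e sum.distrib)
  also have "(\<Sum>a\<in>S. if b = a then B ^ d else 0) = of_bool (b \<in> S) * B ^ d"
    using assms(1) by simp
  also have "\<dots> = (\<Sum>f<D. of_bool (b \<in> S \<and> d = f) * B ^ f)"
    using \<open>d < D\<close> by (simp add: of_bool_conj if_distrib sum.delta flip: of_bool_def)
  also have "(\<Sum>a\<in>S. tally B ev a) = (\<Sum>d<D. occurrences ev S d * B ^ d)"
    using Cons by auto
  finally show ?case by (simp add: e sum.distrib add_mult_distrib)
qed auto

lemma digits_unique:
  fixes a b :: "nat \<Rightarrow> nat"
  assumes "(\<Sum>d<D. a d * B ^ d) = (\<Sum>d<D. b d * B ^ d)"
    and "\<And>d. a d < B" "\<And>d. b d < B" and "d < D"
  shows "a d = b d"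
  using assms
proof (induction D arbitrary: a b d)
  case (Suc D)
  have shift: "(\<Sum>d<Suc D. c d * B ^ d) = c 0 + B * (\<Sum>d<D. c (Suc d) * B ^ d)" for c :: "nat \<Rightarrow> nat"
    unfolding sum.lessThan_Suc_shift by (simp add: sum_distrib_left mult_ac)
  let ?A = "\<Sum>d<D. a (Suc d) * B ^ d" and ?B = "\<Sum>d<D. b (Suc d) * B ^ d"
  have eq: "a 0 + B * ?A = b 0 + B * ?B" using Suc.prems(1) unfolding shift .
  have "a 0 = (a 0 + B * ?A) mod B" using Suc.prems(2)[of 0] by simp
  also have "\<dots> = b 0" unfolding eq using Suc.prems(3)[of 0] by simp
  finally have "a 0 = b 0" .
  moreover have "a (Suc e) = b (Suc e)" if "e < D" for e
  proof (rule Suc.IH[of "\<lambda>d. a (Suc d)" "\<lambda>d. b (Suc d)"])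
    show "?A = ?B" using eq \<open>a 0 = b 0\<close> Suc.prems(2)[of 0] by auto
  qed (use Suc.prems that in auto)
  ultimately show ?case using Suc.prems(4) by (cases d) auto
qed simp

text \<open>No digit exceeds the number of events, so a base above this number excludes carries, and
  equality of numbers is equality digit by digit.\<close>

lemma tally_eq_iff:
  assumes "finite S" and "length ev < B"
  shows "(\<Sum>a\<in>S. tally B ev a) = tally B ev b \<longleftrightarrow> (\<forall>d. occurrences ev S d = occurrences ev {b} d)"
proof -
  define D where "D = Suc (Max (insert 0 (snd ` set ev)))"
  have D: "d < D" if "(a, d) \<in> set ev" for a d
    unfolding D_def using that by (intro le_imp_less_Suc Max_ge) force+
  have "occurrences ev S' d = 0" if "D \<le> d" for S' d
    using D that by (fastforce simp: occurrences_def filter_empty_conv)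
  then have "(\<forall>d. occurrences ev S d = occurrences ev {b} d) \<longleftrightarrow>
      (\<forall>d<D. occurrences ev S d = occurrences ev {b} d)"
    by (metis not_less)
  also have "\<dots> \<longleftrightarrow> (\<Sum>d<D. occurrences ev S d * B ^ d) = (\<Sum>d<D. occurrences ev {b} d * B ^ d)"
  proof
    assume "(\<Sum>d<D. occurrences ev S d * B ^ d) = (\<Sum>d<D. occurrences ev {b} d * B ^ d)"
    then show "\<forall>d<D. occurrences ev S d = occurrences ev {b} d"
      using digits_unique le_less_trans[OF occurrences_le assms(2)] by blast
  qed simp
  also have "\<dots> \<longleftrightarrow> (\<Sum>a\<in>S. tally B ev a) = tally B ev b"
    using sum_tally[OF assms(1) D] sum_tally[of "{b}" ev D B] D by simp
  finally show ?thesis by blast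
qed

section \<open>The digit equations of a circuit\<close>

lemma occurrences_pred_events:
  "occurrences (concat (map (pred_events n t i) js)) S d =
     (if d = 2 * i + 2 then \<Sum>j\<leftarrow>js. of_bool (in_lit t j \<in> S) + of_bool (out_lit t i \<in> S) +
        of_bool (slack n i j \<in> S) + of_bool (1 \<in> S) else 0)"
  by (induction js) (auto simp: pred_events_def)

lemma occurrences_gate_events_odd:
  "occurrences (gate_events n t l js) S (2 * i + 1) = (if i = l then
     of_bool (2 + 2 * i \<in> S) + of_bool (3 + 2 * i \<in> S) + of_bool (1 \<in> S) else 0)"
  by (auto simp: gate_events_def occurrences_pred_events start_events_def)

lemma occurrences_gate_events_even:
  "occurrences (gate_events n t l js) S (2 * i + 2) = (if i = l then
     (if t = 0 then 0 else of_bool (out_lit t i \<in> S) + of_bool (1 \<in> S)) +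
     (\<Sum>j\<leftarrow>js. of_bool (in_lit t j \<in> S) + of_bool (out_lit t i \<in> S) +
        of_bool (slack n i j \<in> S) + of_bool (1 \<in> S)) else 0)"
proof -
  have "2 * l + 1 \<noteq> 2 * i + (2::nat)" by presburger
  then show ?thesis
    by (auto simp: gate_events_def occurrences_pred_events start_events_def)
qed

lemma occurrences_gate_events_0:
  "occurrences (gate_events n t i js) S 0 = (if t = 0 then of_bool (2 + 2 * i \<in> S) else 0)"
  by (auto simp: gate_events_def occurrences_pred_events start_events_def)

lemma occurrences_circuit_events:
  "occurrences (circuit_events n C) S d =
     (\<Sum>i<length C. occurrences (gate_events n (tag (C ! i)) i (preds (C ! i))) S d)"
proof -
  have "occurrences (concat (map f [0..<m])) S d = (\<Sum>i<m. occurrences (f i) S d)" for m f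
    by (induction m) auto
  then show ?thesis by (simp add: circuit_events_def)
qed

lemma tag_0_iff [simp]: "tag g = 0 \<longleftrightarrow> g = Input"
  by (cases g) auto

text \<open>The equations of the odd digits, of the positive even digits and of digit 0, with the
  target side evaluated.\<close>

definition selects :: "nat \<Rightarrow> circuit \<Rightarrow> nat set \<Rightarrow> bool" where
  "selects k C S \<longleftrightarrow>
     (\<forall>i<length C. of_bool (2 + 2 * i \<in> S) + of_bool (3 + 2 * i \<in> S) = (1::nat)) \<and>
     (\<forall>i<length C. C ! i \<noteq> Input \<longrightarrow> of_bool (out_lit (tag (C ! i)) i \<in> S) +
        (\<Sum>j\<leftarrow>preds (C ! i). of_bool (in_lit (tag (C ! i)) j \<in> S) +
           of_bool (out_lit (tag (C ! i)) i \<in> S) + of_bool (slack (length C) i j \<in> S)) =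
        1 + length (preds (C ! i))) \<and>
     (\<Sum>i<length C. if C ! i = Input then of_bool (2 + 2 * i \<in> S) else 0) +
        (if 2 * length C \<in> S then length C + 1 else 0) = k + length C + 1"

lemma occurrences_eq_iff_selects:
  fixes k :: nat
  assumes S: "S \<subseteq> {2..}" and C: "C \<noteq> []"
  defines "ev \<equiv> circuit_events (length C) C @ final_events k (length C)"
  shows "(\<forall>d. occurrences ev S d = occurrences ev {1} d) \<longleftrightarrow> selects k C S"
proof -
  let ?n = "length C"
  have "1 \<notin> S" using S by auto
  have odd: "occurrences ev T (2 * i + 1) = (if i < ?n then of_bool (2 + 2 * i \<in> T) +
      of_bool (3 + 2 * i \<in> T) + of_bool (1 \<in> T) else 0)" for i T
    unfolding ev_def occurrences_simps(3) occurrences_circuit_events occurrences_gate_events_odd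
    by (simp add: final_events_def)
  have even: "occurrences ev T (2 * i + 2) = (if i < ?n then
      (if C ! i = Input then 0 else of_bool (out_lit (tag (C ! i)) i \<in> T) + of_bool (1 \<in> T)) +
      (\<Sum>j\<leftarrow>preds (C ! i). of_bool (in_lit (tag (C ! i)) j \<in> T) +
        of_bool (out_lit (tag (C ! i)) i \<in> T) + of_bool (slack ?n i j \<in> T) + of_bool (1 \<in> T))
      else 0)" for i T
    unfolding ev_def occurrences_simps(3) occurrences_circuit_events occurrences_gate_events_even
    by (simp add: final_events_def)
  have zero: "occurrences ev T 0 = (\<Sum>i<?n. if C ! i = Input then of_bool (2 + 2 * i \<in> T) else 0) +
      (if 2 * ?n \<in> T then ?n + 1 else 0) + (if 1 \<in> T then k + ?n + 1 else 0)" for T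
    unfolding ev_def occurrences_simps(3) occurrences_circuit_events occurrences_gate_events_0
    by (simp add: final_events_def)
  have "d = 0 \<or> (\<exists>i. d = 2 * i + 1) \<or> (\<exists>i. d = 2 * i + 2)" for d :: nat by presburger
  then have split: "(\<forall>d. P d) \<longleftrightarrow> P 0 \<and> (\<forall>i. P (2 * i + 1)) \<and> (\<forall>i. P (2 * i + 2))"
    for P :: "nat \<Rightarrow> bool"
    by metis
  have zero': "occurrences ev S 0 = occurrences ev {1} 0 \<longleftrightarrow>
     (\<Sum>i<?n. if C ! i = Input then of_bool (2 + 2 * i \<in> S) else 0) +
        (if 2 * ?n \<in> S then ?n + 1 else 0) = k + ?n + 1"
  proof -
    have "(\<Sum>i<?n. if C ! i = Input then of_bool (2 + 2 * i \<in> {1}) else 0) = (0::nat)"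
      by (intro sum.neutral) auto
    \<comment> \<open>By parity, the item of the last gate is not the target item 1.\<close>
    moreover have "2 * ?n \<noteq> 1" by presburger
    ultimately show ?thesis unfolding zero using \<open>1 \<notin> S\<close> by simp
  qed
  have odd': "(\<forall>i. occurrences ev S (2 * i + 1) = occurrences ev {1} (2 * i + 1)) \<longleftrightarrow>
     (\<forall>i<?n. of_bool (2 + 2 * i \<in> S) + of_bool (3 + 2 * i \<in> S) = (1::nat))"
    unfolding odd using \<open>1 \<notin> S\<close> by auto
  have even': "(\<forall>i. occurrences ev S (2 * i + 2) = occurrences ev {1} (2 * i + 2)) \<longleftrightarrow>
     (\<forall>i<?n. C ! i \<noteq> Input \<longrightarrow> of_bool (out_lit (tag (C ! i)) i \<in> S) +
        (\<Sum>j\<leftarrow>preds (C ! i). of_bool (in_lit (tag (C ! i)) j \<in> S) +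
           of_bool (out_lit (tag (C ! i)) i \<in> S) + of_bool (slack ?n i j \<in> S)) =
        1 + length (preds (C ! i)))"
  proof -
    have "(\<Sum>j\<leftarrow>js. of_bool (in_lit t j \<in> {1}) + of_bool (out_lit t i \<in> {1}) +
      of_bool (slack ?n i j \<in> {1}) + of_bool ((1::nat) \<in> {1})) = length js" for t i js
      by (induction js) (auto simp: in_lit_def out_lit_def slack_def)
    moreover have "out_lit t i \<notin> {1}" for t i by (simp add: out_lit_def)
    ultimately show ?thesis
      unfolding even using \<open>1 \<notin> S\<close> by (auto split: if_splits)
  qed
  show ?thesis
    unfolding selects_def split[of "\<lambda>d. occurrences ev S d = occurrences ev {1} d"] zero' odd' even'
    by (simp only: conj_ac)
qed


section \<open>Consistent gate values and satisfiability\<close>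

definition in_true :: "(nat \<Rightarrow> bool) \<Rightarrow> nat \<Rightarrow> nat \<Rightarrow> bool" where
  "in_true v t j \<longleftrightarrow> (if t = 2 then \<not> v j else v j)"

definition out_true :: "(nat \<Rightarrow> bool) \<Rightarrow> nat \<Rightarrow> nat \<Rightarrow> bool" where
  "out_true v t i \<longleftrightarrow> (if t = 3 then \<not> v i else v i)"

definition consistent :: "circuit \<Rightarrow> (nat \<Rightarrow> bool) \<Rightarrow> bool" where
  "consistent C v \<longleftrightarrow> (\<forall>i<length C. C ! i \<noteq> Input \<longrightarrow>
     (out_true v (tag (C ! i)) i \<longleftrightarrow> (\<forall>j\<in>set (preds (C ! i)). \<not> in_true v (tag (C ! i)) j)))"

text \<open>A negation is a "none of" as it stands; a conjunction becomes one by negating its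
  inputs, and a disjunction by negating its output.\<close>

lemma gate_value_iff:
  assumes "g \<noteq> Input" "\<And>j. j \<in> set (preds g) \<Longrightarrow> vs ! j = v j"
  shows "(gate_value A vs g \<longleftrightarrow> v i) \<longleftrightarrow>
    (out_true v (tag g) i \<longleftrightarrow> (\<forall>j\<in>set (preds g). \<not> in_true v (tag g) j))"
  using assms by (cases g) (auto simp: out_true_def in_true_def)

text \<open>Gates refer only to earlier gates, so a consistent valuation is determined by its values
  at the inputs. Hence guessing all gate values at once is the same as evaluating the
  circuit.\<close>

lemma satisfiable_iff:
  assumes wf: "wf_circuit C"
  shows "(\<exists>A\<subseteq>input_gates C. card A = k \<and> satisfies A C) \<longleftrightarrow>
    (\<exists>v. consistent C v \<and> card {i. i < length C \<and> C ! i = Input \<and> v i} = k \<and> v (length C - 1))"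
proof -
  let ?n = "length C"
  let ?F = "\<lambda>A. foldl (\<lambda>vs g. vs @ [gate_value A vs g]) []"
  from wf have n: "0 < ?n" and less: "j < i" if "i < ?n" "j \<in> set (preds (C ! i))" for i j
    using that by (auto simp: wf_circuit_def)
  from wf have n: "0 < ?n" by (auto simp: wf_circuit_def)
  have len: "length (?F A D) = length D" for A D by (rule length_foldl_snoc)
  have val: "?F A C ! i = gate_value A (?F A (take i C)) (C ! i)" if "i < ?n" for A i
    using that by (rule nth_foldl_snoc)
  have sat: "satisfies A C \<longleftrightarrow> ?F A C ! (?n - 1)" for A
    unfolding satisfies_def using n len[of A C] by (subst last_conv_nth) auto
  have prefix: "?F A (take i C) ! j = ?F A C ! j" if "i < ?n" "j \<in> set (preds (C ! i))" for A i j
    using that less by (intro foldl_snoc_take) auto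
  have input: "?F A C ! i \<longleftrightarrow> i \<in> A" if "i < ?n" "C ! i = Input" for A i
    using val[of i A] that len[of A "take i C"] by simp
  show ?thesis
  proof
    assume "\<exists>A\<subseteq>input_gates C. card A = k \<and> satisfies A C"
    then obtain A where A: "A \<subseteq> input_gates C" "card A = k" "satisfies A C" by blast
    let ?v = "\<lambda>i. ?F A C ! i"
    have "consistent C ?v"
      unfolding consistent_def
    proof (intro allI impI)
      fix i assume i: "i < ?n" "C ! i \<noteq> Input"
      show "out_true ?v (tag (C ! i)) i \<longleftrightarrow> (\<forall>j\<in>set (preds (C ! i)). \<not> in_true ?v (tag (C ! i)) j)"
        using gate_value_iff[where v = ?v and i = i, OF i(2) prefix[OF i(1)]] val[OF i(1), of A]
        by blast
    qed
    moreover have "{i. i < ?n \<and> C ! i = Input \<and> ?v i} = A"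
      using A(1) input[of _ A] by (auto simp: input_gates_def)
    ultimately show "\<exists>v. consistent C v \<and> card {i. i < ?n \<and> C ! i = Input \<and> v i} = k \<and> v (?n - 1)"
      using A(2,3) sat by (intro exI[of _ ?v]) simp
  next
    assume "\<exists>v. consistent C v \<and> card {i. i < ?n \<and> C ! i = Input \<and> v i} = k \<and> v (?n - 1)"
    then obtain v where v: "consistent C v" "card {i. i < ?n \<and> C ! i = Input \<and> v i} = k" "v (?n - 1)"
      by blast
    define A where "A = {i. i < ?n \<and> C ! i = Input \<and> v i}"
    have "?F A C ! i = v i" if "i < ?n" for i
      using that
    proof (induction i rule: less_induct)
      case (less i)
      show ?case
      proof (cases "C ! i = Input")
        case True
        then show ?thesis using input[of i A] less.prems by (simp add: A_def)
      next
        case False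
        have "?F A (take i C) ! j = v j" if "j \<in> set (preds (C ! i))" for j
          using prefix[OF less.prems that, of A] less.IH[of j] \<open>i < ?n\<close> that
            \<open>\<And>i j. i < ?n \<Longrightarrow> j \<in> set (preds (C ! i)) \<Longrightarrow> j < i\<close>[of i j] by simp
        from gate_value_iff[where v = v and i = i, OF False this] v(1) val[OF less.prems, of A]
        show ?thesis using less.prems False unfolding consistent_def by blast
      qed
    qed
    then have "satisfies A C" using sat v(3) n by simp
    moreover have "A \<subseteq> input_gates C" by (auto simp: A_def input_gates_def)
    ultimately show "\<exists>A\<subseteq>input_gates C. card A = k \<and> satisfies A C" using v(2) A_def by blast
  qed
qed

text \<open>For a gate with \<open>r\<close> predecessors, a true output literal yields
  \<open>r + 1\<close> on its own. Otherwise between 1 and \<open>r\<close> input literals hold, and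
  at most \<open>r\<close> slack items are needed to reach \<open>r + 1\<close>.\<close>

lemma selects_if_consistent:
  assumes wf: "wf_circuit C" and v: "consistent C v"
    "card {i. i < length C \<and> C ! i = Input \<and> v i} = k" "v (length C - 1)"
  shows "\<exists>S\<subseteq>{2..<2 + 2 * length C + length C * length C}. selects k C S"
proof -
  let ?n = "length C"
  from wf have n: "0 < ?n" by (auto simp: wf_circuit_def)
  \<comment> \<open>If some input literals hold, the slack items of all others and of one that holds are selected.\<close>
  define w where "w i = (SOME j. j \<in> set (preds (C ! i)) \<and> in_true v (tag (C ! i)) j)" for i
  define K where "K i = {j \<in> set (preds (C ! i)). \<not> out_true v (tag (C ! i)) i \<and>
    (\<not> in_true v (tag (C ! i)) j \<or> j = w i)}" for i
  define P where "P = (\<lambda>i. 2 + 2 * i) ` {i. i < ?n \<and> v i} \<union> (\<lambda>i. 3 + 2 * i) ` {i. i < ?n \<and> \<not> v i}"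
  define L where "L = (\<lambda>(i, j). slack ?n i j) ` (SIGMA i:{i. i < ?n \<and> C ! i \<noteq> Input}. K i)"
  have preds: "j < i" "distinct (preds (C ! i))" if "i < ?n" "j \<in> set (preds (C ! i))" for i j
    using wf that by (auto simp: wf_circuit_def)
  have L_ge: "2 + 2 * ?n \<le> a" if "a \<in> L" for a using that by (auto simp: L_def slack_def)
  have P_less: "2 \<le> a \<and> a < 2 + 2 * ?n" if "a \<in> P" for a using that by (auto simp: P_def)
  have L_less: "a < 2 + 2 * ?n + ?n * ?n" if "a \<in> L" for a
  proof -
    from that obtain i j where ij: "i < ?n" "j \<in> K i" "a = slack ?n i j" by (auto simp: L_def)
    then have "j < ?n" using preds(1)[of i j] by (auto simp: K_def)
    have "?n * i + j < ?n * (i + 1)" using \<open>j < ?n\<close> by simp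
    also have "\<dots> \<le> ?n * ?n" using ij(1) by (intro mult_le_mono2) simp
    finally show ?thesis using ij(3) by (simp add: slack_def)
  qed
  define S where "S = P \<union> L"
  have pos: "2 + 2 * i \<in> S \<longleftrightarrow> v i" "3 + 2 * i \<in> S \<longleftrightarrow> \<not> v i" if "i < ?n" for i
  proof -
    have "2 + 2 * i \<notin> L" "3 + 2 * i \<notin> L" using L_ge that by fastforce+
    moreover have "3 + 2 * i \<noteq> 2 + 2 * l" "2 + 2 * i \<noteq> 3 + 2 * l" for l by presburger+
    ultimately show "2 + 2 * i \<in> S \<longleftrightarrow> v i" "3 + 2 * i \<in> S \<longleftrightarrow> \<not> v i"
      using that by (auto simp: S_def P_def)
  qed
  have lits: "in_lit t i \<in> S \<longleftrightarrow> in_true v t i" "out_lit t i \<in> S \<longleftrightarrow> out_true v t i" if "i < ?n" for t i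
    using pos[OF that] by (auto simp: in_lit_def out_lit_def in_true_def out_true_def eval_nat_numeral)
  have slacks: "slack ?n i j \<in> S \<longleftrightarrow> j \<in> K i" if "i < ?n" "C ! i \<noteq> Input" "j < ?n" for i j
  proof
    assume "slack ?n i j \<in> S"
    then have "slack ?n i j \<in> L" using P_less[of "slack ?n i j"] by (auto simp: S_def slack_def)
    then obtain i' j' where ij: "i' < ?n" "j' \<in> K i'" "slack ?n i j = slack ?n i' j'" by (auto simp: L_def)
    then have "j' < ?n" using preds(1)[of i' j'] by (auto simp: K_def)
    from ij(3) have "?n * i + j = ?n * i' + j'" by (simp add: slack_def)
    \<comment> \<open>Quotient and remainder recover the gate and the predecessor, so different
      pairs have different slack items.\<close>
    then have "(?n * i + j) div ?n = (?n * i' + j') div ?n" "(?n * i + j) mod ?n = (?n * i' + j') mod ?n"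
      by simp_all
    moreover have "(?n * l + m) div ?n = l" "(?n * l + m) mod ?n = m" if "m < ?n" for l m
      using that n by simp_all
    ultimately have "i = i'" "j = j'" using \<open>j < ?n\<close> \<open>j' < ?n\<close> by metis+
    then show "j \<in> K i" using ij(2) by simp
  next
    assume "j \<in> K i"
    then show "slack ?n i j \<in> S" using that by (auto simp: S_def L_def)
  qed
  have "selects k C S"
    unfolding selects_def
  proof (intro conjI allI impI)
    fix i assume i: "i < ?n"
    then show "of_bool (2 + 2 * i \<in> S) + of_bool (3 + 2 * i \<in> S) = (1::nat)" using pos by simp
    assume "C ! i \<noteq> Input"
    let ?t = "tag (C ! i)" and ?js = "preds (C ! i)"
    have cons: "out_true v ?t i \<longleftrightarrow> (\<forall>j\<in>set ?js. \<not> in_true v ?t j)"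
      using v(1) i \<open>C ! i \<noteq> Input\<close> unfolding consistent_def by blast
    have sum: "(\<Sum>j\<leftarrow>?js. of_bool (in_lit ?t j \<in> S) + of_bool (out_lit ?t i \<in> S) +
        of_bool (slack ?n i j \<in> S)) = (\<Sum>j\<leftarrow>?js. of_bool (in_true v ?t j) + of_bool (out_true v ?t i) +
        of_bool (j \<in> K i) :: nat)"
    proof (rule arg_cong[where f = sum_list], rule map_cong[OF refl])
      fix j assume "j \<in> set ?js"
      then have "j < ?n" using preds(1)[OF i] i by force
      then show "of_bool (in_lit ?t j \<in> S) + of_bool (out_lit ?t i \<in> S) + of_bool (slack ?n i j \<in> S) =
          (of_bool (in_true v ?t j) + of_bool (out_true v ?t i) + of_bool (j \<in> K i) :: nat)"
        using lits i slacks \<open>C ! i \<noteq> Input\<close> by simp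
    qed
    show "of_bool (out_lit ?t i \<in> S) + (\<Sum>j\<leftarrow>?js. of_bool (in_lit ?t j \<in> S) +
        of_bool (out_lit ?t i \<in> S) + of_bool (slack ?n i j \<in> S)) = 1 + length ?js"
    proof (cases "out_true v ?t i")
      case True
      then have "j \<notin> K i" "\<not> in_true v ?t j" if "j \<in> set ?js" for j
        using that cons by (auto simp: K_def)
      then have "(\<Sum>j\<leftarrow>?js. of_bool (in_true v ?t j) + of_bool (out_true v ?t i) +
        of_bool (j \<in> K i)) = (\<Sum>j\<leftarrow>?js. 1::nat)"
        using True by (intro arg_cong[where f = sum_list] map_cong) auto
      then show ?thesis unfolding sum using True lits[OF i] by (simp add: sum_list_triv)
    next
      case False
      then have "\<exists>j. j \<in> set ?js \<and> in_true v ?t j" using cons by blast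
      then have w: "w i \<in> set ?js" "in_true v ?t (w i)" unfolding w_def by (metis (mono_tags, lifting) someI_ex)+
      \<comment> \<open>Every predecessor contributes 1, by its literal or by its slack item; only
        \<open>w i\<close> contributes both.\<close>
      have "(\<Sum>j\<leftarrow>?js. of_bool (in_true v ?t j) + of_bool (out_true v ?t i) + of_bool (j \<in> K i)) =
          (\<Sum>j\<leftarrow>?js. 1 + (if j = w i then 1 else (0::nat)))"
        using False w by (intro arg_cong[where f = sum_list] map_cong) (auto simp: K_def)
      also have "\<dots> = (\<Sum>j\<in>set ?js. 1 + (if j = w i then 1 else (0::nat)))"
        using preds(2)[OF i w(1)] by (rule sum_list_distinct_conv_sum_set)
      also have "\<dots> = length ?js + 1"
        unfolding sum.distrib using w(1) distinct_card[OF preds(2)[OF i w(1)]] by simp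
      finally show ?thesis unfolding sum using False lits[OF i] by simp
    qed
  next
    have "2 * ?n = 2 + 2 * (?n - 1)" using n by linarith
    then have "2 * ?n \<in> S" using pos(1)[of "?n - 1"] n v(3) by simp
    moreover have "(\<Sum>i<?n. if C ! i = Input then of_bool (2 + 2 * i \<in> S) else 0) =
        (\<Sum>i<?n. if C ! i = Input \<and> v i then 1 else (0::nat))"
      using pos by (intro sum.cong) auto
    moreover have "\<dots> = card {i. i < ?n \<and> C ! i = Input \<and> v i}"
      by (simp add: sum.If_cases Int_def)
    ultimately show "(\<Sum>i<?n. if C ! i = Input then of_bool (2 + 2 * i \<in> S) else 0) +
        (if 2 * ?n \<in> S then ?n + 1 else 0) = k + ?n + 1"
      using v(2) by simp
  qed
  moreover have "S \<subseteq> {2..<2 + 2 * ?n + ?n * ?n}"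
    using P_less L_ge L_less by (fastforce simp: S_def)
  ultimately show ?thesis by blast
qed

text \<open>A selected output literal already exhausts \<open>r + 1\<close>, leaving no room for
  input literals. Without it, the \<open>r\<close> slack items fall short by one, so some input
  literal must be selected.\<close>

lemma consistent_if_selects:
  assumes wf: "wf_circuit C" and S: "selects k C S" and k: "k \<le> length C"
  shows "\<exists>v. consistent C v \<and> card {i. i < length C \<and> C ! i = Input \<and> v i} = k \<and> v (length C - 1)"
proof -
  let ?n = "length C"
  from wf have n: "0 < ?n" by (auto simp: wf_circuit_def)
  define v where "v i \<longleftrightarrow> 2 + 2 * i \<in> S" for i
  have less: "j < i" if "i < ?n" "j \<in> set (preds (C ! i))" for i j
    using wf that by (auto simp: wf_circuit_def)
  have neg: "3 + 2 * i \<in> S \<longleftrightarrow> \<not> v i" if "i < ?n" for i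
  proof -
    have "of_bool (2 + 2 * i \<in> S) + of_bool (3 + 2 * i \<in> S) = (1::nat)"
      using S that unfolding selects_def by blast
    then show ?thesis by (auto simp: v_def of_bool_def split: if_splits)
  qed
  have lits: "in_lit t i \<in> S \<longleftrightarrow> in_true v t i" "out_lit t i \<in> S \<longleftrightarrow> out_true v t i" if "i < ?n" for t i
    using neg[OF that] by (auto simp: in_lit_def out_lit_def in_true_def out_true_def v_def eval_nat_numeral)
  have "consistent C v"
    unfolding consistent_def
  proof (intro allI impI)
    fix i assume i: "i < ?n" "C ! i \<noteq> Input"
    let ?t = "tag (C ! i)" and ?js = "preds (C ! i)"
    have sum: "of_bool (out_lit ?t i \<in> S) + (\<Sum>j\<leftarrow>?js. of_bool (in_lit ?t j \<in> S) +
        of_bool (out_lit ?t i \<in> S) + of_bool (slack ?n i j \<in> S)) = 1 + length ?js"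
      using S i unfolding selects_def by blast
    have map: "map (\<lambda>j. of_bool (in_lit ?t j \<in> S) + of_bool (out_lit ?t i \<in> S) +
        of_bool (slack ?n i j \<in> S)) ?js = map (\<lambda>j. of_bool (in_true v ?t j) +
        of_bool (out_true v ?t i) + of_bool (slack ?n i j \<in> S) :: nat) ?js"
    proof (rule map_cong[OF refl])
      fix j assume "j \<in> set ?js"
      then have "j < ?n" using less[OF i(1), of j] i(1) by simp
      then show "of_bool (in_lit ?t j \<in> S) + of_bool (out_lit ?t i \<in> S) + of_bool (slack ?n i j \<in> S) =
          (of_bool (in_true v ?t j) + of_bool (out_true v ?t i) + of_bool (slack ?n i j \<in> S) :: nat)"
        using lits i by simp
    qed
    have eq: "of_bool (out_true v ?t i) + (\<Sum>j\<leftarrow>?js. of_bool (in_true v ?t j) +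
        of_bool (out_true v ?t i) + of_bool (slack ?n i j \<in> S)) = 1 + length ?js"
      using sum unfolding map unfolding lits[OF i(1)] .
    show "out_true v ?t i \<longleftrightarrow> (\<forall>j\<in>set ?js. \<not> in_true v ?t j)"
    proof (cases "out_true v ?t i")
      case True
      have "(\<Sum>j\<leftarrow>js. of_bool (in_true v ?t j) + of_bool True + of_bool (slack ?n i j \<in> S)) =
          length js + (\<Sum>j\<leftarrow>js. of_bool (in_true v ?t j) + of_bool (slack ?n i j \<in> S))" for js
        by (induction js) auto
      with eq True have "(\<Sum>j\<leftarrow>?js. of_bool (in_true v ?t j) + of_bool (slack ?n i j \<in> S)) = (0::nat)"
        by simp
      then show ?thesis using True by (auto simp: sum_list_eq_0_iff)
    next
      case False
      have "\<exists>j\<in>set ?js. in_true v ?t j"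
      proof (rule ccontr)
        assume "\<not> ?thesis"
        then have "(\<Sum>j\<leftarrow>?js. of_bool (in_true v ?t j) +
          of_bool (out_true v ?t i) + of_bool (slack ?n i j \<in> S)) \<le> (\<Sum>j\<leftarrow>?js. 1::nat)"
          using False by (intro sum_list_mono) auto
        then show False using eq False by (simp add: sum_list_triv)
      qed
      then show ?thesis using False by blast
    qed
  qed
  moreover
  let ?c = "\<Sum>i<?n. if C ! i = Input then of_bool (2 + 2 * i \<in> S) else (0::nat)"
  \<comment> \<open>The inputs contribute at most \<open>?n\<close> to digit 0, so
    \<open>k + ?n + 1\<close> is reached only with the item of the last gate.\<close>
  have "?c \<le> (\<Sum>i<?n. 1)" by (intro sum_mono) auto
  then have "?c \<le> ?n" by simp
  moreover have total: "?c + (if 2 * ?n \<in> S then ?n + 1 else 0) = k + ?n + 1"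
    using S unfolding selects_def by blast
  ultimately have "2 * ?n \<in> S" "?c = k" by (auto split: if_splits)
  moreover have "2 * ?n = 2 + 2 * (?n - 1)" using n by linarith
  moreover have "?c = (\<Sum>i<?n. if C ! i = Input \<and> v i then 1 else 0)"
    by (intro sum.cong) (auto simp: v_def)
  moreover have "\<dots> = card {i. i < ?n \<and> C ! i = Input \<and> v i}"
    by (simp add: sum.If_cases Int_def)
  ultimately show ?thesis
    using \<open>consistent C v\<close> by (intro exI[of _ v]) (simp add: v_def)
qed

lemma satisfiable_iff_tally:
  assumes wf: "wf_circuit C" and k: "k \<le> length C"
    and B: "length (circuit_events (length C) C @ final_events k (length C)) < B"
  defines "ev \<equiv> circuit_events (length C) C @ final_events k (length C)"
  shows "(\<exists>A\<subseteq>input_gates C. card A = k \<and> satisfies A C) \<longleftrightarrow>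
    (\<exists>S\<subseteq>{2..<2 + 2 * length C + length C * length C}. (\<Sum>a\<in>S. tally B ev a) = tally B ev 1)"
proof -
  from wf have "C \<noteq> []" by (auto simp: wf_circuit_def)
  have "(\<Sum>a\<in>S. tally B ev a) = tally B ev 1 \<longleftrightarrow> selects k C S"
    if "S \<subseteq> {2..<2 + 2 * length C + length C * length C}" for S
  proof -
    have "finite S" "S \<subseteq> {2..}" using that finite_subset by auto
    then show ?thesis
      using tally_eq_iff[OF _ B] occurrences_eq_iff_selects[OF _ \<open>C \<noteq> []\<close>] unfolding ev_def by simp
  qed
  then have "(\<exists>S\<subseteq>{2..<2 + 2 * length C + length C * length C}. (\<Sum>a\<in>S. tally B ev a) = tally B ev 1) \<longleftrightarrow>
      (\<exists>S\<subseteq>{2..<2 + 2 * length C + length C * length C}. selects k C S)"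
    by (intro ex_cong1 conj_cong refl)
  moreover have "\<dots> \<longleftrightarrow> (\<exists>A\<subseteq>input_gates C. card A = k \<and> satisfies A C)"
    unfolding satisfiable_iff[OF wf]
  proof
    assume "\<exists>S\<subseteq>{2..<2 + 2 * length C + length C * length C}. selects k C S"
    then show "\<exists>v. consistent C v \<and> card {i. i < length C \<and> C ! i = Input \<and> v i} = k \<and> v (length C - 1)"
      using consistent_if_selects[OF wf _ k] by blast
  next
    assume "\<exists>v. consistent C v \<and> card {i. i < length C \<and> C ! i = Input \<and> v i} = k \<and> v (length C - 1)"
    then show "\<exists>S\<subseteq>{2..<2 + 2 * length C + length C * length C}. selects k C S"
      using selects_if_consistent[OF wf] by blast
  qed
  ultimately show ?thesis by simp
qed

subsection \<open>Parsing\<close>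

text \<open>Consuming one token at a time matches the loop of the program, which handles one token
  per round.\<close>

datatype parse =
    Failed
  | Expect_tag circuit
  | Expect_arity circuit nat
  | Expect_pred circuit nat nat "nat list"  \<comment> \<open>tag, number of missing predecessors, known ones\<close>

definition make_gate :: "nat \<Rightarrow> nat list \<Rightarrow> gate" where
  "make_gate t js = (if t = 1 then Neg (hd js) else if t = 2 then And js else Or js)"

fun parse_step :: "parse \<Rightarrow> nat \<Rightarrow> parse" where
  "parse_step Failed x = Failed"
| "parse_step (Expect_tag C) x =
     (if x = 0 then Expect_tag (C @ [Input]) else if x = 1 then Expect_pred C 1 1 []
      else if x \<le> 3 then Expect_arity C x else Failed)"
| "parse_step (Expect_arity C t) x = (if 2 \<le> x then Expect_pred C t x [] else Failed)"
| "parse_step (Expect_pred C t r js) x =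
     (if x < length C \<and> x \<notin> set js then
        if r = 1 then Expect_tag (C @ [make_gate t (js @ [x])])
        else Expect_pred C t (r - 1) (js @ [x])
      else Failed)"

abbreviation parse_list :: "nat list \<Rightarrow> parse" where
  "parse_list \<equiv> foldl parse_step (Expect_tag [])"

definition gates_ok :: "circuit \<Rightarrow> bool" where
  "gates_ok C \<longleftrightarrow> (\<forall>i<length C. fan_in_ok (C ! i) \<and> distinct (preds (C ! i)) \<and>
     (\<forall>j\<in>set (preds (C ! i)). j < i))"

lemma wf_circuit_iff: "wf_circuit C \<longleftrightarrow> C \<noteq> [] \<and> gates_ok C"
  by (simp add: wf_circuit_def gates_ok_def)

lemma gates_ok_snoc:
  "gates_ok (C @ [g]) \<longleftrightarrow> gates_ok C \<and> fan_in_ok g \<and> distinct (preds g) \<and>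
     (\<forall>j\<in>set (preds g). j < length C)"
  by (auto simp: gates_ok_def nth_append less_Suc_eq all_conj_distrib)

fun parse_ok :: "parse \<Rightarrow> bool" where
  "parse_ok Failed \<longleftrightarrow> False"
| "parse_ok (Expect_tag C) \<longleftrightarrow> gates_ok C"
| "parse_ok (Expect_arity C t) \<longleftrightarrow> gates_ok C \<and> (t = 2 \<or> t = 3)"
| "parse_ok (Expect_pred C t r js) \<longleftrightarrow> gates_ok C \<and> (t = 1 \<and> r = 1 \<and> js = [] \<or>
     (t = 2 \<or> t = 3) \<and> 2 \<le> r + length js \<and> 0 < r) \<and> distinct js \<and> (\<forall>j\<in>set js. j < length C)"

text \<open>Reconstructs the input read so far, the announced arity being
  \<open>r + length js\<close>. So a successful parse shows that the tokens are an encoding.\<close>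

fun parsed_tokens :: "parse \<Rightarrow> nat list" where
  "parsed_tokens Failed = []"
| "parsed_tokens (Expect_tag C) = concat (map encode_gate C)"
| "parsed_tokens (Expect_arity C t) = concat (map encode_gate C) @ [t]"
| "parsed_tokens (Expect_pred C t r js) =
     concat (map encode_gate C) @ (if t = 1 then [1] else [t, r + length js]) @ js"

lemma parse_step_ok:
  assumes "parse_ok ps" and "parse_step ps x \<noteq> Failed"
  shows "parse_ok (parse_step ps x) \<and> parsed_tokens (parse_step ps x) = parsed_tokens ps @ [x]"
proof (cases ps)
  case (Expect_tag C)
  then show ?thesis using assms by (auto simp: gates_ok_snoc split: if_splits)
next
  case (Expect_arity C t)
  then show ?thesis using assms by (auto split: if_splits)
next
  case (Expect_pred C t r js)
  then show ?thesis
    using assms by (auto simp: gates_ok_snoc make_gate_def split: if_splits)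
qed (use assms in auto)

lemma parse_list_ok:
  assumes "parse_list ts \<noteq> Failed"
  shows "parse_ok (parse_list ts) \<and> parsed_tokens (parse_list ts) = ts"
  using assms
proof (induction ts rule: rev_induct)
  case Nil
  then show ?case by (simp add: gates_ok_def)
next
  case (snoc x ts)
  have "parse_list ts \<noteq> Failed" using snoc.prems by auto
  with snoc.IH have "parse_ok (parse_list ts)" "parsed_tokens (parse_list ts) = ts" by auto
  then show ?case using parse_step_ok[of "parse_list ts" x] snoc.prems by simp
qed

lemma parse_preds:
  assumes "js \<noteq> []" "distinct (ks @ js)" "\<forall>j\<in>set js. j < length C"
  shows "foldl parse_step (Expect_pred C t (length js) ks) js = Expect_tag (C @ [make_gate t (ks @ js)])"
  using assms
proof (induction js arbitrary: ks)
  case (Cons j js)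
  show ?case
  proof (cases "js = []")
    case False
    then show ?thesis using Cons.IH[of "ks @ [j]"] Cons.prems by simp
  qed (use Cons.prems in auto)
qed simp

lemma parse_circuit: "gates_ok C \<Longrightarrow> parse_list (concat (map encode_gate C)) = Expect_tag C"
proof (induction C rule: rev_induct)
  case (snoc g C)
  then have g: "fan_in_ok g" "distinct (preds g)" "\<forall>j\<in>set (preds g). j < length C" "gates_ok C"
    by (auto simp: gates_ok_snoc)
  have "foldl parse_step (Expect_tag C) (encode_gate g) = Expect_tag (C @ [g])"
  proof (cases g)
    case (And js)
    then show ?thesis using g parse_preds[of js "[]" C 2] by (cases js) (auto simp: make_gate_def)
  next
    case (Or js)
    then show ?thesis using g parse_preds[of js "[]" C 3] by (cases js) (auto simp: make_gate_def)
  qed (use g in \<open>auto simp: make_gate_def\<close>)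
  then show ?case using snoc.IH g by simp
qed simp

text \<open>The last condition keeps the number of events linear in the length of \<open>y\<close>,
  although the weight is given in binary.\<close>

definition accepts :: "nat \<Rightarrow> nat \<Rightarrow> nat list \<Rightarrow> circuit \<Rightarrow> bool" where
  "accepts t d y C \<longleftrightarrow> parse_list (drop 2 y) = Expect_tag C \<and> C \<noteq> [] \<and> length C = init y 0 2 \<and>
     weft C \<le> t \<and> depth C \<le> d \<and> init y 0 1 \<le> length C"

lemma accepts_wf: "accepts t d y C \<Longrightarrow> wf_circuit C"
  using parse_list_ok[of "drop 2 y"] by (auto simp: accepts_def wf_circuit_iff)

text \<open>The parser inverts the encoding, and a set of \<open>k\<close> inputs exists only if
  \<open>k\<close> is at most the number of gates; so the checks in \<open>accepts\<close> exclude
  no member.\<close>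

lemma WCS_iff:
  "y \<in> fst (WCS t d) \<longleftrightarrow>
     (\<exists>C. accepts t d y C \<and> (\<exists>A\<subseteq>input_gates C. card A = init y 0 1 \<and> satisfies A C))"
proof
  assume "y \<in> fst (WCS t d)"
  then obtain k C A where C: "y = encode_circuit k C" "wf_circuit C" "weft C \<le> t" "depth C \<le> d"
    "A \<subseteq> input_gates C" "card A = k" "satisfies A C" by (auto simp: WCS_def)
  have "k \<le> card (input_gates C)"
    using C(5,6) by (auto simp: input_gates_def intro!: card_mono)
  also have "\<dots> \<le> card {..<length C}" by (intro card_mono) (auto simp: input_gates_def)
  finally have "k \<le> length C" by simp
  moreover have "init y 0 1 = k" "init y 0 2 = length C"
    by (auto simp: C(1) encode_circuit_def init_def)
  ultimately have "accepts t d y C"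
    using C parse_circuit[of C] by (auto simp: accepts_def encode_circuit_def wf_circuit_iff)
  moreover have "\<exists>A\<subseteq>input_gates C. card A = init y 0 1 \<and> satisfies A C"
    unfolding \<open>init y 0 1 = k\<close> using C(5-7) by (intro exI[of _ A] conjI)
  ultimately show "\<exists>C. accepts t d y C \<and> (\<exists>A\<subseteq>input_gates C. card A = init y 0 1 \<and> satisfies A C)"
    by (intro exI[of _ C] conjI)
next
  assume "\<exists>C. accepts t d y C \<and> (\<exists>A\<subseteq>input_gates C. card A = init y 0 1 \<and> satisfies A C)"
  then obtain C A where C: "accepts t d y C" "A \<subseteq> input_gates C" "card A = init y 0 1" "satisfies A C"
    by blast
  have toks: "drop 2 y = concat (map encode_gate C)"
    using C(1) parse_list_ok[of "drop 2 y"] by (simp add: accepts_def)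
  \<comment> \<open>A nonempty circuit leaves a token behind the first two entries, so
    \<open>y\<close> has a full header and \<open>init\<close> does not return default values for
    it.\<close>
  have "encode_gate g \<noteq> []" for g by (cases g) auto
  then have "drop 2 y \<noteq> []" using C(1) unfolding toks accepts_def by (cases C) auto
  then obtain a b ys where y: "y = a # b # ys" by (cases y; cases "tl y") auto
  then have "y = encode_circuit (init y 0 1) C"
    using toks C(1) by (auto simp: encode_circuit_def accepts_def init_def)
  then show "y \<in> fst (WCS t d)"
    using C accepts_wf[OF C(1)] unfolding WCS_def by (auto simp: accepts_def)
qed

text \<open>\<open>n\<close> is meant to be the number of gates announced in the header, because
  slack items have to be numbered before the gates are counted; \<open>accepts\<close> compares both
  numbers.\<close>

fun parse_events :: "nat \<Rightarrow> parse \<Rightarrow> event list" where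
  "parse_events n Failed = []"
| "parse_events n (Expect_tag C) = circuit_events n C"
| "parse_events n (Expect_arity C t) = circuit_events n C @ start_events t (length C)"
| "parse_events n (Expect_pred C t r js) = circuit_events n C @ gate_events n t (length C) js"

lemma circuit_events_snoc:
  "circuit_events n (C @ [g]) = circuit_events n C @ gate_events n (tag g) (length C) (preds g)"
proof -
  have "map (\<lambda>i. gate_events n (tag ((C @ [g]) ! i)) i (preds ((C @ [g]) ! i))) [0..<length C] =
      map (\<lambda>i. gate_events n (tag (C ! i)) i (preds (C ! i))) [0..<length C]"
    by (intro map_cong) (auto simp: nth_append)
  moreover have "circuit_events n (C @ [g]) =
      concat (map (\<lambda>i. gate_events n (tag ((C @ [g]) ! i)) i (preds ((C @ [g]) ! i))) [0..<length C]) @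
      gate_events n (tag g) (length C) (preds g)"
    by (simp add: circuit_events_def)
  ultimately show ?thesis by (simp only: circuit_events_def)
qed

lemma length_gate_events: "length (gate_events n t i js) \<le> 5 + 4 * length js"
proof -
  have "length (concat (map (pred_events n t i) js)) = 4 * length js"
    by (induction js) (auto simp: pred_events_def)
  then show ?thesis by (simp add: gate_events_def start_events_def)
qed

text \<open>A gate takes at least one token plus one per predecessor, and causes at most five events
  plus four per predecessor.\<close>

lemma length_circuit_events:
  "length (circuit_events n C) \<le> 5 * length (concat (map encode_gate C))"
proof (induction C rule: rev_induct)
  case (snoc g C)
  have "1 + length (preds g) \<le> length (encode_gate g)" by (cases g) auto
  with snoc length_gate_events[of n "tag g" "length C" "preds g"] show ?case
    by (simp add: circuit_events_snoc)
qed (simp add: circuit_events_def)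

lemma length_le_encoding: "length C \<le> length (concat (map encode_gate C))"
proof (induction C)
  case (Cons g C)
  then show ?case by (cases g) auto
qed simp

text \<open>The base is also the number of rounds of every loop in \<open>circuit_prog\<close>. The
  list \<open>[1, 0]\<close> is an unsolvable instance.\<close>

definition circuit_numbers :: "nat \<Rightarrow> nat \<Rightarrow> nat list \<Rightarrow> nat list" where
  "circuit_numbers t d y = (if Ex (accepts t d y) then
     map (tally (12 * (length y + 1)) (parse_events (init y 0 2) (parse_list (drop 2 y)) @
       final_events (init y 0 1) (init y 0 2))) [1..<2 + 2 * init y 0 2 + init y 0 2 * init y 0 2]
     else [1, 0])"

lemma subset_sum_map_upt:
  assumes "1 < m"
  shows "subset_sum (map f [1..<m]) \<longleftrightarrow> (\<exists>S\<subseteq>{2..<m}. (\<Sum>a\<in>S. f a) = f 1)"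
proof
  assume "subset_sum (map f [1..<m])"
  then obtain I where I: "I \<subseteq> {..<m - 2}" "(\<Sum>i\<in>I. map f [1..<m] ! Suc i) = f 1"
    using assms by (auto simp: subset_sum_def numeral_2_eq_2)
  have "(\<Sum>a\<in>(\<lambda>i. i + 2) ` I. f a) = (\<Sum>i\<in>I. f (i + 2))"
    by (subst sum.reindex) (auto simp: inj_on_def)
  also have "\<dots> = (\<Sum>i\<in>I. map f [1..<m] ! Suc i)"
  proof (rule sum.cong[OF refl])
    fix i assume "i \<in> I"
    then have "i < m - 2" using I(1) by auto
    then show "f (i + 2) = map f [1..<m] ! Suc i" by simp
  qed
  finally have "(\<Sum>a\<in>(\<lambda>i. i + 2) ` I. f a) = f 1" using I(2) by simp
  moreover have "(\<lambda>i. i + 2) ` I \<subseteq> {2..<m}" using I(1) by auto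
  ultimately show "\<exists>S\<subseteq>{2..<m}. (\<Sum>a\<in>S. f a) = f 1" by blast
next
  assume "\<exists>S\<subseteq>{2..<m}. (\<Sum>a\<in>S. f a) = f 1"
  then obtain S where S: "S \<subseteq> {2..<m}" "(\<Sum>a\<in>S. f a) = f 1" by blast
  have inj: "inj_on (\<lambda>a. a - 2) S"
  proof (rule inj_onI)
    fix a b assume "a \<in> S" "b \<in> S" "a - 2 = b - 2"
    moreover from this have "2 \<le> a" "2 \<le> b" using S(1) by auto
    ultimately show "a = b" by linarith
  qed
  have "(\<Sum>i\<in>(\<lambda>a. a - 2) ` S. map f [1..<m] ! Suc i) = (\<Sum>a\<in>S. map f [1..<m] ! Suc (a - 2))"
    by (simp add: sum.reindex[OF inj])
  also have "\<dots> = (\<Sum>a\<in>S. f a)"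
  proof (rule sum.cong[OF refl])
    fix a assume "a \<in> S"
    then have "2 \<le> a" "a < m" using S(1) by auto
    then obtain b where "a = 2 + b" using le_Suc_ex by blast
    then show "map f [1..<m] ! Suc (a - 2) = f a" using \<open>a < m\<close> by simp
  qed
  finally have "(\<Sum>i\<in>(\<lambda>a. a - 2) ` S. map f [1..<m] ! Suc i) = f 1" using S(2) by simp
  moreover have "(\<lambda>a. a - 2) ` S \<subseteq> {..<length (map f [1..<m]) - 1}"
  proof (rule image_subsetI)
    fix a assume "a \<in> S"
    then have "2 \<le> a" "a < m" using S(1) by auto
    then show "a - 2 \<in> {..<length (map f [1..<m]) - 1}" by simp
  qed
  moreover have "map f [1..<m] ! 0 = f 1" using assms by simp
  ultimately show "subset_sum (map f [1..<m])"
    unfolding subset_sum_def by (intro exI[of _ "(\<lambda>a. a - 2) ` S"] conjI) simp_all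
qed

text \<open>There are at most five events per token and \<open>k + 2 * n + 2\<close> final ones,
  where \<open>k\<close> and \<open>n\<close> are bounded by the length of \<open>y\<close>.\<close>

lemma length_events_less:
  assumes "accepts t d y C"
  shows "length (circuit_events (length C) C @ final_events (init y 0 1) (length C)) < 12 * (length y + 1)"
proof -
  have "drop 2 y = concat (map encode_gate C)"
    using assms parse_list_ok[of "drop 2 y"] by (simp add: accepts_def)
  then have "length (concat (map encode_gate C)) \<le> length y" by (metis diff_le_self length_drop)
  moreover have "init y 0 1 \<le> length C" using assms by (simp add: accepts_def)
  ultimately show ?thesis
    using length_circuit_events[of "length C" C] length_le_encoding[of C]
    by (simp add: final_events_def)
qed

lemma circuit_numbers_correct: "y \<in> fst (WCS t d) \<longleftrightarrow> subset_sum (circuit_numbers t d y)"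
proof (cases "Ex (accepts t d y)")
  case True
  then obtain C where C: "accepts t d y C" by blast
  let ?n = "length C" and ?k = "init y 0 1" and ?B = "12 * (length y + 1)"
  let ?ev = "circuit_events ?n C @ final_events ?k ?n"
  have n: "init y 0 2 = ?n" "parse_list (drop 2 y) = Expect_tag C" "?k \<le> ?n"
    using C by (auto simp: accepts_def)
  have "circuit_numbers t d y = map (tally ?B ?ev) [1..<2 + 2 * ?n + ?n * ?n]"
    using True n(1,2) by (simp add: circuit_numbers_def)
  moreover have "y \<in> fst (WCS t d) \<longleftrightarrow> (\<exists>A\<subseteq>input_gates C. card A = ?k \<and> satisfies A C)"
  proof -
    have "D = C" if "accepts t d y D" for D using that n(2) by (simp add: accepts_def)
    then show ?thesis unfolding WCS_iff using C by blast
  qed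
  ultimately show ?thesis
    using satisfiable_iff_tally[OF accepts_wf[OF C] n(3) length_events_less[OF C]]
    by (simp only: subset_sum_map_upt)
next
  case False
  have "(\<Sum>i\<in>I. [1, 0] ! Suc i) = (0::nat)" if "I \<subseteq> {..<length [1::nat, 0] - 1}" for I
    using that by (intro sum.neutral) auto
  then have "\<not> subset_sum [1, 0]" unfolding subset_sum_def by fastforce
  then show ?thesis using False by (auto simp: WCS_iff circuit_numbers_def)
qed

lemma length_circuit_numbers:
  "accepts t d y C \<Longrightarrow> length (circuit_numbers t d y) = 1 + 2 * length C + length C * length C"
  by (auto simp: circuit_numbers_def accepts_def)

text \<open>At least one item besides the target is required for the gadget to have a positive bound
  on the number of vertices.\<close>

lemma length_circuit_numbers_ge: "2 \<le> length (circuit_numbers t d y)"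
proof (cases "Ex (accepts t d y)")
  case True
  then obtain C where C: "accepts t d y C" by blast
  then have "C \<noteq> []" by (simp add: accepts_def)
  then have "0 < length C" by simp
  then show ?thesis unfolding length_circuit_numbers[OF C] by linarith
qed (simp add: circuit_numbers_def)

lemma length_circuit_numbers_le: "length (circuit_numbers t d y) \<le> 4 * (length y + 1) ^ 2"
proof (cases "Ex (accepts t d y)")
  case True
  then obtain C where C: "accepts t d y C" by blast
  let ?n = "length C"
  have "drop 2 y = concat (map encode_gate C)"
    using C parse_list_ok[of "drop 2 y"] by (simp add: accepts_def)
  then have "?n \<le> length y" using length_le_encoding[of C] by (metis diff_le_self le_trans length_drop)
  then have "1 + 2 * ?n + ?n * ?n \<le> 1 + 2 * length y + length y * length y"
    by (intro add_mono mult_mono) auto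
  moreover have "length (circuit_numbers t d y) = 1 + 2 * ?n + ?n * ?n"
    using C by (rule length_circuit_numbers)
  ultimately show ?thesis by (simp add: power2_eq_square)
next
  case False
  then have "circuit_numbers t d y = [1, 0]" unfolding circuit_numbers_def by (rule if_not_P)
  then show ?thesis by (simp add: power2_eq_square)
qed

subsection \<open>The program\<close>

text \<open>A maximum with default 0, updated element by element like the corresponding memory
  cell.\<close>

definition best :: "(nat \<Rightarrow> nat) \<Rightarrow> nat list \<Rightarrow> nat" where
  "best h js = foldl (\<lambda>m j. max m (h j)) 0 js"

lemma best_simps [simp]: "best h [] = 0" "best h (js @ [j]) = max (best h js) (h j)"
  by (simp_all add: best_def)

lemma best_eq_Max: "js \<noteq> [] \<Longrightarrow> best (\<lambda>j. h j + c) js = c + Max (h ` set js)"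
proof (induction js rule: rev_nonempty_induct)
  case (snoc j js)
  then have "Max (h ` set (js @ [j])) = max (Max (h ` set js)) (h j)"
    by (simp add: max.commute)
  then show ?case using snoc by (simp add: max_add_distrib_left max_add_distrib_right)
qed (simp add: best_def)

abbreviation depths :: "circuit \<Rightarrow> nat list" where
  "depths \<equiv> foldl (\<lambda>ds g. ds @ [gate_depth ds g]) []"

abbreviation wefts :: "circuit \<Rightarrow> nat list" where
  "wefts \<equiv> foldl (\<lambda>ws g. ws @ [gate_weft ws g]) []"

text \<open>Addresses and exponents that do not read array 1 keep their values while it is being
  changed, so a sequence of additions to it acts like a simultaneous one.\<close>

fun avoids_output :: "exp \<Rightarrow> bool" where
  "avoids_output (Const n) \<longleftrightarrow> True"
| "avoids_output (Get a e) \<longleftrightarrow> a \<noteq> 1 \<and> avoids_output e"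
| "avoids_output (Add e1 e2) \<longleftrightarrow> avoids_output e1 \<and> avoids_output e2"
| "avoids_output (Sub e1 e2) \<longleftrightarrow> avoids_output e1 \<and> avoids_output e2"

lemma eval_avoids_output: "avoids_output e \<Longrightarrow> eval e (r(1 := h)) = eval e r"
  by (induction e) auto

lemma avoids_output_times_exp [simp]: "avoids_output e \<Longrightarrow> avoids_output (times_exp k e)"
  by (induction k) auto

text \<open>Array 5 holds the powers of the base \<open>B\<close>.\<close>

fun bumps :: "(exp \<times> exp) list \<Rightarrow> prog" where
  "bumps [] = Nop"
| "bumps ((e, f) # l) = Asg 1 e (Add (Get 1 e) (Get 5 f)) ;; bumps l"

fun bump_sum :: "(exp \<times> exp) list \<Rightarrow> state \<Rightarrow> nat \<Rightarrow> nat" where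
  "bump_sum [] r a = 0"
| "bump_sum ((e, f) # l) r a = (if eval e r = a then r 5 (eval f r) else 0) + bump_sum l r a"

lemma run_bumps:
  assumes "\<forall>(e, f)\<in>set l. avoids_output e \<and> avoids_output f"
  shows "run (bumps l) r = r(1 := \<lambda>a. r 1 a + bump_sum l r a)"
  using assms
proof (induction l arbitrary: r)
  case (Cons p l)
  obtain e f where p: "p = (e, f)" by fastforce
  let ?r = "r(1 := (r 1)(eval e r := r 1 (eval e r) + r 5 (eval f r)))"
  have *: "bump_sum l ?r a = bump_sum l r a" for a
  proof -
    have "\<forall>(e, f)\<in>set l. avoids_output e \<and> avoids_output f" using Cons.prems by simp
    then show ?thesis
      by (induction l) (auto simp: eval_avoids_output[unfolded One_nat_def])
  qed
  have "run (bumps (p # l)) r = run (bumps l) ?r" by (simp add: p)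
  also have "\<dots> = ?r(1 := \<lambda>a. ?r 1 a + bump_sum l ?r a)" using Cons by auto
  also have "\<dots> = r(1 := \<lambda>a. r 1 a + bump_sum (p # l) r a)"
    unfolding * by (auto simp: p fun_eq_iff)
  finally show ?case .
qed simp

declare bumps.simps [simp del]

lemma writes_bumps: "writes (bumps l) \<subseteq> {1}"
  by (induction l rule: bumps.induct) (auto simp: bumps.simps)

lemma wf_bumps [simp]: "wf_prog (bumps l)"
  by (induction l rule: bumps.induct) (auto simp: bumps.simps)

lemma not_in_writes_bumps [simp]: "a \<noteq> 1 \<Longrightarrow> a \<notin> writes (bumps l)"
  using writes_bumps[of l] by auto

text \<open>
  Arrays: 3 and 4 loop counters, 5 powers of \<open>B\<close>, 7 the index \<open>g\<close> of the current gate, 16 the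
  number \<open>n * g\<close>, 8 the mode of the parser, 6 and 9 whether the current gate is a conjunction
  or a disjunction, 10 the number of missing predecessors, 11 whether the current gate is large, 12 the error flag,
  13 the last gate (plus 1) that used a gate as predecessor, 14 depths, 15 wefts.
\<close>

abbreviation token :: exp where
  "token \<equiv> Get 0 (Add (Var 3) (Const 3))"

abbreviation gates :: exp where
  "gates \<equiv> Get 0 (Const 2)"

abbreviation twice_gate :: exp where
  "twice_gate \<equiv> times_exp 2 (Var 7)"

abbreviation fail :: prog where
  "fail \<equiv> Asg 12 (Const 0) (Const 1)"

abbreviation next_gate :: prog where
  "next_gate \<equiv> Asg 7 (Const 0) (Add (Var 7) (Const 1)) ;; Asg 16 (Const 0) (Add (Var 16) gates)"

definition start_bumps :: prog where
  "start_bumps = bumps [(Add twice_gate (Const 2), Add twice_gate (Const 1)),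
     (Add twice_gate (Const 3), Add twice_gate (Const 1)), (Const 1, Add twice_gate (Const 1))]"

definition input_bumps :: prog where
  "input_bumps = bumps [(Add twice_gate (Const 2), Const 0)]"

definition out_bumps :: prog where
  "out_bumps = bumps [(Add (Add twice_gate (Const 2)) (Var 9), Add twice_gate (Const 2)),
     (Const 1, Add twice_gate (Const 2))]"

definition pred_bumps :: prog where
  "pred_bumps = bumps [(Add (Add (times_exp 2 token) (Const 2)) (Var 6), Add twice_gate (Const 2)),
     (Add (Add twice_gate (Const 2)) (Var 9), Add twice_gate (Const 2)),
     (Add (Add (times_exp 2 gates) (Const 2)) (Add (Var 16) token), Add twice_gate (Const 2)),
     (Const 1, Add twice_gate (Const 2))]"

text \<open>For a token \<open>x\<close> up to 3, truncated subtraction makes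
  \<open>x - 1 - 2 * (x - 2)\<close> the indicator of tag 2, and \<open>x - 2\<close> that of tag
  3.\<close>

definition tag_prog :: prog where
  "tag_prog = If (Sub token (Const 3)) fail (
     Asg 6 (Const 0) (Sub (Sub token (Const 1)) (times_exp 2 (Sub token (Const 2)))) ;;
     Asg 9 (Const 0) (Sub token (Const 2)) ;;
     start_bumps ;;
     If token (
       out_bumps ;;
       If (Sub token (Const 1)) (Asg 8 (Const 0) (Const 1)) (
         Asg 10 (Const 0) (Const 1) ;; Asg 11 (Const 0) (Const 0) ;; Asg 8 (Const 0) (Const 2)))
     (input_bumps ;; next_gate))"

definition arity_prog :: prog where
  "arity_prog = If (Sub (Const 2) token) fail (
     Asg 10 (Const 0) token ;;
     If (Sub token (Const 2)) (Asg 11 (Const 0) (Const 1)) (Asg 11 (Const 0) (Const 0)) ;;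
     Asg 8 (Const 0) (Const 2))"

text \<open>Stamping a predecessor with the number of the current gate plus 1 detects repetitions
  without clearing array 13 between gates. The assignments to arrays 14 and 15 compute a maximum as
  \<open>a + (b - a)\<close>.\<close>

definition pred_prog :: prog where
  "pred_prog = If (Sub (Add token (Const 1)) (Var 7)) fail (
     If (Sub (Get 13 token) (Var 7)) fail (
     Asg 13 token (Add (Var 7) (Const 1)) ;;
     Asg 14 (Var 7) (Add (Get 14 (Var 7)) (Sub (Add (Get 14 token) (Const 1)) (Get 14 (Var 7)))) ;;
     Asg 15 (Var 7) (Add (Get 15 (Var 7)) (Sub (Add (Get 15 token) (Var 11)) (Get 15 (Var 7)))) ;;
     pred_bumps ;;
     Asg 10 (Const 0) (Sub (Var 10) (Const 1)) ;;
     If (Var 10) Nop (Asg 8 (Const 0) (Const 0) ;; next_gate)))"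

definition step_prog :: prog where
  "step_prog = If (Var 8) (If (Sub (Var 8) (Const 1)) pred_prog arity_prog) tag_prog"

text \<open>The inner loop adds up \<open>B\<close> copies of \<open>B ^ i\<close>, since its number
  of rounds is the base itself.\<close>

definition powers_prog :: prog where
  "powers_prog = Asg 5 (Const 0) (Const 1) ;;
     Loop 3 (Loop 4 (Asg 5 (Add (Var 3) (Const 1)) (Add (Get 5 (Add (Var 3) (Const 1))) (Get 5 (Var 3)))))"

definition parse_prog :: prog where
  "parse_prog = For 3 (Sub (Var 0) (Const 2)) step_prog"

text \<open>A sum of truncated differences vanishes iff all of them do. They stand for the error
  flag, an unfinished gate, a wrong gate count (two summands), an empty circuit, too large depth or
  weft, and too large \<open>k\<close>.\<close>

definition rejection :: "nat \<Rightarrow> nat \<Rightarrow> exp" where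
  "rejection t d = Add (Var 12) (Add (Var 8) (Add (Sub (Var 7) gates) (Add (Sub gates (Var 7))
     (Add (Sub (Const 1) (Var 7)) (Add (Sub (Get 14 (Sub (Var 7) (Const 1))) (Const d))
     (Add (Sub (Get 15 (Sub (Var 7) (Const 1))) (Const t)) (Sub (Get 0 (Const 1)) (Var 7))))))))"

text \<open>On acceptance, array 16 holds \<open>n * n\<close>, so the output length needs no
  product. Entries of the output that received no event are zero from the start.\<close>

definition finish_prog :: "nat \<Rightarrow> nat \<Rightarrow> prog" where
  "finish_prog t d = If (rejection t d)
     (Asg 1 (Const 1) (Const 1) ;; Asg 1 (Const 2) (Const 0) ;; Asg 1 (Const 0) (Const 2))
     (Asg 1 twice_gate (Add (Get 1 twice_gate) (Add (Var 7) (Const 1))) ;;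
      Asg 1 (Const 1) (Add (Get 1 (Const 1)) (Add (Get 0 (Const 1)) (Add (Var 7) (Const 1)))) ;;
      Asg 1 (Const 0) (Add (Add twice_gate (Const 1)) (Var 16)))"

definition circuit_prog :: "nat \<Rightarrow> nat \<Rightarrow> prog" where
  "circuit_prog t d = powers_prog ;; parse_prog ;; finish_prog t d"

lemmas step_defs = tag_prog_def arity_prog_def pred_prog_def start_bumps_def input_bumps_def
  out_bumps_def pred_bumps_def

lemma wf_circuit_prog: "wf_prog (circuit_prog t d)"
  by (simp add: circuit_prog_def powers_prog_def parse_prog_def finish_prog_def step_prog_def step_defs)

lemma step_prog_frame: "a \<in> {0, 2, 3, 5} \<Longrightarrow> run step_prog r a = r a"
  by (rule run_frame) (auto simp: step_prog_def step_defs)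

section \<open>Correctness of the circuit program\<close>

context
  fixes y :: "nat list" and B n :: nat
  defines "B \<equiv> 12 * (length y + 1)" and "n \<equiv> init y 0 2"
begin

text \<open>Position \<open>length C\<close> is left open in arrays 14 and 15: there the maximum for
  the gate under construction builds up.\<close>

definition counters :: "circuit \<Rightarrow> state \<Rightarrow> bool" where
  "counters C r \<longleftrightarrow> r 12 0 = 0 \<and> r 7 0 = length C \<and> r 16 0 = n * length C \<and>
     (\<forall>i<length C. r 14 i = depths C ! i \<and> r 15 i = wefts C ! i) \<and>
     (\<forall>i>length C. r 14 i = 0 \<and> r 15 i = 0)"

definition fresh :: "circuit \<Rightarrow> state \<Rightarrow> bool" where
  "fresh C r \<longleftrightarrow> r 14 (length C) = 0 \<and> r 15 (length C) = 0 \<and> (\<forall>j. r 13 j \<le> length C)"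

definition flags :: "nat \<Rightarrow> state \<Rightarrow> bool" where
  "flags t r \<longleftrightarrow> r 6 0 = of_bool (t = 2) \<and> r 9 0 = of_bool (t = 3)"

text \<open>Index 0 is exempt because it is kept for the output length.\<close>

definition written :: "event list \<Rightarrow> state \<Rightarrow> bool" where
  "written ev r \<longleftrightarrow> (\<forall>a\<ge>1. r 1 a = tally B ev a)"

text \<open>After a failure the program keeps processing tokens, so nothing is known but the flag,
  which no step clears.\<close>

fun represents :: "parse \<Rightarrow> state \<Rightarrow> bool" where
  "represents Failed r \<longleftrightarrow> r 12 0 = 1"
| "represents (Expect_tag C) r \<longleftrightarrow> counters C r \<and> fresh C r \<and> r 8 0 = 0 \<and>
     written (parse_events n (Expect_tag C)) r"
| "represents (Expect_arity C t) r \<longleftrightarrow> counters C r \<and> fresh C r \<and> flags t r \<and> r 8 0 = 1 \<and>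
     written (parse_events n (Expect_arity C t)) r"
| "represents (Expect_pred C t q js) r \<longleftrightarrow> counters C r \<and> flags t r \<and> r 8 0 = 2 \<and> r 10 0 = q \<and>
     r 11 0 = of_bool (2 < q + length js) \<and>
     (\<forall>j. r 13 j \<le> length C + 1 \<and> (r 13 j = length C + 1 \<longleftrightarrow> j \<in> set js)) \<and>
     r 14 (length C) = best (\<lambda>j. depths C ! j + 1) js \<and>
     r 15 (length C) = best (\<lambda>j. wefts C ! j + r 11 0) js \<and>
     written (parse_events n (Expect_pred C t q js)) r"

definition constants :: "state \<Rightarrow> bool" where
  "constants r \<longleftrightarrow> r 0 = init y 0 \<and> r 2 0 = B \<and> (\<forall>j\<le>B. r 5 j = B ^ j)"

lemma counters_snoc_Input:
  "counters C r \<Longrightarrow> fresh C r \<Longrightarrow> q 12 = r 12 \<Longrightarrow> q 14 = r 14 \<Longrightarrow> q 15 = r 15 \<Longrightarrow>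
    q 7 0 = length C + 1 \<Longrightarrow> q 16 0 = n * length C + n \<Longrightarrow> counters (C @ [Input]) q"
  by (auto simp: counters_def fresh_def nth_append length_foldl_snoc gate_depth_def gate_weft_def
      less_Suc_eq)

lemma represents_tag_step:
  assumes r: "represents (Expect_tag C) r" and c: "constants r" and C: "2 * length C + 2 \<le> B"
  shows "represents (parse_step (Expect_tag C) (init y 0 (r 3 0 + 3))) (run tag_prog r)"
proof -
  define x where "x = init y 0 (r 3 0 + 3)"
  define g where "g = length C"
  have r': "r 0 = init y 0" "r 7 0 = g" "r 16 0 = n * g" "r 8 0 = 0" "r 12 0 = 0"
    "counters C r" "fresh C r" "\<And>a. 1 \<le> a \<Longrightarrow> r 1 a = tally B (circuit_events n C) a"
    using r c by (auto simp: counters_def written_def constants_def g_def)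
  have pow: "r 5 0 = 1" "r 5 (2 * g + 1) = B ^ (2 * g + 1)" "r 5 (2 * g + 2) = B ^ (2 * g + 2)"
    using c C by (auto simp: constants_def g_def)
  have tok: "init y 0 (r 3 0 + 3) = x" by (simp add: x_def)
  consider "x = 0" | "x = 1" | "x = 2" | "x = 3" | "3 < x" by linarith
  then show ?thesis
  proof cases
    case 1
    let ?q = "run tag_prog r"
    have "written (circuit_events n (C @ [Input])) ?q"
      using r' pow 1 tok
      by (auto simp: written_def step_defs run_bumps circuit_events_snoc gate_events_def
          start_events_def g_def[symmetric])
    moreover have q: "?q 12 = r 12" "?q 13 = r 13" "?q 14 = r 14" "?q 15 = r 15" "?q 7 0 = length C + 1"
      "?q 16 0 = n * length C + n" "?q 8 0 = 0"
      using r' 1 tok by (simp_all add: step_defs run_bumps g_def n_def)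
    moreover have "counters (C @ [Input]) ?q"
      using r'(6,7) q by (intro counters_snoc_Input)
    moreover have "fresh (C @ [Input]) ?q"
      using r'(6,7) q by (auto simp: fresh_def counters_def le_Suc_eq)
    ultimately show ?thesis using 1 tok by simp
  next
    case 2
    let ?q = "run tag_prog r"
    have "written (circuit_events n C @ gate_events n 1 g []) ?q"
      using r' pow 2 tok
      by (auto simp: written_def step_defs run_bumps gate_events_def start_events_def out_lit_def)
    moreover have q: "?q 12 = r 12" "?q 13 = r 13" "?q 14 = r 14" "?q 15 = r 15" "?q 7 = r 7"
      "?q 16 = r 16" "?q 8 0 = 2" "?q 6 0 = 0" "?q 9 0 = 0" "?q 10 0 = 1" "?q 11 0 = 0"
      using r' 2 tok by (simp_all add: step_defs run_bumps)
    moreover have "counters C ?q" using r'(6) q by (simp add: counters_def)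
    \<comment> \<open>All stamps stem from earlier gates, so no gate counts as already used by the
      new one.\<close>
    moreover have "r 13 j \<noteq> Suc (length C)" "r 13 j \<le> Suc (length C)" for j
      using r'(7) by (auto simp: fresh_def le_Suc_eq) (metis not_less_eq_eq order_refl)
    ultimately show ?thesis using 2 tok r'(7) by (simp add: flags_def g_def fresh_def)
  next
    case 3
    let ?q = "run tag_prog r"
    have "written (circuit_events n C @ start_events 2 g) ?q"
      using r' pow 3 tok
      by (auto simp: written_def step_defs run_bumps start_events_def out_lit_def)
    moreover have q: "?q 12 = r 12" "?q 13 = r 13" "?q 14 = r 14" "?q 15 = r 15" "?q 7 = r 7"
      "?q 16 = r 16" "?q 8 0 = 1" "?q 6 0 = 1" "?q 9 0 = 0"
      using r' 3 tok by (simp_all add: step_defs run_bumps)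
    moreover have "counters C ?q" using r'(6) q by (simp add: counters_def)
    moreover have "fresh C ?q" using r'(7) q by (simp add: fresh_def)
    ultimately show ?thesis using 3 tok by (simp add: flags_def g_def)
  next
    case 4
    let ?q = "run tag_prog r"
    have "written (circuit_events n C @ start_events 3 g) ?q"
      using r' pow 4 tok
      by (auto simp: written_def step_defs run_bumps start_events_def out_lit_def)
    moreover have q: "?q 12 = r 12" "?q 13 = r 13" "?q 14 = r 14" "?q 15 = r 15" "?q 7 = r 7"
      "?q 16 = r 16" "?q 8 0 = 1" "?q 6 0 = 0" "?q 9 0 = 1"
      using r' 4 tok by (simp_all add: step_defs run_bumps)
    moreover have "counters C ?q" using r'(6) q by (simp add: counters_def)
    moreover have "fresh C ?q" using r'(7) q by (simp add: fresh_def)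
    ultimately show ?thesis using 4 tok by (simp add: flags_def g_def)
  next
    case 5
    then show ?thesis using r' tok by (simp add: step_defs)
  qed
qed

lemma represents_arity_step:
  assumes r: "represents (Expect_arity C t) r" and c: "constants r"
    and ok: "parse_ok (Expect_arity C t)"
  shows "represents (parse_step (Expect_arity C t) (init y 0 (r 3 0 + 3))) (run arity_prog r)"
proof -
  define x where "x = init y 0 (r 3 0 + 3)"
  have tok: "init y 0 (r 3 0 + 3) = x" by (simp add: x_def)
  have r': "r 0 = init y 0" "counters C r" "fresh C r" "flags t r"
    "written (circuit_events n C @ start_events t (length C)) r"
    using r c by (auto simp: constants_def)
  show ?thesis
  proof (cases "2 \<le> x")
    case True
    let ?q = "run arity_prog r"
    have q: "?q 12 = r 12" "?q 13 = r 13" "?q 14 = r 14" "?q 15 = r 15" "?q 7 = r 7" "?q 1 = r 1"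
      "?q 16 = r 16" "?q 8 0 = 2" "?q 6 = r 6" "?q 9 = r 9" "?q 10 0 = x" "?q 11 0 = of_bool (2 < x)"
      using r' True tok by (simp_all add: arity_prog_def)
    have "counters C ?q" "flags t ?q" using r' q by (simp_all add: counters_def flags_def)
    moreover have "written (circuit_events n C @ gate_events n t (length C) []) ?q"
      using r' q by (simp add: written_def gate_events_def)
    moreover have "r 13 j \<noteq> Suc (length C)" "r 13 j \<le> Suc (length C)" for j
      using r'(3) by (auto simp: fresh_def le_Suc_eq) (metis not_less_eq_eq order_refl)
    ultimately show ?thesis using True tok q r'(3) by (simp add: fresh_def)
  next
    case False
    then show ?thesis using r' tok by (simp add: arity_prog_def)
  qed
qed

lemma tag_make_gate: "t = 1 \<and> length js = 1 \<or> t = 2 \<or> t = 3 \<Longrightarrow> tag (make_gate t js) = t"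
  by (auto simp: make_gate_def)

lemma preds_make_gate: "t = 1 \<and> length js = 1 \<or> t = 2 \<or> t = 3 \<Longrightarrow> preds (make_gate t js) = js"
  by (cases js) (auto simp: make_gate_def)

lemma represents_pred_step:
  assumes r: "represents (Expect_pred C t q js) r" and c: "constants r" and C: "2 * length C + 2 \<le> B"
    and ok: "parse_ok (Expect_pred C t q js)"
  shows "represents (parse_step (Expect_pred C t q js) (init y 0 (r 3 0 + 3))) (run pred_prog r)"
proof -
  define x where "x = init y 0 (r 3 0 + 3)"
  define g where "g = length C"
  have tok: "init y 0 (r 3 0 + 3) = x" by (simp add: x_def)
  have r': "r 0 = init y 0" "r 7 0 = g" "r 16 0 = n * g" "r 8 0 = 2" "r 12 0 = 0" "r 10 0 = q"
    "r 11 0 = of_bool (2 < q + length js)" "r 6 0 = of_bool (t = 2)" "r 9 0 = of_bool (t = 3)"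
    "\<And>j. r 13 j \<le> g + 1" "\<And>j. r 13 j = g + 1 \<longleftrightarrow> j \<in> set js"
    "\<And>i. i < g \<Longrightarrow> r 14 i = depths C ! i" "\<And>i. i < g \<Longrightarrow> r 15 i = wefts C ! i"
    "\<And>i. g < i \<Longrightarrow> r 14 i = 0" "\<And>i. g < i \<Longrightarrow> r 15 i = 0"
    "r 14 g = best (\<lambda>j. depths C ! j + 1) js" "r 15 g = best (\<lambda>j. wefts C ! j + r 11 0) js"
    "\<And>a. 1 \<le> a \<Longrightarrow> r 1 a = tally B (circuit_events n C @ gate_events n t g js) a"
    using r c by (auto simp: counters_def flags_def written_def constants_def g_def)
  have pow: "r 5 (2 * g + 2) = B ^ (2 * g + 2)"
    using c C by (auto simp: constants_def g_def)
  show ?thesis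
  proof (cases "x < g \<and> x \<notin> set js")
    case False
    then consider "g \<le> x" | "x < g" "r 13 x = g + 1" using r'(11) by fastforce
    then have "run pred_prog r 12 0 = 1"
    proof cases
      case 1
      then show ?thesis using r'(1,2) tok by (simp add: pred_prog_def)
    next
      case 2
      then show ?thesis using r'(1,2) tok by (simp add: pred_prog_def)
    qed
    then show ?thesis using False tok by (auto simp: g_def)
  next
    case True
    have "r 13 x \<le> g" using r'(10,11)[of x] True by fastforce
    let ?q = "run pred_prog r" and ?js = "js @ [x]"
    have max: "a + (b - a) = max a b" for a b :: nat by (simp add: max_def)
    have "x + 1 - g = 0" "r 13 x - g = 0" using True \<open>r 13 x \<le> g\<close> by simp_all
    note guard = this
    have q: "?q 12 = r 12" "?q 6 = r 6" "?q 9 = r 9" "?q 11 = r 11" "?q 13 = (r 13)(x := g + 1)"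
      "?q 14 = (r 14)(g := max (r 14 g) (r 14 x + 1))"
      "?q 15 = (r 15)(g := max (r 15 g) (r 15 x + r 11 0))" "?q 10 0 = q - 1"
      "?q 8 0 = (if q \<le> 1 then 0 else 2)" "?q 7 0 = (if q \<le> 1 then g + 1 else g)"
      "?q 16 0 = (if q \<le> 1 then n * g + n else n * g)"
      using r'(1-9) tok guard True
      by (simp_all add: pred_prog_def pred_bumps_def run_bumps max n_def)
    have "?q 1 a = tally B (circuit_events n C @ gate_events n t g ?js) a" if "1 \<le> a" for a
      using r'(1-9) r'(18)[OF that] tok guard True pow that
      by (auto simp: pred_prog_def pred_bumps_def run_bumps gate_events_def pred_events_def
          in_lit_def out_lit_def slack_def n_def add.assoc)
    then have out: "written (circuit_events n C @ gate_events n t g ?js) ?q" by (simp add: written_def)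
    have depth: "?q 14 g = best (\<lambda>j. depths C ! j + 1) ?js"
      unfolding q using r'(12,16) True by simp
    have weft: "?q 15 g = best (\<lambda>j. wefts C ! j + r 11 0) ?js"
      unfolding q using r'(13,17) True by simp
    show ?thesis
    proof (cases "q = 1")
      case False
      then have "1 < q" using ok by auto
      have "counters C ?q" using r'(3,5,12-15) q \<open>1 < q\<close> by (auto simp: counters_def g_def)
      moreover have "flags t ?q" using r'(8,9) q by (simp add: flags_def)
      moreover have "?q 13 j \<le> length C + 1 \<and> (?q 13 j = length C + 1 \<longleftrightarrow> j \<in> set ?js)" for j
        unfolding q using r'(10,11)[of j] by (auto simp: g_def)
      moreover have "?q 11 0 = of_bool (2 < q - 1 + length ?js)"
        using q(4) r'(7) \<open>1 < q\<close> by simp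
      moreover have "?q 8 0 = 2" using q(9) \<open>1 < q\<close> by simp
      moreover have "?q 11 0 = r 11 0" using q(4) by simp
      ultimately have "represents (Expect_pred C t (q - 1) ?js) ?q"
        unfolding represents.simps parse_events.simps using q(8) depth weft out
        by (simp only: g_def simp_thms)
      then show ?thesis using True False tok by (simp add: g_def)
    next
      case q1: True
      let ?g = "make_gate t ?js"
      have t: "t = 1 \<and> length ?js = 1 \<or> t = 2 \<or> t = 3" using ok by auto
      note gate = tag_make_gate[OF t] preds_make_gate[OF t]
      have "?g \<noteq> Input" by (auto simp: make_gate_def)
      \<comment> \<open>The offsets 1 and \<open>r 11 0\<close> are the summands in the recursions
        for depth and weft. As \<open>q = 1\<close>, the flag compares the full number of
        predecessors with 2.\<close>
      then have "gate_depth (depths C) ?g = best (\<lambda>j. depths C ! j + 1) ?js"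
        "gate_weft (wefts C) ?g = best (\<lambda>j. wefts C ! j + r 11 0) ?js"
        using r'(7) q1 best_eq_Max[of ?js "\<lambda>j. depths C ! j" 1] best_eq_Max[of ?js "\<lambda>j. wefts C ! j" "r 11 0"]
        by (simp_all add: gate_depth_def gate_weft_def gate del: best_simps)
      note val = this
      have "?q 14 i = depths (C @ [?g]) ! i \<and> ?q 15 i = wefts (C @ [?g]) ! i" if "i < length C + 1" for i
      proof (cases "i < g")
        case True
        then show ?thesis using q(6,7) r'(12,13) by (simp add: nth_append length_foldl_snoc g_def)
      next
        case False
        then have "i = length C" using that by (simp add: g_def)
        then show ?thesis using depth weft val by (simp add: nth_append length_foldl_snoc g_def)
      qed
      moreover have "?q 14 i = 0 \<and> ?q 15 i = 0" if "length C < i" for i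
        using that q(6,7) r'(14,15) by (simp add: g_def)
      moreover have "?q 12 0 = 0" "?q 7 0 = length C + 1" "?q 16 0 = n * length C + n" "?q 8 0 = 0"
        using q(1,9-11) r'(5) q1 by (simp_all add: g_def)
      ultimately have "counters (C @ [?g]) ?q" "fresh (C @ [?g]) ?q" "?q 8 0 = 0"
        using q(5) r'(10) by (auto simp: counters_def fresh_def g_def)
      moreover have "written (circuit_events n (C @ [?g])) ?q"
        using out by (simp only: circuit_events_snoc gate g_def)
      ultimately have "represents (Expect_tag (C @ [?g])) ?q" by simp
      then show ?thesis using True q1 tok by (simp add: g_def)
    qed
  qed
qed

fun parsed_circuit :: "parse \<Rightarrow> circuit" where
  "parsed_circuit Failed = []"
| "parsed_circuit (Expect_tag C) = C"
| "parsed_circuit (Expect_arity C t) = C"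
| "parsed_circuit (Expect_pred C t q js) = C"

lemma length_parsed_circuit: "length (parsed_circuit ps) \<le> length (parsed_tokens ps)"
  using length_le_encoding by (cases ps) (auto intro: le_SucI trans_le_add1)

lemma represents_step:
  assumes r: "represents ps r" and c: "constants r" and C: "2 * length (parsed_circuit ps) + 2 \<le> B"
    and ok: "ps \<noteq> Failed \<Longrightarrow> parse_ok ps"
  shows "represents (parse_step ps (init y 0 (r 3 0 + 3))) (run step_prog r)"
proof (cases ps)
  case Failed
  then show ?thesis
    using r by (auto simp: step_prog_def step_defs run_bumps)
next
  case (Expect_tag C)
  have "run step_prog r = run tag_prog r" using r Expect_tag by (simp add: step_prog_def)
  then show ?thesis using represents_tag_step[of C r] r c C Expect_tag by simp
next
  case (Expect_arity C t)
  have "run step_prog r = run arity_prog r" using r Expect_arity by (simp add: step_prog_def)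
  then show ?thesis using represents_arity_step[of C t r] r c ok Expect_arity by simp
next
  case (Expect_pred C t q js)
  have "run step_prog r = run pred_prog r" using r Expect_pred by (simp add: step_prog_def)
  then show ?thesis
    using represents_pred_step[of C t q js r] r c C ok Expect_pred
    by (simp only: parsed_circuit.simps) blast
qed

definition frame :: "state \<Rightarrow> bool" where
  "frame r \<longleftrightarrow> r 0 = init y 0 \<and> r 2 0 = B \<and> (\<forall>a. a \<notin> {0, 2, 3, 4, 5} \<longrightarrow> r a = (\<lambda>_. 0))"

definition start :: state where
  "start = (init y)(2 := (init y 2)(0 := B))"

lemma run_powers_prog: "frame (run powers_prog start) \<and> constants (run powers_prog start)"
proof -
  let ?I = "\<lambda>i r. frame r \<and> (\<forall>j\<le>i. r 5 j = B ^ j) \<and> (\<forall>j>i. r 5 j = 0)"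
  let ?p = "Asg 5 (Add (Var 3) (Const 1)) (Add (Get 5 (Add (Var 3) (Const 1))) (Get 5 (Var 3)))"
  let ?s = "run (Asg 5 (Const 0) (Const 1)) start"
  have s: "frame ?s" "?s 5 0 = 1" "\<forall>j>0. ?s 5 j = 0" "?s 2 0 = B"
    by (auto simp: frame_def start_def init_def)
  have "?I (?s 2 0) (run (Loop 3 (Loop 4 ?p)) ?s)"
  proof (rule run_Loop_invariant[where I = ?I])
    show "?I 0 (?s(3 := (?s 3)(0 := 0)))" using s by (simp add: frame_def)
  next
    fix i r assume I: "?I i r" and r: "r 3 0 = i"
    \<comment> \<open>After all \<open>B\<close> inner rounds, \<open>l * B ^ i\<close> has become
      the next power.\<close>
    let ?J = "\<lambda>l q. frame q \<and> q 3 0 = i \<and> (\<forall>j\<le>i. q 5 j = B ^ j) \<and> q 5 (Suc i) = l * B ^ i \<and>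
      (\<forall>j>Suc i. q 5 j = 0)"
    have "?J (r 2 0) (run (Loop 4 ?p) r)"
    proof (rule run_Loop_invariant[where I = ?J])
      show "?J 0 (r(4 := (r 4)(0 := 0)))" using I r by (simp add: frame_def)
    qed (auto simp: frame_def)
    moreover have "r 2 0 = B" using I by (simp add: frame_def)
    ultimately show "?I (Suc i) ((run (Loop 4 ?p) r)(3 := (run (Loop 4 ?p) r 3)(0 := Suc i)))"
      by (auto simp: frame_def le_Suc_eq simp del: run.simps)
  qed simp
  moreover have "run powers_prog start = run (Loop 3 (Loop 4 ?p)) ?s"
    by (simp only: powers_prog_def run.simps(3))
  ultimately show ?thesis using s(4) by (simp add: constants_def frame_def del: run.simps)
qed

lemma represents_frame: "represents ps (r(3 := h)) = represents ps r"
  by (cases ps) (simp_all add: counters_def fresh_def flags_def written_def)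

lemma run_parse_prog:
  "constants (run parse_prog (run powers_prog start)) \<and>
   represents (parse_list (drop 2 y)) (run parse_prog (run powers_prog start))"
proof -
  let ?s = "run powers_prog start"
  let ?I = "\<lambda>i r. constants r \<and> represents (parse_list (take i (drop 2 y))) r"
  have s: "frame ?s" "constants ?s" using run_powers_prog by auto
  have "?I (length y - 2) (run parse_prog ?s)"
    unfolding parse_prog_def
  proof (rule run_For_invariant[where I = ?I and n = "length y - 2"])
    have "represents (Expect_tag []) ?s"
      using s(1) by (simp add: frame_def counters_def fresh_def written_def circuit_events_def)
    then show "?I 0 (?s(3 := (?s 3)(0 := 0)))"
      using s(2) by (simp add: represents_frame constants_def)
    show "length y - 2 \<le> ?s 2 0" using s(2) by (simp add: constants_def B_def)
    show "3 \<notin> writes step_prog" by (simp add: step_prog_def step_defs)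
    show "eval (Sub (Var 0) (Const 2)) r = length y - 2" if "?I i r" for i r
      using that by (simp add: constants_def init_def)
    show "?I (length y - 2) (r(3 := (r 3)(0 := c)))" if "?I (length y - 2) r" for r c
      using that by (simp add: represents_frame constants_def)
  next
    fix i r assume i: "i < length y - 2" and I: "?I i r" and r: "r 3 0 = i"
    let ?ps = "parse_list (take i (drop 2 y))"
    have x: "init y 0 (i + 3) = drop 2 y ! i" using i by (auto simp: init_def)
    \<comment> \<open>No more gates than tokens have been read, so every digit in use has its power
      in array 5.\<close>
    have "length (parsed_circuit ?ps) \<le> length y"
      using length_parsed_circuit[of ?ps] parse_list_ok[of "take i (drop 2 y)"] i
      by (cases "?ps = Failed") auto
    then have "2 * length (parsed_circuit ?ps) + 2 \<le> B" by (simp add: B_def)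
    with I have "represents (parse_step ?ps (init y 0 (r 3 0 + 3))) (run step_prog r)"
      using parse_list_ok by (intro represents_step) auto
    moreover have "take (Suc i) (drop 2 y) = take i (drop 2 y) @ [drop 2 y ! i]"
      using i by (intro take_Suc_conv_app_nth) simp
    ultimately have "represents (parse_list (take (Suc i) (drop 2 y))) (run step_prog r)"
      using x r by simp
    moreover have "constants (run step_prog r)"
      using I step_prog_frame[of _ r] by (simp add: constants_def)
    ultimately show "?I (Suc i) ((run step_prog r)(3 := (run step_prog r 3)(0 := Suc i)))"
      by (simp add: represents_frame constants_def)
  qed
  then show ?thesis by simp
qed

lemma rejection_iff:
  assumes r: "represents (parse_list (drop 2 y)) r" and c: "constants r"
  shows "eval (rejection t d) r = 0 \<longleftrightarrow> Ex (accepts t d y)"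
proof (cases "parse_list (drop 2 y)")
  case (Expect_tag C)
  show ?thesis
  proof (cases "C = []")
    case True
    then show ?thesis
      using r Expect_tag by (auto simp: rejection_def accepts_def counters_def)
  next
    case False
    have len: "length (depths C) = length C" "length (wefts C) = length C"
      by (rule length_foldl_snoc)+
    with False have "depths C \<noteq> []" "wefts C \<noteq> []" by force+
    then have "depth C = depths C ! (length C - 1)" "weft C = wefts C ! (length C - 1)"
      unfolding depth_def weft_def by (simp_all add: last_conv_nth len)
    moreover have "r 12 0 = 0" "r 8 0 = 0" "r 7 0 = length C" "r 0 = init y 0"
      "r 14 (length C - 1) = depths C ! (length C - 1)" "r 15 (length C - 1) = wefts C ! (length C - 1)"
      using r c Expect_tag False by (auto simp: counters_def constants_def)
    ultimately have "eval (rejection t d) r = 0 \<longleftrightarrow> length C = n \<and> depth C \<le> d \<and> weft C \<le> t \<and>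
        init y 0 1 \<le> length C"
      using False by (auto simp: rejection_def n_def Suc_le_eq)
    moreover have "accepts t d y D \<longleftrightarrow> D = C \<and> length C = n \<and> depth C \<le> d \<and> weft C \<le> t \<and>
        init y 0 1 \<le> length C" for D
      using Expect_tag False by (auto simp: accepts_def n_def)
    ultimately show ?thesis by blast
  qed
qed (use r in \<open>auto simp: rejection_def accepts_def\<close>)

lemma result_circuit_prog: "result (run (circuit_prog t d) start) = circuit_numbers t d y"
proof -
  let ?s = "run parse_prog (run powers_prog start)"
  let ?q = "run (finish_prog t d) ?s"
  have s: "constants ?s" "represents (parse_list (drop 2 y)) ?s" using run_parse_prog by auto
  have "result ?q = circuit_numbers t d y"
  proof (cases "Ex (accepts t d y)")
    case False
    then have "eval (rejection t d) ?s \<noteq> 0" using rejection_iff[OF s(2,1)] by simp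
    then have "result ?q = [1, 0]" by (simp add: finish_prog_def result_def upt_rec)
    moreover have "circuit_numbers t d y = [1, 0]"
      using False unfolding circuit_numbers_def by (rule if_not_P)
    ultimately show ?thesis by simp
  next
    case True
    then obtain C where C: "accepts t d y C" by blast
    then have ps: "parse_list (drop 2 y) = Expect_tag C" "length C = n" "C \<noteq> []"
      by (auto simp: accepts_def n_def)
    from True have rej: "eval (rejection t d) ?s = 0" using rejection_iff[OF s(2,1)] by simp
    have n: "0 < n" using ps by auto
    have s': "?s 7 0 = n" "?s 16 0 = n * n" "?s 0 = init y 0"
      "\<And>a. 1 \<le> a \<Longrightarrow> ?s 1 a = tally B (circuit_events n C) a"
      using s ps by (auto simp: counters_def constants_def written_def)
    have len: "?q 1 0 = 1 + 2 * n + n * n"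
      using rej s' n by (simp add: finish_prog_def)
    have "?q 1 a = tally B (circuit_events n C @ final_events (init y 0 1) n) a" if "1 \<le> a" for a
      using rej s' n that by (simp add: finish_prog_def final_events_def)
    then have "map (\<lambda>i. ?q 1 (Suc i)) [0..<1 + 2 * n + n * n] =
        map (\<lambda>i. tally B (circuit_events n C @ final_events (init y 0 1) n) (Suc i)) [0..<1 + 2 * n + n * n]"
      by simp
    also have "\<dots> = map (tally B (circuit_events n C @ final_events (init y 0 1) n)) (map Suc [0..<1 + 2 * n + n * n])"
      by simp
    also have "\<dots> = circuit_numbers t d y"
      unfolding map_Suc_upt using True ps by (simp add: circuit_numbers_def B_def n_def)
    finally show ?thesis by (simp only: result_def len)
  qed
  then show ?thesis by (simp only: circuit_prog_def run.simps(3))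
qed

end

lemma fpt_bounded_circuit_numbers:
  obtains P where "fpt_bounded (\<lambda>_. 0) P (circuit_numbers t d)"
proof
  have "result (run (circuit_prog t d) ((init y)(2 := (init y 2)(0 := 12 * (length y + 1))))) =
      circuit_numbers t d y" for y
    using result_circuit_prog[of t d y] by (simp only: start_def)
  from fpt_bounded_code[OF wf_circuit_prog this length_circuit_numbers_le]
  show "fpt_bounded (\<lambda>_. 0) (Seq (Put 2 (Const 0) (times_exp 12 (Add (Var 0) (Const 1))))
      (code (circuit_prog t d))) (circuit_numbers t d)" .
qed

section \<open>The theorem\<close>

text \<open>A lone input gate is satisfied only by setting it, so the weight in the header decides;
  this is the format into which a known answer is turned.\<close>

lemma single_input_WCS: "[k, 1, 0] \<in> fst (WCS 1 1) \<longleftrightarrow> k = 1"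
proof
  assume "[k, 1, 0] \<in> fst (WCS 1 1)"
  then obtain C A where C: "[k, 1, 0] = encode_circuit k C" "A \<subseteq> input_gates C" "card A = k"
    "satisfies A C" by (auto simp: WCS_def encode_circuit_def)
  then have "length C = 1" "concat (map encode_gate C) = [0]" by (auto simp: encode_circuit_def)
  then obtain g where g: "C = [g]" "encode_gate g = [0]" by (cases C) auto
  then have "C = [Input]" by (cases g) auto
  with C(2,4) have "A = {0}" by (auto simp: input_gates_def satisfies_def)
  with C(3) show "k = 1" by simp
next
  assume "k = 1"
  then have "[k, 1, 0] = encode_circuit k [Input]" by (simp add: encode_circuit_def)
  moreover have "wf_circuit [Input]" "weft [Input] \<le> 1" "depth [Input] \<le> 1"
    by (auto simp: wf_circuit_def weft_def depth_def gate_weft_def gate_depth_def)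
  moreover have "{0} \<subseteq> input_gates [Input]" "satisfies {0} [Input]"
    by (auto simp: input_gates_def satisfies_def)
  ultimately show "[k, 1, 0] \<in> fst (WCS 1 1)"
    using \<open>k = 1\<close> unfolding WCS_def by (auto intro!: exI[of _ "[Input]"] exI[of _ "{0}"])
qed

lemma FPT_subset_W1: "FPT \<subseteq> W 1"
proof
  fix L :: pproblem assume "L \<in> FPT"
  then obtain Q \<kappa> P where L: "L = (Q, \<kappa>)" and P: "fpt_bounded \<kappa> P (\<lambda>x. [if x \<in> Q then 1 else 0])"
    by (auto simp: FPT_def)
  \<comment> \<open>Answer 1 becomes weight 1 and answer 0 weight 2, which also bounds the new
    parameter by 2.\<close>
  let ?F = "\<lambda>z. [2 - init z 0 1, 1, 0]"
  let ?p = "Asg 1 (Const 1) (Sub (Const 2) (Get 0 (Const 1))) ;; Asg 1 (Const 2) (Const 1) ;; Asg 1 (Const 0) (Const 3)"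
  \<comment> \<open>The program has no loop, so the factor 0 for the number of rounds will
    do.\<close>
  have res: "result (run ?p ((init z)(2 := (init z 2)(0 := 0 * (length z + 1))))) = ?F z" for z
    by (simp add: result_def upt_rec init_def)
  have "wf_prog ?p" by simp
  moreover have "length (?F z) \<le> 3 * (length z + 1) ^ 0" for z by simp
  ultimately have "fpt_bounded (\<lambda>_. 0) (Seq (Put 2 (Const 0) (times_exp 0 (Add (Var 0) (Const 1)))) (code ?p)) ?F"
    using res by (intro fpt_bounded_code)
  from fpt_bounded_comp[OF P this, of 0] obtain R where
    R: "fpt_bounded \<kappa> R (\<lambda>x. [2 - init [if x \<in> Q then 1 else 0] 0 1, 1, 0])"
    by auto
  have *: "[2 - init [if x \<in> Q then 1 else 0] 0 1, 1, 0] = [if x \<in> Q then 1 else 2, 1, 0]" for x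
    by (simp add: init_def)
  have "L \<le>\<^sub>f\<^sub>p\<^sub>t WCS 1 1"
    unfolding fpt_reducible_def
  proof (intro exI conjI allI)
    show "fpt_bounded (snd L) R (\<lambda>x. [if x \<in> Q then 1 else 2, 1, 0])"
      using R by (simp only: * L snd_conv)
    show "computable (\<lambda>_. 2)" by (rule computable_const)
    show "x \<in> fst L \<longleftrightarrow> [if x \<in> Q then 1 else 2, 1, 0] \<in> fst (WCS 1 1)" for x
      unfolding single_input_WCS by (simp add: L)
    show "snd (WCS 1 1) [if x \<in> Q then 1 else 2, 1, 0] \<le> 2" for x
      by (simp add: WCS_def)
  qed
  then show "L \<in> W 1" by (auto simp: W_def)
qed

text \<open>The parameter of \<open>L\<close> influences only the given reduction. The other two run
  in polynomial time, and the second of them ends in parameter values at most 1, the constant bound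
  required for composing with the assumed algorithm.\<close>

lemma W1_subset_FPT:
  assumes "(M_EPVCB, M_EPVCB_param) \<in> FPT"
  shows "W 1 \<subseteq> FPT"
proof
  fix L assume "L \<in> W 1"
  then obtain d P R where P: "fpt_bounded (snd L) P R" and R: "\<And>x. x \<in> fst L \<longleftrightarrow> R x \<in> fst (WCS 1 d)"
    by (auto simp: W_def fpt_reducible_def)
  obtain PC where PC: "fpt_bounded (\<lambda>_. 0) PC (circuit_numbers 1 d)"
    by (rule fpt_bounded_circuit_numbers)
  obtain PR where PR: "fpt_bounded (\<lambda>_. 0) PR (\<lambda>zs. encode (reduction zs))"
    by (rule fpt_bounded_reduction)
  from assms obtain PM where
    PM: "fpt_bounded M_EPVCB_param PM (\<lambda>x. [if x \<in> M_EPVCB then 1 else 0])"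
    by (auto simp: FPT_def)
  obtain P1 where P1: "fpt_bounded (snd L) P1 (\<lambda>x. circuit_numbers 1 d (R x))"
    by (rule fpt_bounded_comp[OF P PC order_refl])
  obtain P2 where P2: "fpt_bounded (snd L) P2 (\<lambda>x. encode (reduction (circuit_numbers 1 d (R x))))"
    by (rule fpt_bounded_comp[OF P1 PR order_refl])
  obtain P3 where P3: "fpt_bounded (snd L) P3
      (\<lambda>x. [if encode (reduction (circuit_numbers 1 d (R x))) \<in> M_EPVCB then 1 else 0])"
    by (rule fpt_bounded_comp[OF P2 PM encode_reduction_param])
  have "encode (reduction (circuit_numbers 1 d (R x))) \<in> M_EPVCB \<longleftrightarrow> x \<in> fst L" for x
    using encode_reduction_correct[OF length_circuit_numbers_ge] circuit_numbers_correct R by simp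
  with P3 have "fpt_bounded (snd L) P3 (\<lambda>x. [if x \<in> fst L then 1 else 0])" by simp
  then show "L \<in> FPT" by (cases L) (auto simp: FPT_def)
qed

theorem theorem7:
  assumes "FPT \<noteq> W 1"
  shows "(M_EPVCB, M_EPVCB_param) \<notin> FPT"
  using assms FPT_subset_W1 W1_subset_FPT by blast

end
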